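(* Let $1 \leq p < \infty$. Assume that $\Omega\subset\mathbb{H}$ is a non-empty open set with $3$-regular boundary, and assume that there is a constant $C_0<\infty$ such that $$\int_{B(p_{0},R)\cap\partial\Omega}\int_{0}^{R}\beta_{\partial\Omega,1}(B(q,r))^{p}\,\frac{dr}{r}\,d\mathcal{H}^{3}(q) \leq C_0 R^{3}, \qquad p_{0}\in\partial\Omega,\ 0<R\leq\operatorname{diam}\Omega,\ R<\infty.$$ Then $$\wp_{\Omega,p}(B(q,r)) \lesssim r^{3}, \qquad q\in\partial\Omega,\ 0<r\leq\operatorname{diam}\Omega,\ r<\infty,$$ where the implicit constant may depend on $p$, $C_0$ and the $3$-regularity constant of $\partial\Omega$, but not on $q$ or $r$.
   Context: The first Heisenberg group is $\mathbb{H} = (\mathbb{R}^{3},\cdot)$ with group law $(x,y,t)\cdot(x',y',t') = (x+x',y+y',t+t'+\tfrac12(xy'-x'y))$, equipped with the metric $d(p,q) = \|q^{-1}\cdot p\|$, $\|(x,y,t)\| = \max\{|(x,y)|, 2\sqrt{|t|}\}$. Balls $B(p,r)=\{q: d(p,q)<r\}$, distances, diameters and Hausdorff measures are with respect to $d$; $dp$ denotes Lebesgue measure on $\mathbb{R}^3$. A closed set $E \subset \mathbb{H}$ is $3$-regular if there is a constant $A\geq 1$ with $A^{-1}r^3 \leq \mathcal{H}^3(E\cap B(q,r)) \leq A r^3$ for all $q\in E$ and $0<r\leq\operatorname{diam}E$, $r<\infty$. Vertical perimeter: for measurable $\Omega,U\subset\mathbb{H}$ and $s>0$, $\mathrm{v}_{\Omega}(U)(s)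 = \int_{U}|\chi_\Omega(p)-\chi_\Omega(p\cdot(0,0,s^2))|\,dp$, and $$\wp_{\Omega,p}(U) := \left(\int_0^\infty \left(\frac{\mathrm{v}_\Omega(U)(s)}{s}\right)^p\frac{ds}{s}\right)^{1/p}.$$ $\beta$-numbers: a vertical subgroup $\mathbb{W}$ is a $2$-dimensional linear subspace of $\mathbb{R}^3$ containing the $t$-axis. For $E\subset\mathbb{H}$ with locally finite $\mathcal{H}^3$ measure and $q \in E$, $$\beta_{E,1}(B(q,r)) := \inf_{\mathbb{W},z}\frac{1}{r^3}\int_{B(q,r)\cap E}\frac{\operatorname{dist}(x,z\cdot\mathbb{W})}{r}\,d\mathcal{H}^3(x),$$ the infimum being over all vertical subgroups $\mathbb{W}$ and all $z\in\mathbb{H}$. *)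

theory Defs
  imports "HOL-Analysis.Analysis"
begin

section \<open>The first Heisenberg group\<close>

type_synonym heis = "real \<times> real \<times> real"

fun hmul :: "heis \<Rightarrow> heis \<Rightarrow> heis" (infixl "\<odot>" 70) where
  "(x, y, t) \<odot> (x', y', t') = (x + x', y + y', t + t' + (x * y' - x' * y) / 2)"

fun hinv :: "heis \<Rightarrow> heis" where
  "hinv (x, y, t) = (- x, - y, - t)"

fun hnorm :: "heis \<Rightarrow> real" where
  "hnorm (x, y, t) = max (norm (x, y)) (2 * sqrt \<bar>t\<bar>)"

definition hdist :: "heis \<Rightarrow> heis \<Rightarrow> real" where
  "hdist p q = hnorm (hinv q \<odot> p)"

lemma hmul_assoc: "(p \<odot> q) \<odot> r = p \<odot> (q \<odot> r)"
  by (cases p; cases q; cases r) (simp add: field_simps)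

lemma hinv_left: "hinv p \<odot> p = 0"
  by (cases p) (simp add: zero_prod_def)

lemma hinv_right: "p \<odot> hinv p = 0"
  by (cases p) (simp add: zero_prod_def)

lemma hmul_zero: "0 \<odot> p = p" "p \<odot> 0 = p"
  by (cases p; simp add: zero_prod_def)+

lemma hinv_hmul: "hinv (p \<odot> q) = hinv q \<odot> hinv p"
  by (cases p; cases q) (simp add: field_simps)

lemma hinv_hinv: "hinv (hinv p) = p"
  by (cases p) simp

lemma hnorm_hinv: "hnorm (hinv p) = hnorm p"
  by (cases p) (simp add: norm_Pair)

lemma hnorm_nonneg: "0 \<le> hnorm p"
  by (cases p) (simp add: le_max_iff_disj)

lemma hnorm_eq_0: "hnorm p = 0 \<longleftrightarrow> p = 0"
proof -
  obtain x y t where p: "p = (x, y, t)" by (cases p)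
  have "max (norm (x, y)) (2 * sqrt \<bar>t\<bar>) = 0 \<longleftrightarrow> norm (x, y) = 0 \<and> 2 * sqrt \<bar>t\<bar> = 0"
    using norm_ge_zero[of "(x, y)"] real_sqrt_ge_zero[of "\<bar>t\<bar>"] by (auto simp: max_def)
  then show ?thesis by (simp add: p zero_prod_def)
qed

lemma hnorm_triangle: "hnorm (p \<odot> q) \<le> hnorm p + hnorm q"
proof -
  obtain x y t where p: "p = (x, y, t)" by (cases p)
  obtain x' y' t' where q: "q = (x', y', t')" by (cases q)
  define a b where "a = hnorm p" and "b = hnorm q"
  have a0: "a \<ge> 0" and b0: "b \<ge> 0" by (simp_all add: a_def b_def hnorm_nonneg)
  have na: "norm (x, y) \<le> a" and nb: "norm (x', y') \<le> b" by (simp_all add: a_def b_def p q)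
  have "2 * sqrt \<bar>t\<bar> \<le> a" "2 * sqrt \<bar>t'\<bar> \<le> b" by (simp_all add: a_def b_def p q)
  then have "(2 * sqrt \<bar>t\<bar>)\<^sup>2 \<le> a\<^sup>2 \<and> (2 * sqrt \<bar>t'\<bar>)\<^sup>2 \<le> b\<^sup>2"
    by (intro conjI power_mono) auto
  then have ta: "4 * \<bar>t\<bar> \<le> a\<^sup>2" and tb: "4 * \<bar>t'\<bar> \<le> b\<^sup>2"
    by (simp_all add: power_mult_distrib)
  have "\<bar>x * y' - x' * y\<bar> = \<bar>inner (x, y) (y', - x')\<bar>" by (simp add: algebra_simps)
  also have "\<dots> \<le> norm (x, y) * norm (y', - x')" by (rule Cauchy_Schwarz_ineq2)
  also have "norm (y', - x') = norm (x', y')" by (simp add: norm_Pair add.commute)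
  also have "norm (x, y) * norm (x', y') \<le> a * b"
    using na nb a0 by (intro mult_mono) auto
  finally have w: "\<bar>x * y' - x' * y\<bar> \<le> a * b" .
  have "4 * \<bar>t + t' + v / 2\<bar> \<le> 4 * \<bar>t\<bar> + 4 * \<bar>t'\<bar> + 2 * \<bar>v\<bar>" for v by (simp add: abs_if field_simps)
  from this[of "x * y' - x' * y"] have "4 * \<bar>t + t' + (x * y' - x' * y) / 2\<bar> \<le> a\<^sup>2 + b\<^sup>2 + 2 * (a * b)"
    using ta tb w by simp
  also have "\<dots> = (a + b)\<^sup>2" by (simp add: power2_sum)
  finally have "sqrt (4 * \<bar>t + t' + (x * y' - x' * y) / 2\<bar>) \<le> a + b"
    using a0 b0 by (intro real_le_lsqrt) auto
  then have "2 * sqrt \<bar>t + t' + (x * y' - x' * y) / 2\<bar> \<le> a + b"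
    by (simp add: real_sqrt_mult)
  moreover have "norm (x + x', y + y') \<le> a + b"
    using norm_triangle_ineq[of "(x, y)" "(x', y')"] na nb by simp
  ultimately show ?thesis
    unfolding a_def[symmetric] b_def[symmetric] by (simp add: p q)
qed

interpretation heis: Metric_space UNIV hdist
proof
  fix p q r :: heis
  show "0 \<le> hdist p q" by (simp add: hdist_def hnorm_nonneg)
  show "hdist p q = hdist q p"
    unfolding hdist_def by (metis hinv_hinv hinv_hmul hnorm_hinv)
  show "hdist p q = 0 \<longleftrightarrow> p = q"
    unfolding hdist_def hnorm_eq_0 by (metis hinv_left hinv_right hmul_assoc hmul_zero)
  have "hinv r \<odot> p = (hinv r \<odot> q) \<odot> (hinv q \<odot> p)"
    by (metis hinv_right hmul_assoc hmul_zero(1))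
  then show "hdist p r \<le> hdist p q + hdist q r"
    unfolding hdist_def by (metis hnorm_triangle add.commute)
qed

text \<open>The metric \<open>hdist\<close> induces the Euclidean topology, so \<^const>\<open>open\<close>, \<^const>\<open>closed\<close>,
  \<^const>\<open>frontier\<close> and \<^const>\<open>borel\<close> on \<^typ>\<open>heis\<close> may be used without qualification.\<close>

lemma continuous_on_hdist: "continuous_on UNIV (\<lambda>p. hdist p q)"
proof -
  obtain a b c where q: "q = (a, b, c)" by (cases q)
  have "(\<lambda>p. hdist p q) = (\<lambda>p. max (norm (fst p - a, fst (snd p) - b))
          (2 * sqrt \<bar>snd (snd p) - c + (b * fst p - a * fst (snd p)) / 2\<bar>))"
    by (rule ext) (auto simp: hdist_def q algebra_simps)
  then show ?thesis by (simp only:) (intro continuous_intros ballI, simp)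
qed

lemma mtopology_heis: "heis.mtopology = euclidean"
proof (rule topology_eq[THEN iffD2], intro allI iffI)
  fix U :: "heis set"
  assume U: "openin euclidean U"
  show "openin heis.mtopology U"
    unfolding heis.openin_mtopology
  proof (intro conjI allI impI)
    fix p assume pU: "p \<in> U"
    obtain a b c where p: "p = (a, b, c)" by (cases p)
    obtain e where e: "e > 0" "ball p e \<subseteq> U"
      using U pU by (auto simp: open_contains_ball)
    define M where "M = \<bar>a\<bar> + \<bar>b\<bar>"
    define r where "r = min 1 (e / (3 + M))"
    have M: "M \<ge> 0" by (simp add: M_def)
    have r: "r > 0" "r \<le> 1" using e M by (auto simp: r_def)
    have "heis.mball p r \<subseteq> ball p e"
    proof
      fix q assume q': "q \<in> heis.mball p r"
      obtain x y t where q: "q = (x, y, t)" by (cases q)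
      define s where "s = t - c + (b * x - a * y) / 2"
      have d: "hdist q p < r" using q' by (simp add: heis.commute)
      have n: "norm (x - a, y - b) < r" and s: "2 * sqrt \<bar>s\<bar> < r"
        using d by (simp_all add: hdist_def p q s_def algebra_simps)
      have xa: "\<bar>x - a\<bar> < r" and yb: "\<bar>y - b\<bar> < r"
        using n norm_fst_le[of "x - a" "y - b"] norm_snd_le[of "y - b" "x - a"] by auto
      have "(2 * sqrt \<bar>s\<bar>)\<^sup>2 \<le> r\<^sup>2" using s by (intro power_mono) auto
      then have "4 * \<bar>s\<bar> \<le> r * r" by (simp add: power_mult_distrib power2_eq_square)
      also have "r * r \<le> r" using r by (simp add: mult_left_le)
      finally have s4: "4 * \<bar>s\<bar> \<le> r" .
      have "t - c = s - (b * (x - a) - a * (y - b)) / 2" by (simp add: s_def field_simps)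
      moreover have "\<bar>s - (u - v) / 2\<bar> \<le> \<bar>s\<bar> + (\<bar>u\<bar> + \<bar>v\<bar>) / 2" for u v :: real by (simp add: abs_if field_simps)
      ultimately have "\<bar>t - c\<bar> \<le> \<bar>s\<bar> + (\<bar>b * (x - a)\<bar> + \<bar>a * (y - b)\<bar>) / 2" by metis
      also have "\<dots> \<le> \<bar>s\<bar> + (\<bar>b\<bar> * r + \<bar>a\<bar> * r) / 2"
        using xa yb unfolding abs_mult
        by (intro add_left_mono divide_right_mono add_mono mult_left_mono) auto
      also have "\<dots> = \<bar>s\<bar> + M * r / 2" by (simp add: M_def algebra_simps)
      also have "\<dots> < r + M * r"
      proof -
        have "0 \<le> M * r" using M r by simp
        then show ?thesis using s4 r by linarith
      qed
      finally have tc: "\<bar>t - c\<bar> < r + M * r" .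
      have "dist p q = norm ((x - a, y - b), t - c)"
        by (simp add: p q dist_Pair_Pair dist_real_def norm_Pair power2_commute add.assoc)
      also have "\<dots> \<le> norm (x - a, y - b) + norm (t - c)" by (rule norm_Pair_le)
      also have "\<dots> < (3 + M) * r" using n tc r by (simp add: algebra_simps)
      also have "\<dots> \<le> (3 + M) * (e / (3 + M))"
        using M by (intro mult_left_mono) (auto simp: r_def)
      also have "\<dots> = e" using M by simp
      finally show "q \<in> ball p e" by simp
    qed
    then show "\<exists>r>0. heis.mball p r \<subseteq> U" using r e by blast
  qed simp
next
  fix U :: "heis set"
  assume U: "openin heis.mtopology U"
  have ob: "open (heis.mball p r)" for p r
  proof -
    have "heis.mball p r = {q. hdist q p < r}" by (auto simp: heis.commute)
    then show ?thesis
      using open_Collect_less[OF continuous_on_hdist continuous_on_const] by simp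
  qed
  have "\<exists>T. open T \<and> p \<in> T \<and> T \<subseteq> U" if "p \<in> U" for p
    using U that ob heis.centre_in_mball_iff unfolding heis.openin_mtopology
    by (metis UNIV_I)
  then show "openin euclidean U" using open_subopen[of U] by simp
qed


section \<open>Hausdorff measure\<close>

definition hdiam :: "heis set \<Rightarrow> ennreal" where
  "hdiam S = (SUP p\<in>S. SUP q\<in>S. ennreal (hdist p q))"

definition hausdorff3_pre :: "real \<Rightarrow> heis set \<Rightarrow> ennreal" where
  "hausdorff3_pre \<delta> S =
     (INF C\<in>{C :: nat \<Rightarrow> heis set. S \<subseteq> (\<Union>i. C i) \<and> (\<forall>i. hdiam (C i) \<le> ennreal \<delta>)}.
        \<Sum>i. hdiam (C i) ^ 3)"

definition hausdorff3_outer :: "heis set \<Rightarrow> ennreal" where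
  "hausdorff3_outer S = (SUP \<delta>\<in>{0<..}. hausdorff3_pre \<delta> S)"

text \<open>No normalising constant is used. Since \<^const>\<open>measure_of\<close> yields the null measure when its
  argument is not countably additive, lemma \<open>emeasure_hausdorff3\<close> below is what shows that this
  is the Hausdorff measure.\<close>

definition hausdorff3 :: "heis measure" where
  "hausdorff3 = measure_of UNIV (sets borel) hausdorff3_outer"

lemma hdiam_mono: "S \<subseteq> T \<Longrightarrow> hdiam S \<le> hdiam T"
  unfolding hdiam_def by (intro SUP_subset_mono) auto

lemma hdiam_empty [simp]: "hdiam {} = 0"
  by (simp add: hdiam_def bot_ennreal)

lemma hdist_le_hdiam: "p \<in> S \<Longrightarrow> q \<in> S \<Longrightarrow> ennreal (hdist p q) \<le> hdiam S"
  unfolding hdiam_def by (blast intro: SUP_upper2)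

lemma hausdorff3_pre_antimono:
  assumes "\<delta> \<le> \<epsilon>" shows "hausdorff3_pre \<epsilon> S \<le> hausdorff3_pre \<delta> S"
  unfolding hausdorff3_pre_def
  using assms by (intro INF_superset_mono) (auto intro: order_trans ennreal_leI)

lemma hausdorff3_pre_mono: "S \<subseteq> T \<Longrightarrow> hausdorff3_pre \<delta> S \<le> hausdorff3_pre \<delta> T"
  unfolding hausdorff3_pre_def by (intro INF_superset_mono) auto

lemma hausdorff3_outer_mono: "S \<subseteq> T \<Longrightarrow> hausdorff3_outer S \<le> hausdorff3_outer T"
  unfolding hausdorff3_outer_def by (intro SUP_mono) (auto intro: hausdorff3_pre_mono)

lemma hausdorff3_pre_empty: "hausdorff3_pre \<delta> {} = 0"
proof -
  have "hausdorff3_pre \<delta> {} \<le> (\<Sum>i::nat. hdiam {} ^ 3)"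
    unfolding hausdorff3_pre_def by (rule INF_lower2[of "\<lambda>_. {}"]) auto
  then show ?thesis by simp
qed

lemma hausdorff3_outer_empty: "hausdorff3_outer {} = 0"
  by (auto simp: hausdorff3_outer_def hausdorff3_pre_empty intro!: antisym SUP_least)

lemma hausdorff3_pre_eq_outer_measure:
  "hausdorff3_pre \<delta> S =
     outer_measure (Pow UNIV) (\<lambda>C. if hdiam C \<le> ennreal \<delta> then hdiam C ^ 3 else top) S"
    (is "_ = outer_measure _ ?f S")
proof (rule antisym)
  show "hausdorff3_pre \<delta> S \<le> outer_measure (Pow UNIV) ?f S"
    unfolding outer_measure_def
  proof (rule INF_greatest)
    fix A :: "nat \<Rightarrow> heis set"
    assume A: "A \<in> {A. range A \<subseteq> Pow UNIV \<and> disjoint_family A \<and> S \<subseteq> (\<Union>i. A i)}"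
    show "hausdorff3_pre \<delta> S \<le> (\<Sum>i. ?f (A i))"
    proof (cases "\<forall>i. hdiam (A i) \<le> ennreal \<delta>")
      case True
      then show ?thesis using A unfolding hausdorff3_pre_def by (auto intro!: INF_lower2[of A])
    next
      case False
      then obtain i where "\<not> hdiam (A i) \<le> ennreal \<delta>" by blast
      then have "top = (\<Sum>j\<in>{i}. ?f (A j))" by simp
      also have "\<dots> \<le> (\<Sum>j. ?f (A j))" by (rule sum_le_suminf) auto
      finally have "(\<Sum>j. ?f (A j)) = top" by (rule top.extremum_uniqueI)
      then show ?thesis by (simp only: top_greatest)
    qed
  qed
  show "outer_measure (Pow UNIV) ?f S \<le> hausdorff3_pre \<delta> S"
    unfolding hausdorff3_pre_def
  proof (rule INF_greatest)
    fix C :: "nat \<Rightarrow> heis set"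
    assume C: "C \<in> {C. S \<subseteq> (\<Union>i. C i) \<and> (\<forall>i. hdiam (C i) \<le> ennreal \<delta>)}"
    have "outer_measure (Pow UNIV) ?f S \<le> (\<Sum>i. ?f (disjointed C i))"
      unfolding outer_measure_def
    proof (rule INF_lower)
      show "disjointed C \<in> {A. range A \<subseteq> Pow UNIV \<and> disjoint_family A \<and> S \<subseteq> (\<Union>i. A i)}"
        using C UN_disjointed_eq[of C] disjoint_family_disjointed[of C] by simp
    qed
    also have "\<dots> \<le> (\<Sum>i. hdiam (C i) ^ 3)"
    proof (rule suminf_le)
      fix i
      have "hdiam (disjointed C i) \<le> hdiam (C i)" by (rule hdiam_mono) (rule disjointed_subset)
      then show "?f (disjointed C i) \<le> hdiam (C i) ^ 3"
        using C order_trans[of _ _ "ennreal \<delta>"] by (simp add: power_mono)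
    qed auto
    finally show "outer_measure (Pow UNIV) ?f S \<le> (\<Sum>i. hdiam (C i) ^ 3)" .
  qed
qed

lemma hausdorff3_pre_subadditive: "hausdorff3_pre \<delta> (\<Union>i. A i) \<le> (\<Sum>i. hausdorff3_pre \<delta> (A i))"
proof -
  let ?f = "\<lambda>C. if hdiam C \<le> ennreal \<delta> then hdiam C ^ 3 else top"
  interpret ring_of_sets "UNIV :: heis set" "Pow UNIV" by (rule ring_of_sets_Pow)
  have "positive (Pow UNIV) ?f" by (simp add: positive_def)
  moreover have "increasing (Pow UNIV) ?f"
    by (auto simp: increasing_def intro: power_mono hdiam_mono dest: order_trans[OF hdiam_mono])
  ultimately have "countably_subadditive (Pow UNIV) (outer_measure (Pow UNIV) ?f)"
    using countably_subadditive_outer_measure by simp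
  then have cs: "countably_subadditive (Pow UNIV) (hausdorff3_pre \<delta>)"
    by (simp add: hausdorff3_pre_eq_outer_measure[abs_def])
  have "hausdorff3_pre \<delta> (\<Union>i. disjointed A i) \<le> (\<Sum>i. hausdorff3_pre \<delta> (disjointed A i))"
    using cs disjoint_family_disjointed[of A] unfolding countably_subadditive_def by simp
  also have "\<dots> \<le> (\<Sum>i. hausdorff3_pre \<delta> (A i))"
    by (intro suminf_le hausdorff3_pre_mono disjointed_subset) auto
  finally show ?thesis by (simp add: UN_disjointed_eq)
qed

lemma hausdorff3_outer_subadditive: "hausdorff3_outer (\<Union>i. A i) \<le> (\<Sum>i. hausdorff3_outer (A i))"
proof -
  have "hausdorff3_pre \<delta> (\<Union>i. A i) \<le> (\<Sum>i. hausdorff3_outer (A i))" if "\<delta> > 0" for \<delta>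
  proof -
    have "(\<Sum>i. hausdorff3_pre \<delta> (A i)) \<le> (\<Sum>i. hausdorff3_outer (A i))"
      unfolding hausdorff3_outer_def using that by (intro suminf_le SUP_upper) auto
    then show ?thesis using hausdorff3_pre_subadditive order_trans by blast
  qed
  then show ?thesis by (auto simp: hausdorff3_outer_def intro: SUP_least)
qed

lemma outer_measure_space_hausdorff3: "outer_measure_space (Pow UNIV) hausdorff3_outer"
  unfolding outer_measure_space_def positive_def increasing_def countably_subadditive_def
  using hausdorff3_outer_empty hausdorff3_outer_mono hausdorff3_outer_subadditive by auto

lemma hausdorff3_outer_Un: "hausdorff3_outer (S \<union> T) \<le> hausdorff3_outer S + hausdorff3_outer T"
proof -
  have "(\<Union>i. if i = (0::nat) then S else if i = 1 then T else {}) = S \<union> T"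
    by (auto split: if_splits)
  moreover have "(\<Sum>i. hausdorff3_outer (if i = (0::nat) then S else if i = 1 then T else {}))
      = (\<Sum>i\<in>{0,1}. hausdorff3_outer (if i = (0::nat) then S else if i = 1 then T else {}))"
    by (rule suminf_finite) (auto simp: hausdorff3_outer_empty)
  ultimately show ?thesis
    using hausdorff3_outer_subadditive[of "\<lambda>i. if i = (0::nat) then S else if i = 1 then T else {}"]
    by simp
qed

lemma hausdorff3_outer_separated:
  assumes "\<epsilon> > 0" and sep: "\<And>p q. p \<in> S \<Longrightarrow> q \<in> T \<Longrightarrow> \<epsilon> \<le> hdist p q"
  shows "hausdorff3_outer S + hausdorff3_outer T \<le> hausdorff3_outer (S \<union> T)"
proof -
  have pre: "hausdorff3_pre \<delta> S + hausdorff3_pre \<delta> T \<le> hausdorff3_pre \<delta> (S \<union> T)"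
    if \<delta>: "\<delta> < \<epsilon>" for \<delta>
    unfolding hausdorff3_pre_def[of \<delta> "S \<union> T"]
  proof (rule INF_greatest)
    fix C :: "nat \<Rightarrow> heis set"
    assume C: "C \<in> {C. S \<union> T \<subseteq> (\<Union>i. C i) \<and> (\<forall>i. hdiam (C i) \<le> ennreal \<delta>)}"
    have le: "hdiam (C i \<inter> X) \<le> ennreal \<delta>" for i X
      using C hdiam_mono[of "C i \<inter> X" "C i"] by (auto intro: order_trans)
    have "hausdorff3_pre \<delta> S \<le> (\<Sum>i. hdiam (C i \<inter> S) ^ 3)"
      unfolding hausdorff3_pre_def using C le by (intro INF_lower) auto
    moreover have "hausdorff3_pre \<delta> T \<le> (\<Sum>i. hdiam (C i \<inter> T) ^ 3)"
      unfolding hausdorff3_pre_def using C le by (intro INF_lower) auto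
    ultimately have "hausdorff3_pre \<delta> S + hausdorff3_pre \<delta> T
        \<le> (\<Sum>i. hdiam (C i \<inter> S) ^ 3) + (\<Sum>i. hdiam (C i \<inter> T) ^ 3)" by (rule add_mono)
    also have "\<dots> = (\<Sum>i. hdiam (C i \<inter> S) ^ 3 + hdiam (C i \<inter> T) ^ 3)"
      by (rule suminf_add) auto
    also have "\<dots> \<le> (\<Sum>i. hdiam (C i) ^ 3)"
    proof (rule suminf_le)
      fix i
      have "C i \<inter> S = {} \<or> C i \<inter> T = {}"
      proof (rule ccontr)
        assume "\<not> ?thesis"
        then obtain p q where pq: "p \<in> C i" "p \<in> S" "q \<in> C i" "q \<in> T" by blast
        have "ennreal (hdist p q) \<le> ennreal \<delta>"
          using hdist_le_hdiam[OF pq(1) pq(3)] C by (auto intro: order_trans)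
        moreover have "\<epsilon> \<le> hdist p q" using sep pq by blast
        ultimately show False using \<delta> assms(1) by (auto simp: ennreal_le_iff2)
      qed
      then show "hdiam (C i \<inter> S) ^ 3 + hdiam (C i \<inter> T) ^ 3 \<le> hdiam (C i) ^ 3"
        by (auto intro!: power_mono hdiam_mono)
    qed auto
    finally show "hausdorff3_pre \<delta> S + hausdorff3_pre \<delta> T \<le> (\<Sum>i. hdiam (C i) ^ 3)" .
  qed
  have "hausdorff3_outer S + hausdorff3_outer T
      = (SUP \<delta>\<in>{0<..}. hausdorff3_pre \<delta> S + hausdorff3_pre \<delta> T)"
    unfolding hausdorff3_outer_def
  proof (rule SUP_add_directed_ennreal[symmetric])
    fix i j :: real assume "i \<in> {0<..}" "j \<in> {0<..}"
    then show "\<exists>k\<in>{0<..}. hausdorff3_pre i S + hausdorff3_pre j T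
        \<le> hausdorff3_pre k S + hausdorff3_pre k T"
      by (intro bexI[of _ "min i j"] add_mono hausdorff3_pre_antimono) auto
  qed
  also have "\<dots> \<le> hausdorff3_outer (S \<union> T)"
  proof (rule SUP_least)
    fix \<delta> :: real assume \<delta>: "\<delta> \<in> {0<..}"
    define \<delta>' where "\<delta>' = min \<delta> (\<epsilon> / 2)"
    have "hausdorff3_pre \<delta> S + hausdorff3_pre \<delta> T \<le> hausdorff3_pre \<delta>' S + hausdorff3_pre \<delta>' T"
      by (intro add_mono hausdorff3_pre_antimono) (auto simp: \<delta>'_def)
    also have "\<dots> \<le> hausdorff3_pre \<delta>' (S \<union> T)"
      using \<open>\<epsilon> > 0\<close> by (intro pre) (auto simp: \<delta>'_def)
    also have "\<dots> \<le> hausdorff3_outer (S \<union> T)"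
      unfolding hausdorff3_outer_def using \<open>\<epsilon> > 0\<close> \<delta> by (intro SUP_upper) (auto simp: \<delta>'_def)
    finally show "hausdorff3_pre \<delta> S + hausdorff3_pre \<delta> T \<le> hausdorff3_outer (S \<union> T)" .
  qed
  finally show ?thesis .
qed

lemma closed_in_lambda_system:
  assumes "closed F"
  shows "F \<in> lambda_system UNIV (Pow UNIV) hausdorff3_outer"
proof (cases "F = {}")
  case True
  then show ?thesis by (auto simp: lambda_system_def hausdorff3_outer_empty)
next
  case False
  interpret algebra "UNIV :: heis set" "Pow UNIV" by (rule algebra_Pow)
  let ?H = hausdorff3_outer
  define u where "u p = (INF q\<in>F. hdist p q)" for p
  have bdd: "bdd_below (hdist p ` F)" for p by (rule bdd_belowI2[of _ 0]) simp
  have u0: "0 \<le> u p" for p unfolding u_def using False by (intro cINF_greatest) auto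
  have uF: "u p \<le> hdist p q" if "q \<in> F" for p q
    unfolding u_def by (rule cINF_lower[OF bdd that])
  have lip: "u p \<le> hdist p q + u q" for p q
  proof -
    have "u p - hdist p q \<le> u q"
      unfolding u_def[of q]
    proof (rule cINF_greatest)
      fix r assume "r \<in> F"
      then show "u p - hdist p q \<le> hdist q r" using uF[of r p] heis.triangle[of p q r] by simp
    qed (rule False)
    then show ?thesis by simp
  qed
  have upos: "0 < u p" if pF: "p \<notin> F" for p
  proof -
    have "openin heis.mtopology (- F)" using open_Compl[OF assms] by (simp add: mtopology_heis)
    then obtain r where r: "r > 0" "heis.mball p r \<subseteq> - F"
      using pF unfolding heis.openin_mtopology by (metis ComplI)
    then have "r \<le> u p"
      unfolding u_def using False by (intro cINF_greatest) (auto simp: not_less[symmetric])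
    then show ?thesis using r by simp
  qed
  have "?H (X \<inter> F) + ?H (X - F) \<le> ?H X" for X
  proof (cases "?H X = top")
    case False
    define c where "c n = 1 / real (Suc n)" for n
    define D where "D n = {p \<in> X. c n \<le> u p}" for n
    define E where "E n = D (Suc n) - D n" for n
    have cpos: "c n > 0" for n by (simp add: c_def)
    have cmono: "c n \<le> c m" if "m \<le> n" for m n using that by (simp add: c_def frac_le)
    have cstrict: "c (Suc n) < c n" for n by (simp add: c_def frac_less2)
    have DX: "?H (X \<inter> F) + ?H (D n) \<le> ?H X" for n
    proof -
      have "?H (X \<inter> F) + ?H (D n) \<le> ?H (X \<inter> F \<union> D n)"
      proof (rule hausdorff3_outer_separated[OF cpos[of n]])
        fix p q assume "p \<in> X \<inter> F" "q \<in> D n"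
        then show "c n \<le> hdist p q" using uF[of p q] by (auto simp: D_def heis.commute)
      qed
      also have "\<dots> \<le> ?H X" by (rule hausdorff3_outer_mono) (auto simp: D_def)
      finally show ?thesis .
    qed
    have part: "(\<Sum>k<n. ?H (E (2 * k + i))) \<le> ?H (\<Union>k<n. E (2 * k + i))" for n i
    proof (induction n)
      case (Suc n)
      have sep: "?H (\<Union>k<n. E (2 * k + i)) + ?H (E (2 * n + i))
          \<le> ?H ((\<Union>k<n. E (2 * k + i)) \<union> E (2 * n + i))"
      proof (cases "n = 0")
        case n: False
        show ?thesis
        proof (rule hausdorff3_outer_separated)
          show "0 < c (2 * n + i - 1) - c (2 * n + i)"
            using cstrict[of "2 * n + i - 1"] n by simp
          fix p q assume p: "p \<in> (\<Union>k<n. E (2 * k + i))" and q: "q \<in> E (2 * n + i)"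
          then obtain k where k: "k < n" "p \<in> E (2 * k + i)" by blast
          have "c (2 * n + i - 1) \<le> c (Suc (2 * k + i))" using k by (intro cmono) simp
          then have "c (2 * n + i - 1) \<le> u p" using k by (auto simp: E_def D_def)
          moreover have "u q < c (2 * n + i)" using q by (auto simp: E_def D_def)
          ultimately show "c (2 * n + i - 1) - c (2 * n + i) \<le> hdist p q" using lip[of p q] by simp
        qed
      qed (simp add: hausdorff3_outer_empty)
      have "(\<Sum>k<Suc n. ?H (E (2 * k + i)))
          \<le> ?H (\<Union>k<n. E (2 * k + i)) + ?H (E (2 * n + i))"
        using Suc.IH by (simp add: add_right_mono)
      also note sep
      finally show ?case by (simp add: lessThan_Suc Un_commute)
    qed simp
    have half: "(\<Sum>k<n. ?H (E (2 * k + i))) \<le> ?H X" for n i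
      by (rule order_trans[OF part]) (rule hausdorff3_outer_mono, auto simp: E_def D_def)
    have "(\<Sum>k<n. ?H (E k)) \<le> ?H X + ?H X" for n
    proof -
      have "(\<Sum>k<n. ?H (E k)) \<le> (\<Sum>k<2 * n. ?H (E k))" by (rule sum_mono2) auto
      also have "\<dots> = (\<Sum>k<n. ?H (E (2 * k + 0))) + (\<Sum>k<n. ?H (E (2 * k + 1)))"
        by (induction n) (simp_all add: ac_simps)
      also have "\<dots> \<le> ?H X + ?H X"
        by (intro add_mono half)
      finally show ?thesis .
    qed
    then have "(\<Sum>k. ?H (E k)) \<le> ?H X + ?H X" by (intro suminf_le_const summableI)
    then have fin: "(\<Sum>k. ?H (E k)) \<noteq> top" using False by (auto simp: top_unique)
    have tail: "?H (X - F) \<le> ?H (D n) + (\<Sum>k. ?H (E (k + n)))" for n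
    proof -
      have "X - F \<subseteq> D n \<union> (\<Union>k. E (k + n))"
      proof
        fix p assume p: "p \<in> X - F"
        obtain m where m: "c m < u p" using reals_Archimedean[of "u p"] upos p
          by (auto simp: c_def inverse_eq_divide)
        define l where "l = (LEAST l. p \<in> D l)"
        have "p \<in> D m" using m p by (auto simp: D_def)
        then have l: "p \<in> D l" "\<And>j. j < l \<Longrightarrow> p \<notin> D j"
          unfolding l_def by (auto intro: LeastI dest: not_less_Least)
        show "p \<in> D n \<union> (\<Union>k. E (k + n))"
        proof (cases "l \<le> n")
          case True
          then show ?thesis using l cmono[of l n] by (auto simp: D_def)
        next
          case False
          then have "p \<in> E ((l - 1 - n) + n)" using l(1) l(2)[of "l - 1"] by (auto simp: E_def)
          then show ?thesis by blast
        qed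
      qed
      then have "?H (X - F) \<le> ?H (D n \<union> (\<Union>k. E (k + n)))" by (rule hausdorff3_outer_mono)
      also have "\<dots> \<le> ?H (D n) + ?H (\<Union>k. E (k + n))" by (rule hausdorff3_outer_Un)
      also have "\<dots> \<le> ?H (D n) + (\<Sum>k. ?H (E (k + n)))"
        by (intro add_left_mono hausdorff3_outer_subadditive)
      finally show ?thesis .
    qed
    have "(\<lambda>n. \<Sum>k. ?H (E (k + n))) \<longlonglongrightarrow> 0" 
    proof -
      define g where "g k = enn2real (?H (E k))" for k
      have "?H (E k) \<noteq> top" for k
        using fin by (metis ennreal_suminf_lessD less_top)
      then have g: "?H (E k) = ennreal (g k)" for k by (simp add: g_def less_top)
      have g0: "0 \<le> g k" for k by (simp add: g_def)
      have sg: "summable g" using fin g0 by (simp add: g summable_suminf_not_top)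
      have "(\<Sum>k. ?H (E (k + n))) = ennreal (\<Sum>k. g (k + n))" for n
        unfolding g using g0 sg by (intro suminf_ennreal2) (simp_all add: summable_ignore_initial_segment)
      then show ?thesis
        using tendsto_ennrealI[OF suminf_exist_split2[OF sg]] by simp
    qed
    then have "(\<lambda>n. ?H X + (\<Sum>k. ?H (E (k + n)))) \<longlonglongrightarrow> ?H X + 0"
      by (intro tendsto_add tendsto_const)
    moreover have "?H (X \<inter> F) + ?H (X - F) \<le> ?H X + (\<Sum>k. ?H (E (k + n)))" for n
    proof -
      have "?H (X \<inter> F) + ?H (X - F) \<le> ?H (X \<inter> F) + (?H (D n) + (\<Sum>k. ?H (E (k + n))))"
        by (rule add_left_mono) (rule tail)
      also have "\<dots> = ?H (X \<inter> F) + ?H (D n) + (\<Sum>k. ?H (E (k + n)))" by (simp add: add.assoc)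
      also have "\<dots> \<le> ?H X + (\<Sum>k. ?H (E (k + n)))" by (rule add_right_mono) (rule DX)
      finally show ?thesis .
    qed
    ultimately show ?thesis by (intro LIMSEQ_le_const[of _ "?H X"]) auto
  qed simp
  moreover have "?H X \<le> ?H (X \<inter> F) + ?H (X - F)" for X
    using hausdorff3_outer_Un[of "X \<inter> F" "X - F"] by (simp add: Int_Diff_Un)
  ultimately show ?thesis unfolding lambda_system_eq by (auto intro: antisym)
qed

lemma emeasure_hausdorff3:
  assumes "S \<in> sets borel" shows "emeasure hausdorff3 S = hausdorff3_outer S"
proof -
  let ?L = "lambda_system (UNIV :: heis set) (Pow UNIV) hausdorff3_outer"
  interpret sigma_algebra "UNIV :: heis set" "Pow UNIV" by (rule sigma_algebra_Pow)
  have ms: "measure_space UNIV ?L hausdorff3_outer"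
    by (rule caratheodory_lemma[OF outer_measure_space_hausdorff3])
  then have "sigma_algebra UNIV ?L" by (simp add: measure_space_def)
  moreover have "sets (borel :: heis measure) = sigma_sets UNIV (Collect closed)"
    by (simp add: borel_eq_closed)
  ultimately have "sets borel \<subseteq> ?L"
    using closed_in_lambda_system by (simp only:) (rule sigma_algebra.sigma_sets_subset, auto)
  then have "countably_additive (sets borel) hausdorff3_outer"
    using ms by (auto simp: measure_space_def countably_additive_def)
  moreover have "positive (sets borel) hausdorff3_outer"
    by (simp add: positive_def hausdorff3_outer_empty)
  ultimately have "measure_space UNIV (sets borel) hausdorff3_outer"
    using sets.sigma_algebra_axioms[of "borel :: heis measure"] by (simp add: measure_space_def)
  then show ?thesis
    unfolding hausdorff3_def using assms sets.sigma_sets_eq[of "borel :: heis measure"]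
    by (subst emeasure_measure_of_sigma) (auto simp: measure_space_def)
qed

text \<open>A closed set \<open>E\<close> is 3-regular iff \<open>regular3 A E\<close> for some \<open>A\<close>. The sets \<open>E \<inter> B(q, r)\<close> are
  Borel, so here \<^term>\<open>emeasure hausdorff3\<close> is the Hausdorff measure.\<close>

definition regular3 :: "real \<Rightarrow> heis set \<Rightarrow> bool" where
  "regular3 A E \<longleftrightarrow> 1 \<le> A \<and> closed E \<and>
     (\<forall>q\<in>E. \<forall>r>0. ennreal r \<le> hdiam E \<longrightarrow>
        ennreal (inverse A * r ^ 3) \<le> emeasure hausdorff3 (E \<inter> heis.mball q r) \<and>
        emeasure hausdorff3 (E \<inter> heis.mball q r) \<le> ennreal (A * r ^ 3))"


section \<open>Vertical perimeter and \<open>\<beta>\<close>-numbers\<close>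

text \<open>Used only with \<open>a > 0\<close>.\<close>

definition ennreal_powr :: "ennreal \<Rightarrow> real \<Rightarrow> ennreal" where
  "ennreal_powr x a = (if x = \<infinity> then \<infinity> else ennreal (enn2real x powr a))"

definition vertical_var :: "heis set \<Rightarrow> heis set \<Rightarrow> real \<Rightarrow> ennreal" where
  "vertical_var \<Omega> U s =
     (\<integral>\<^sup>+p\<in>U. ennreal \<bar>indicator \<Omega> p - indicator \<Omega> (p \<odot> (0, 0, s\<^sup>2))\<bar> \<partial>lborel)"

definition vertical_perimeter :: "heis set \<Rightarrow> real \<Rightarrow> heis set \<Rightarrow> ennreal" where
  "vertical_perimeter \<Omega> p U =
     ennreal_powr
       (\<integral>\<^sup>+s\<in>{0<..}. ennreal_powr (vertical_var \<Omega> U s / ennreal s) p / ennreal s \<partial>lborel)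
       (1 / p)"

definition vertical_subgroup :: "heis set \<Rightarrow> bool" where
  "vertical_subgroup W \<longleftrightarrow> subspace W \<and> dim W = 2 \<and> (\<forall>t. (0, 0, t) \<in> W)"

definition hinfdist :: "heis \<Rightarrow> heis set \<Rightarrow> ennreal" where
  "hinfdist p S = (INF q\<in>S. ennreal (hdist p q))"

text \<open>\<open>\<beta>\<^bsub>E,1\<^esub>(B(q, r))\<close>, as a function of the centre and the radius.\<close>

definition beta1 :: "heis set \<Rightarrow> heis \<Rightarrow> real \<Rightarrow> ennreal" where
  "beta1 E q r =
     (INF (W, z)\<in>{W. vertical_subgroup W} \<times> UNIV.
        (\<integral>\<^sup>+x\<in>heis.mball q r \<inter> E. hinfdist x ((\<odot>) z ` W) / ennreal r \<partial>hausdorff3)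
          / ennreal (r ^ 3))"

end

theory Submission
  imports Defs
begin

text \<open>Write \<open>E\<close> for the boundary and \<open>v(s)\<close> for the measure of the points \<open>p\<close> such that \<open>\<Omega>\<close> separates
  \<open>p\<close> from \<open>p \<odot> (0, 0, s\<^sup>2)\<close>. The distance to a vertical plane \<open>z \<odot> W\<close> is the absolute value of an affine
  function \<open>f\<close> of \<open>(x, y)\<close>, and it grows along one of the coordinate directions \<open>v\<close>. If \<open>\<Omega>\<close>
  separates \<open>p\<close> from \<open>p \<odot> (0, 0, s\<^sup>2)\<close>, follow the horizontal line in direction \<open>v\<close> away from the plane up
  to distance \<open>s\<close>, then move vertically, and come back. Either the vertical piece
  meets \<open>E\<close> at distance at least \<open>s\<close> from the plane, so that regularity makes the \<open>\<beta>\<close>-number large,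
  or one of the horizontal pieces meets \<open>E\<close> at a point \<open>x\<close> further from the plane than \<open>p\<close>.
  Since projection along horizontal lines maps a set of diameter \<open>\<rho>\<close> into a planar set of area
  \<open>O(\<rho>\<^sup>3)\<close>, the volume of the latter \<open>p\<close> is at most a multiple of \<open>\<integral> \<bar>f\<bar>\<close> over \<open>E\<close>. Hence
  \<open>v(s)\<close>, localised to a ball \<open>B(q, 3 s)\<close> with \<open>q \<in> E\<close>, is at most a multiple of
  \<open>s\<^sup>4 \<beta>(q, 8 s)\<close>. Averaging over \<open>q\<close>, Jensen's inequality and the Carleson condition finish the proof
  for small \<open>s\<close>; large \<open>s\<close> are controlled by the trivial volume bound.\<close>

section \<open>Distances and volumes\<close>

lemma hdist_Pair:
  "hdist (x, y, t) (a, b, c) = max (norm (x - a, y - b)) (2 * sqrt \<bar>t - c + (b * x - a * y) / 2\<bar>)"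
  by (simp add: hdist_def algebra_simps)

lemma hdist_hmul_right: "hdist (p \<odot> v) p = hnorm v"
  unfolding hdist_def by (metis hinv_left hmul_assoc hmul_zero(1))

lemma abs_le_norm_Pair: "\<bar>x\<bar> \<le> norm (x, y)" "\<bar>y\<bar> \<le> norm (x, y)" for x y :: real
  using norm_fst_le[of x y] norm_snd_le[of y x] by auto

text \<open>Balls are compared with sheared boxes, whose volume is computed by slicing. This gives
  the box around a ball, \<open>hdist_less_I\<close> the box inside one.\<close>

lemma hdist_le_D:
  assumes "hdist (x, y, t) (a, b, c) \<le> r"
  shows "\<bar>x - a\<bar> \<le> r" "\<bar>y - b\<bar> \<le> r" "\<bar>t - c + (b * x - a * y) / 2\<bar> \<le> r\<^sup>2 / 4"
proof -
  have n: "norm (x - a, y - b) \<le> r" and s: "2 * sqrt \<bar>t - c + (b * x - a * y) / 2\<bar> \<le> r"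
    using assms by (simp_all add: hdist_Pair)
  show "\<bar>x - a\<bar> \<le> r" "\<bar>y - b\<bar> \<le> r"
    using n abs_le_norm_Pair[where x="x - a" and y="y - b"] by linarith+
  have "(2 * sqrt \<bar>t - c + (b * x - a * y) / 2\<bar>)\<^sup>2 \<le> r\<^sup>2" using s by (intro power_mono) auto
  then show "\<bar>t - c + (b * x - a * y) / 2\<bar> \<le> r\<^sup>2 / 4" by (simp add: power_mult_distrib)
qed

text \<open>The hypotheses bound both entries of the maximum by \<open>r / sqrt 2\<close>, which
  leaves room for the strict inequality.\<close>

lemma hdist_less_I:
  assumes "\<bar>x - a\<bar> \<le> r / 2" "\<bar>y - b\<bar> \<le> r / 2" "\<bar>t - c + (b * x - a * y) / 2\<bar> \<le> r\<^sup>2 / 8" "0 < r"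
  shows "hdist (x, y, t) (a, b, c) < r"
proof -
  have "norm (x - a, y - b) = sqrt ((x - a)\<^sup>2 + (y - b)\<^sup>2)" by (simp add: norm_Pair)
  also have "\<dots> < r"
  proof (rule real_less_lsqrt)
    have "(x - a)\<^sup>2 \<le> (r / 2)\<^sup>2" "(y - b)\<^sup>2 \<le> (r / 2)\<^sup>2"
      using assms by (auto intro!: power2_le_iff_abs_le[THEN iffD2])
    moreover have "(r / 2)\<^sup>2 + (r / 2)\<^sup>2 < r\<^sup>2" using assms(4) by (simp add: power2_eq_square)
    ultimately show "(x - a)\<^sup>2 + (y - b)\<^sup>2 < r\<^sup>2" by linarith
  qed (use assms in auto)
  finally have 1: "norm (x - a, y - b) < r" .
  have "sqrt \<bar>t - c + (b * x - a * y) / 2\<bar> < r / 2"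
  proof (rule real_less_lsqrt)
    have "r\<^sup>2 / 8 < (r / 2)\<^sup>2" using assms(4) by (simp add: power2_eq_square)
    then show "\<bar>t - c + (b * x - a * y) / 2\<bar> < (r / 2)\<^sup>2" using assms(3) by linarith
  qed (use assms in auto)
  with 1 show ?thesis by (simp add: hdist_Pair)
qed

section \<open>Volumes of sheared boxes, by slicing\<close>

lemma lborel_heis: "(lborel :: heis measure) = lborel \<Otimes>\<^sub>M (lborel \<Otimes>\<^sub>M lborel)"
  by (simp add: lborel_prod)

lemma emeasure_lborel_abs_le: "0 \<le> c \<Longrightarrow> emeasure lborel {t::real. \<bar>t - g\<bar> \<le> c} = ennreal (2 * c)"
proof -
  assume "0 \<le> c"
  have "{t::real. \<bar>t - g\<bar> \<le> c} = {g - c .. g + c}" by auto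
  then show ?thesis using \<open>0 \<le> c\<close> by simp
qed

text \<open>Cavalieri's principle: every vertical fibre over \<open>Q\<close> is an interval of
  length \<open>2 * c\<close>, wherever its centre \<open>g x y\<close> lies. This covers the boxes
  for balls as well as the sets swept out by horizontal lines.\<close>

lemma emeasure_lborel_fibre_interval:
  fixes g :: "real \<Rightarrow> real \<Rightarrow> real"
  assumes Q: "Q \<in> sets (borel :: (real \<times> real) measure)" and c: "0 \<le> c"
    and g: "(\<lambda>(x, y). g x y) \<in> borel_measurable borel"
  shows "{(x, y, t). (x, y) \<in> Q \<and> \<bar>t - g x y\<bar> \<le> c} \<in> sets borel"
    and "emeasure lborel {(x, y, t). (x, y) \<in> Q \<and> \<bar>t - g x y\<bar> \<le> c} = ennreal (2 * c) * emeasure lborel Q"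
proof -
  let ?T = "{(x, y, t). (x, y) \<in> Q \<and> \<bar>t - g x y\<bar> \<le> c}"
  have m: "(\<lambda>p::heis. (fst p, fst (snd p))) \<in> borel_measurable borel"
    by (intro borel_measurable_continuous_onI continuous_intros)
  have [measurable]: "(\<lambda>p::heis. g (fst p) (fst (snd p))) \<in> borel_measurable borel"
    using measurable_compose[OF m g] by simp
  have [measurable]: "(\<lambda>p::heis. snd (snd p)) \<in> borel_measurable borel"
    by (intro borel_measurable_continuous_onI continuous_intros)
  have [measurable]: "{p::heis. (fst p, fst (snd p)) \<in> Q} \<in> sets borel"
    using measurable_sets[OF m Q] by (simp add: vimage_def)
  have eq: "?T = {p. (fst p, fst (snd p)) \<in> Q} \<inter> {p. \<bar>snd (snd p) - g (fst p) (fst (snd p))\<bar> \<le> c}"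
    by auto
  show T: "?T \<in> sets borel" unfolding eq by measurable
  have "emeasure lborel ?T = (\<integral>\<^sup>+x. emeasure (lborel \<Otimes>\<^sub>M lborel) (Pair x -` ?T) \<partial>lborel)"
    using T unfolding lborel_heis
    by (intro sigma_finite_measure.emeasure_pair_measure_alt)
      (simp_all only: lborel_prod sets_lborel sigma_finite_lborel)
  also have "\<dots> = (\<integral>\<^sup>+x. \<integral>\<^sup>+y. emeasure lborel (Pair y -` (Pair x -` ?T)) \<partial>lborel \<partial>lborel)"
  proof (intro nn_integral_cong sigma_finite_measure.emeasure_pair_measure_alt sigma_finite_lborel)
    fix x :: real
    have "Pair x \<in> borel \<rightarrow>\<^sub>M (borel :: heis measure)"
      by (intro borel_measurable_continuous_onI continuous_intros)
    from measurable_sets[OF this T]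
    show "Pair x -` ?T \<in> sets (lborel \<Otimes>\<^sub>M lborel)"
      by (simp only: lborel_prod sets_lborel space_borel Int_UNIV_right)
  qed
  also have "\<dots> = (\<integral>\<^sup>+x. \<integral>\<^sup>+y. ennreal (2 * c) * indicator Q (x, y) \<partial>lborel \<partial>lborel)"
  proof (intro nn_integral_cong)
    fix x y
    have "Pair y -` (Pair x -` ?T) = (if (x, y) \<in> Q then {t. \<bar>t - g x y\<bar> \<le> c} else {})" by auto
    then show "emeasure lborel (Pair y -` (Pair x -` ?T)) = ennreal (2 * c) * indicator Q (x, y)"
      using c by (simp add: emeasure_lborel_abs_le)
  qed
  also have "\<dots> = (\<integral>\<^sup>+z. ennreal (2 * c) * indicator Q z \<partial>(lborel \<Otimes>\<^sub>M lborel))"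
    using Q by (intro sigma_finite_measure.nn_integral_fst sigma_finite_lborel) (simp add: lborel_prod)
  also have "\<dots> = ennreal (2 * c) * emeasure lborel Q"
    using Q by (simp add: lborel_prod nn_integral_cmult_indicator)
  finally show "emeasure lborel ?T = ennreal (2 * c) * emeasure lborel Q" .
qed

text \<open>For fixed \<open>x\<close> the second condition confines \<open>y\<close> to an interval
  of length \<open>2 * h / \<bar>b\<bar>\<close>, and \<open>x\<close> runs through an interval of
  length \<open>2 * r\<close>.\<close>

lemma emeasure_lborel_strip_fst:
  assumes "0 \<le> r" "0 \<le> h" "b \<noteq> 0"
  shows "{(x, y). \<bar>x - x0\<bar> \<le> r \<and> \<bar>a * x + b * y + c\<bar> \<le> h} \<in> sets borel"
    and "emeasure lborel {(x, y). \<bar>x - x0\<bar> \<le> r \<and> \<bar>a * x + b * y + c\<bar> \<le> h}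
      = ennreal (4 * r * h / \<bar>b\<bar>)"
proof -
  let ?T = "{(x::real, y::real). \<bar>x - x0\<bar> \<le> r \<and> \<bar>a * x + b * y + c\<bar> \<le> h}"
  have "closed {z::real \<times> real. \<bar>fst z - x0\<bar> \<le> r \<and> \<bar>a * fst z + b * snd z + c\<bar> \<le> h}"
    by (intro closed_Collect_conj closed_Collect_le continuous_intros)
  then show T: "?T \<in> sets borel" by (simp add: case_prod_unfold)
  have "emeasure lborel ?T = (\<integral>\<^sup>+x. emeasure lborel (Pair x -` ?T) \<partial>lborel)"
    unfolding lborel_prod[symmetric]
    by (rule sigma_finite_measure.emeasure_pair_measure_alt)
      (use T in \<open>simp_all only: lborel_prod sets_lborel sigma_finite_lborel\<close>)
  also have "\<dots> = (\<integral>\<^sup>+x. ennreal (2 * (h / \<bar>b\<bar>)) * indicator {x. \<bar>x - x0\<bar> \<le> r} x \<partial>lborel)"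
  proof (intro nn_integral_cong)
    fix x
    have "\<bar>a * x + b * y + c\<bar> \<le> h \<longleftrightarrow> \<bar>y - (- (a * x + c) / b)\<bar> \<le> h / \<bar>b\<bar>" for y
    proof -
      have "a * x + b * y + c = b * (y - (- (a * x + c) / b))" using assms by (simp add: field_simps)
      then have "\<bar>a * x + b * y + c\<bar> = \<bar>b\<bar> * \<bar>y - (- (a * x + c) / b)\<bar>" by (metis abs_mult)
      then show ?thesis using assms by (simp add: pos_le_divide_eq mult.commute)
    qed
    then have "Pair x -` ?T = (if \<bar>x - x0\<bar> \<le> r then {y. \<bar>y - (- (a * x + c) / b)\<bar> \<le> h / \<bar>b\<bar>} else {})"
      by auto
    then show "emeasure lborel (Pair x -` ?T) = ennreal (2 * (h / \<bar>b\<bar>)) * indicator {x. \<bar>x - x0\<bar> \<le> r} x"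
      using assms emeasure_lborel_abs_le[of "h / \<bar>b\<bar>"] by simp
  qed
  also have "\<dots> = ennreal (2 * (h / \<bar>b\<bar>)) * emeasure lborel {x. \<bar>x - x0\<bar> \<le> r}"
    by (rule nn_integral_cmult_indicator) simp
  also have "\<dots> = ennreal (4 * r * h / \<bar>b\<bar>)"
    using assms by (simp add: emeasure_lborel_abs_le ennreal_mult[symmetric] mult_ac)
  finally show "emeasure lborel ?T = ennreal (4 * r * h / \<bar>b\<bar>)" .
qed

text \<open>The slices at fixed \<open>y\<close> are those of the previous kind of parallelogram
  with \<open>a\<close> and \<open>b\<close> exchanged.\<close>

lemma emeasure_lborel_strip_snd:
  assumes "0 \<le> r" "0 \<le> h" "a \<noteq> 0"
  shows "{(x, y). \<bar>y - y0\<bar> \<le> r \<and> \<bar>a * x + b * y + c\<bar> \<le> h} \<in> sets borel"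
    and "emeasure lborel {(x, y). \<bar>y - y0\<bar> \<le> r \<and> \<bar>a * x + b * y + c\<bar> \<le> h}
      = ennreal (4 * r * h / \<bar>a\<bar>)"
proof -
  let ?T = "{(x::real, y::real). \<bar>y - y0\<bar> \<le> r \<and> \<bar>a * x + b * y + c\<bar> \<le> h}"
  let ?T' = "{(x::real, y::real). \<bar>x - y0\<bar> \<le> r \<and> \<bar>b * x + a * y + c\<bar> \<le> h}"
  have "closed {z::real \<times> real. \<bar>snd z - y0\<bar> \<le> r \<and> \<bar>a * fst z + b * snd z + c\<bar> \<le> h}"
    by (intro closed_Collect_conj closed_Collect_le continuous_intros)
  then show T: "?T \<in> sets borel" by (simp add: case_prod_unfold)
  have "emeasure lborel ?T = (\<integral>\<^sup>+y. emeasure lborel ((\<lambda>x. (x, y)) -` ?T) \<partial>lborel)"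
    unfolding lborel_prod[symmetric]
    by (rule lborel_pair.emeasure_pair_measure_alt2) (use T in \<open>simp_all only: lborel_prod sets_lborel\<close>)
  also have "\<dots> = (\<integral>\<^sup>+y. emeasure lborel (Pair y -` ?T') \<partial>lborel)"
    by (intro nn_integral_cong arg_cong[where f="emeasure lborel"]) (auto simp: algebra_simps)
  also have "\<dots> = emeasure lborel ?T'"
    unfolding lborel_prod[symmetric]
    by (rule sigma_finite_measure.emeasure_pair_measure_alt[symmetric])
      (use emeasure_lborel_strip_fst(1)[OF assms, of y0 b c] in \<open>simp_all only: lborel_prod sets_lborel sigma_finite_lborel\<close>)
  also have "\<dots> = ennreal (4 * r * h / \<bar>a\<bar>)"
    using emeasure_lborel_strip_fst(2)[of r h a y0 b c] assms by simp
  finally show "emeasure lborel ?T = ennreal (4 * r * h / \<bar>a\<bar>)" .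
qed

section \<open>Volumes of metric balls\<close>

lemma hball_eq: "heis.mball q r = {p. hdist p q < r}"
  by (auto simp: heis.commute)

lemma open_hball [simp]: "open (heis.mball q r)"
  unfolding hball_eq by (intro open_Collect_less continuous_on_hdist continuous_on_const)

lemma closed_hcball [simp]: "closed (heis.mcball q r)"
proof -
  have "heis.mcball q r = {p. hdist p q \<le> r}" by (auto simp: heis.commute)
  then show ?thesis using closed_Collect_le[OF continuous_on_hdist continuous_on_const] by simp
qed

lemma emeasure_hcball_le:
  assumes "0 \<le> r" shows "emeasure lborel (heis.mcball q r) \<le> ennreal (2 * r ^ 4)"
proof -
  obtain a b c where q: "q = (a, b, c)" by (cases q)
  \<comment> \<open>With the affine function \<open>y - b\<close> the strip is a square, so the box
    has volume \<open>(4 * r\<^sup>2) * (r\<^sup>2 / 2) = 2 * r ^ 4\<close>.\<close>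
  let ?Q = "{(x, y). \<bar>x - a\<bar> \<le> r \<and> \<bar>0 * x + 1 * y + (- b)\<bar> \<le> r}"
  let ?T = "{(x, y, t). (x, y) \<in> ?Q \<and> \<bar>t - (c - (b * x - a * y) / 2)\<bar> \<le> r\<^sup>2 / 4}"
  note Q = emeasure_lborel_strip_fst[OF assms assms, of 1 a 0 "- b", simplified]
  have g: "(\<lambda>(x, y). c - (b * x - a * y) / 2) \<in> borel_measurable borel"
    unfolding case_prod_unfold by (intro borel_measurable_continuous_onI continuous_intros) auto
  have T: "?T \<in> sets borel" "emeasure lborel ?T = ennreal (2 * (r\<^sup>2 / 4)) * ennreal (4 * r * r)"
    using emeasure_lborel_fibre_interval[OF Q(1) _ g, of "r\<^sup>2 / 4"] Q(2) by simp_all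
  have "heis.mcball q r \<subseteq> ?T"
  proof
    fix p assume p: "p \<in> heis.mcball q r"
    obtain x y t where xyt: "p = (x, y, t)" by (cases p)
    have "hdist (x, y, t) (a, b, c) \<le> r" using p xyt q by (simp add: heis.commute)
    from hdist_le_D[OF this] show "p \<in> ?T" by (simp add: xyt algebra_simps)
  qed
  then have "emeasure lborel (heis.mcball q r) \<le> emeasure lborel ?T"
    using T(1) by (intro emeasure_mono) auto
  also have "\<dots> = ennreal (2 * r ^ 4)"
    unfolding T(2) using assms by (subst ennreal_mult[symmetric]) (auto simp: power2_eq_square eval_nat_numeral)
  finally show ?thesis .
qed

lemma emeasure_hball_le:
  assumes "0 \<le> r" shows "emeasure lborel (heis.mball q r) \<le> ennreal (2 * r ^ 4)"
proof -
  have "emeasure lborel (heis.mball q r) \<le> emeasure lborel (heis.mcball q r)"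
    by (intro emeasure_mono) (auto simp: borel_closed)
  then show ?thesis using emeasure_hcball_le[OF assms] by (rule order_trans)
qed

lemma emeasure_hball_ge:
  assumes "0 < r" shows "ennreal (r ^ 4 / 4) \<le> emeasure lborel (heis.mball q r)"
proof -
  obtain a b c where q: "q = (a, b, c)" by (cases q)
  let ?Q = "{(x, y). \<bar>x - a\<bar> \<le> r / 2 \<and> \<bar>0 * x + 1 * y + (- b)\<bar> \<le> r / 2}"
  let ?T = "{(x, y, t). (x, y) \<in> ?Q \<and> \<bar>t - (c - (b * x - a * y) / 2)\<bar> \<le> r\<^sup>2 / 8}"
  have r2: "0 \<le> r / 2" using assms by simp
  note Q = emeasure_lborel_strip_fst[OF r2 r2, of 1 a 0 "- b", simplified]
  have g: "(\<lambda>(x, y). c - (b * x - a * y) / 2) \<in> borel_measurable borel"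
    unfolding case_prod_unfold by (intro borel_measurable_continuous_onI continuous_intros) auto
  have T: "emeasure lborel ?T = ennreal (2 * (r\<^sup>2 / 8)) * ennreal (r * r)"
    using emeasure_lborel_fibre_interval[OF Q(1) _ g, of "r\<^sup>2 / 8"] Q(2) by simp_all
  have "?T \<subseteq> heis.mball q r"
  proof
    fix p assume p: "p \<in> ?T"
    obtain x y t where xyt: "p = (x, y, t)" by (cases p)
    have "hdist (x, y, t) (a, b, c) < r"
      using p assms by (intro hdist_less_I) (auto simp: xyt algebra_simps)
    then show "p \<in> heis.mball q r" by (simp add: xyt q heis.commute)
  qed
  then have "emeasure lborel ?T \<le> emeasure lborel (heis.mball q r)"
    by (intro emeasure_mono) auto
  also have "emeasure lborel ?T = ennreal (r ^ 4 / 4)"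
    unfolding T using assms by (subst ennreal_mult[symmetric]) (auto simp: power2_eq_square eval_nat_numeral)
  finally show ?thesis .
qed

section \<open>Projections along horizontal lines\<close>

text \<open>Sets swept out by lines are not shown to be measurable, so their volume is taken as
  outer measure. Subadditivity passes from measurable hulls that attain the outer measure.\<close>

lemma outer_measure_of_UN_le:
  "outer_measure_of M (\<Union>i::nat. A i) \<le> (\<Sum>i. outer_measure_of M (A i))"
  if "\<And>i. A i \<subseteq> space M"
proof -
  have "\<exists>E\<in>sets M. A i \<subseteq> E \<and> outer_measure_of M (A i) = emeasure M E" for i
    using outer_measure_of_attain[OF that] by blast
  then obtain E where E: "\<And>i. E i \<in> sets M" "\<And>i. A i \<subseteq> E i"
      "\<And>i. outer_measure_of M (A i) = emeasure M (E i)" by metis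
  have "outer_measure_of M (\<Union>i. A i) \<le> outer_measure_of M (\<Union>i. E i)"
    using E by (intro outer_measure_of_mono) blast
  also have "\<dots> = emeasure M (\<Union>i. E i)" using E by (intro outer_measure_of_eq) blast
  also have "\<dots> \<le> (\<Sum>i. emeasure M (E i))" using E by (intro emeasure_subadditive_countably) auto
  finally show ?thesis by (simp add: E)
qed

lemma outer_measure_of_Un_le:
  assumes "A \<subseteq> space M" "B \<subseteq> space M"
  shows "outer_measure_of M (A \<union> B) \<le> outer_measure_of M A + outer_measure_of M B"
proof -
  obtain E F where E: "E \<in> sets M" "A \<subseteq> E" "outer_measure_of M A = emeasure M E"
    and F: "F \<in> sets M" "B \<subseteq> F" "outer_measure_of M B = emeasure M F"
    using outer_measure_of_attain assms by meson
  have "outer_measure_of M (A \<union> B) \<le> outer_measure_of M (E \<union> F)"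
    using E F by (intro outer_measure_of_mono) blast
  also have "\<dots> \<le> emeasure M E + emeasure M F"
    using E F by (subst outer_measure_of_eq) (auto intro: emeasure_subadditive)
  finally show ?thesis by (simp add: E F)
qed

lemma emeasure_le_outer_measure_of:
  "A \<in> sets M \<Longrightarrow> A \<subseteq> B \<Longrightarrow> emeasure M A \<le> outer_measure_of M B"
  by (metis outer_measure_of_eq outer_measure_of_mono)

text \<open>For \<open>a\<^sup>2 + b\<^sup>2 = 1\<close> the zero set is a vertical plane, and the
  absolute value is the Euclidean distance of \<open>(x, y)\<close> from the line below that
  plane.\<close>

definition aff :: "real \<Rightarrow> real \<Rightarrow> real \<Rightarrow> heis \<Rightarrow> real" where
  "aff a b c p = a * fst p + b * fst (snd p) + c"

lemma aff_Pair [simp]: "aff a b c (x, y, t) = a * x + b * y + c"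
  by (simp add: aff_def)

lemma continuous_on_aff: "continuous_on UNIV (aff a b c)"
  unfolding aff_def by (intro continuous_intros)

lemma measurable_aff [measurable]: "aff a b c \<in> borel_measurable borel"
  by (intro borel_measurable_continuous_onI continuous_on_aff)

text \<open>A coordinate direction along which \<open>aff a b c\<close> has slope at least
  \<open>1/2\<close> in absolute value. A unit vector \<open>(a, b)\<close> always admits
  one.\<close>

definition transversal :: "real \<Rightarrow> real \<Rightarrow> heis \<Rightarrow> bool" where
  "transversal a b v \<longleftrightarrow> v = (1, 0, 0) \<and> 1/2 \<le> \<bar>a\<bar> \<or> v = (0, 1, 0) \<and> 1/2 \<le> \<bar>b\<bar>"

text \<open>Along the lines \<open>\<tau> \<mapsto> p \<odot> (\<tau>, 0, 0)\<close> the functions \<open>y\<close> and \<open>t + x y / 2\<close> are constant,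
  along \<open>\<tau> \<mapsto> p \<odot> (0, \<tau>, 0)\<close> the functions \<open>x\<close> and \<open>t - x y / 2\<close> are. In these coordinates a
  ball of radius \<open>\<rho>\<close> projects into a parallelogram of area comparable to \<open>\<rho>\<^sup>3\<close>.\<close>

lemma outer_measure_lines_hdiam:
  assumes v: "transversal a b v" and C: "\<And>x x'. x \<in> C \<Longrightarrow> x' \<in> C \<Longrightarrow> hdist x x' \<le> \<rho>"
    and \<rho>: "0 \<le> \<rho>" and h: "0 \<le> h"
  shows "outer_measure_of lborel {p. \<bar>aff a b c p\<bar> \<le> h \<and> (\<exists>\<tau>. p \<odot> (\<tau> *\<^sub>R v) \<in> C)} \<le> ennreal (12 * h * \<rho> ^ 3)"
    (is "outer_measure_of lborel ?S \<le> _")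
proof (cases "C = {}")
  case True
  then show ?thesis by simp
next
  case False
  then obtain a' b' t' where x0: "(a', b', t') \<in> C" by (metis equals0I prod_cases3)
  \<comment> \<open>The half-height consists of \<open>\<rho>\<^sup>2 / 4\<close> from the vertical
    part of the metric and \<open>\<rho>\<^sup>2 / 2\<close> from a product of two horizontal
    differences.\<close>
  have \<rho>4: "0 \<le> 3 / 4 * \<rho>\<^sup>2" by simp
  have key: "ennreal (2 * (3 / 4 * \<rho>\<^sup>2)) * ennreal (4 * \<rho> * h / \<bar>k\<bar>) \<le> ennreal (12 * h * \<rho> ^ 3)" if "1/2 \<le> \<bar>k\<bar>" for k
  proof -
    have "4 * \<rho> * h / \<bar>k\<bar> \<le> 4 * \<rho> * h / (1 / 2)"
      using that \<rho> h by (intro divide_left_mono) auto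
    then have "2 * (3 / 4 * \<rho>\<^sup>2) * (4 * \<rho> * h / \<bar>k\<bar>) \<le> 2 * (3 / 4 * \<rho>\<^sup>2) * (8 * \<rho> * h)"
      by (intro mult_left_mono) auto
    also have "\<dots> = 12 * h * \<rho> ^ 3" by (simp add: power2_eq_square power3_eq_cube)
    finally show ?thesis by (subst ennreal_mult[symmetric]) (auto intro!: ennreal_leI simp: \<rho> h)
  qed
  from v consider (1) "v = (1, 0, 0)" "1/2 \<le> \<bar>a\<bar>" | (2) "v = (0, 1, 0)" "1/2 \<le> \<bar>b\<bar>"
    unfolding transversal_def by blast
  then show ?thesis
  proof cases
    case 1
    let ?Q = "{(x, y). \<bar>y - b'\<bar> \<le> \<rho> \<and> \<bar>a * x + b * y + c\<bar> \<le> h}"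
    \<comment> \<open>The line invariant \<open>t + x * y / 2\<close> is compared with its value at
      the reference point, corrected by the shear \<open>a' * (y - b')\<close>.\<close>
    let ?T = "{(x, y, t). (x, y) \<in> ?Q \<and> \<bar>t - (t' + a' * b' / 2 + a' * (y - b') - x * y / 2)\<bar> \<le> 3 / 4 * \<rho>\<^sup>2}"
    have a0: "a \<noteq> 0" using 1 by auto
    note Q = emeasure_lborel_strip_snd[OF \<rho> h a0, of b' b c]
    have g: "(\<lambda>(x, y). t' + a' * b' / 2 + a' * (y - b') - x * y / 2) \<in> borel_measurable borel"
      unfolding case_prod_unfold by (intro borel_measurable_continuous_onI continuous_intros) auto
    note T = emeasure_lborel_fibre_interval[OF Q(1) \<rho>4 g, unfolded Q(2)]
    have "?S \<subseteq> ?T"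
    proof
      fix p assume p: "p \<in> ?S"
      obtain x y t where xyt: "p = (x, y, t)" by (cases p)
      from p obtain \<tau> where h': "\<bar>a * x + b * y + c\<bar> \<le> h" and "(x, y, t) \<odot> (\<tau> *\<^sub>R v) \<in> C"
        by (auto simp: xyt)
      then have "(x + \<tau>, y, t - \<tau> * y / 2) \<in> C" by (simp add: 1)
      from hdist_le_D[OF C[OF this x0]]
      have d: "\<bar>x + \<tau> - a'\<bar> \<le> \<rho>" "\<bar>y - b'\<bar> \<le> \<rho>"
        "\<bar>t - \<tau> * y / 2 - t' + (b' * (x + \<tau>) - a' * y) / 2\<bar> \<le> \<rho>\<^sup>2 / 4" by auto
      have "\<bar>(x + \<tau> - a') * (y - b')\<bar> \<le> \<rho>\<^sup>2"
        using d(1,2) \<rho> unfolding abs_mult power2_eq_square by (intro mult_mono) auto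
      moreover have "t - (t' + a' * b' / 2 + a' * (y - b') - x * y / 2)
        = (t - \<tau> * y / 2 - t' + (b' * (x + \<tau>) - a' * y) / 2) + (x + \<tau> - a') * (y - b') / 2"
        by (simp add: field_simps)
      ultimately have "\<bar>t - (t' + a' * b' / 2 + a' * (y - b') - x * y / 2)\<bar> \<le> 3 / 4 * \<rho>\<^sup>2"
        using d(3) by linarith
      then show "p \<in> ?T" using h' d by (simp add: xyt)
    qed
    then have "outer_measure_of lborel ?S \<le> outer_measure_of lborel ?T" by (rule outer_measure_of_mono)
    also have "\<dots> = ennreal (2 * (3 / 4 * \<rho>\<^sup>2)) * ennreal (4 * \<rho> * h / \<bar>a\<bar>)"
      using T by (subst outer_measure_of_eq) auto
    also have "\<dots> \<le> ennreal (12 * h * \<rho> ^ 3)" using key 1 by blast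
    finally show ?thesis .
  next
    case 2
    let ?Q = "{(x, y). \<bar>x - a'\<bar> \<le> \<rho> \<and> \<bar>a * x + b * y + c\<bar> \<le> h}"
    let ?T = "{(x, y, t). (x, y) \<in> ?Q \<and> \<bar>t - (t' - a' * b' / 2 - b' * (x - a') + x * y / 2)\<bar> \<le> 3 / 4 * \<rho>\<^sup>2}"
    have b0: "b \<noteq> 0" using 2 by auto
    note Q = emeasure_lborel_strip_fst[OF \<rho> h b0, of a' a c]
    have g: "(\<lambda>(x, y). t' - a' * b' / 2 - b' * (x - a') + x * y / 2) \<in> borel_measurable borel"
      unfolding case_prod_unfold by (intro borel_measurable_continuous_onI continuous_intros) auto
    note T = emeasure_lborel_fibre_interval[OF Q(1) \<rho>4 g, unfolded Q(2)]
    have "?S \<subseteq> ?T"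
    proof
      fix p assume p: "p \<in> ?S"
      obtain x y t where xyt: "p = (x, y, t)" by (cases p)
      from p obtain \<tau> where h': "\<bar>a * x + b * y + c\<bar> \<le> h" and "(x, y, t) \<odot> (\<tau> *\<^sub>R v) \<in> C"
        by (auto simp: xyt)
      then have "(x, y + \<tau>, t + x * \<tau> / 2) \<in> C" by (simp add: 2)
      from hdist_le_D[OF C[OF this x0]]
      have d: "\<bar>x - a'\<bar> \<le> \<rho>" "\<bar>y + \<tau> - b'\<bar> \<le> \<rho>"
        "\<bar>t + x * \<tau> / 2 - t' + (b' * x - a' * (y + \<tau>)) / 2\<bar> \<le> \<rho>\<^sup>2 / 4" by auto
      have "\<bar>(x - a') * (y + \<tau> - b')\<bar> \<le> \<rho>\<^sup>2"
        using d(1,2) \<rho> unfolding abs_mult power2_eq_square by (intro mult_mono) auto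
      moreover have "t - (t' - a' * b' / 2 - b' * (x - a') + x * y / 2)
        = (t + x * \<tau> / 2 - t' + (b' * x - a' * (y + \<tau>)) / 2) - (x - a') * (y + \<tau> - b') / 2"
        by (simp add: field_simps)
      ultimately have "\<bar>t - (t' - a' * b' / 2 - b' * (x - a') + x * y / 2)\<bar> \<le> 3 / 4 * \<rho>\<^sup>2"
        using d(3) by linarith
      then show "p \<in> ?T" using h' d by (simp add: xyt)
    qed
    then have "outer_measure_of lborel ?S \<le> outer_measure_of lborel ?T" by (rule outer_measure_of_mono)
    also have "\<dots> = ennreal (2 * (3 / 4 * \<rho>\<^sup>2)) * ennreal (4 * \<rho> * h / \<bar>b\<bar>)"
      using T by (subst outer_measure_of_eq) auto
    also have "\<dots> \<le> ennreal (12 * h * \<rho> ^ 3)" using key 2 by blast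
    finally show ?thesis .
  qed
qed

text \<open>Apply the bound for a single set to each member of a nearly optimal cover of
  \<open>A\<close> and sum: both sides are governed by the cubes of the diameters.\<close>

lemma outer_measure_lines_hausdorff3:
  assumes v: "transversal a b v" and h: "0 \<le> h" and A: "hausdorff3_outer A < \<infinity>"
  shows "outer_measure_of lborel {p. \<bar>aff a b c p\<bar> \<le> h \<and> (\<exists>\<tau>. p \<odot> (\<tau> *\<^sub>R v) \<in> A)}
    \<le> ennreal (12 * h) * hausdorff3_outer A"
    (is "outer_measure_of lborel (?S A) \<le> _")
proof (rule ennreal_le_epsilon)
  fix e :: real assume e: "0 < e"
  \<comment> \<open>The summand \<open>1\<close> in the denominator covers the case
    \<open>h = 0\<close>.\<close>
  define d where "d = e / (12 * h + 1)"
  have d: "0 < d" "12 * h * d \<le> e" using e h by (auto simp: d_def field_simps)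
  \<comment> \<open>Covers at scale \<open>1\<close> suffice: the premeasure is below the Hausdorff
    measure at every scale, and the scale serves to make the diameters finite.\<close>
  have "hausdorff3_pre 1 A \<le> hausdorff3_outer A"
    unfolding hausdorff3_outer_def by (rule SUP_upper) simp
  also have "\<dots> < hausdorff3_outer A + ennreal d"
    using A d by (cases "hausdorff3_outer A") (auto simp: ennreal_plus[symmetric] ennreal_less_iff simp del: ennreal_plus)
  finally obtain C where C: "A \<subseteq> (\<Union>i. C i)" "\<And>i. hdiam (C i) \<le> ennreal 1"
    and sum: "(\<Sum>i. hdiam (C i) ^ 3) < hausdorff3_outer A + ennreal d"
    unfolding hausdorff3_pre_def INF_less_iff by auto
  define \<rho> where "\<rho> i = enn2real (hdiam (C i))" for i
  have "hdiam (C i) < top" for i using C(2)[of i] by (rule order_le_less_trans) simp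
  then have \<rho>: "hdiam (C i) = ennreal (\<rho> i)" "0 \<le> \<rho> i" for i by (simp_all add: \<rho>_def)
  have dist: "hdist x x' \<le> \<rho> i" if "x \<in> C i" "x' \<in> C i" for x x' i
    using hdist_le_hdiam[OF that] \<rho>[of i] by (simp add: ennreal_le_iff)
  have "outer_measure_of lborel (?S A) \<le> outer_measure_of lborel (\<Union>i. ?S (C i))"
    using C(1) by (intro outer_measure_of_mono) blast
  also have "\<dots> \<le> (\<Sum>i. outer_measure_of lborel (?S (C i)))"
    by (rule outer_measure_of_UN_le) simp
  also have "\<dots> \<le> (\<Sum>i. ennreal (12 * h) * hdiam (C i) ^ 3)"
  proof (rule suminf_le)
    fix i
    have "outer_measure_of lborel (?S (C i)) \<le> ennreal (12 * h * \<rho> i ^ 3)"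
      using v dist \<rho> h by (intro outer_measure_lines_hdiam) auto
    then show "outer_measure_of lborel (?S (C i)) \<le> ennreal (12 * h) * hdiam (C i) ^ 3"
      using \<rho> h by (simp add: ennreal_mult ennreal_power)
  qed auto
  also have "\<dots> = ennreal (12 * h) * (\<Sum>i. hdiam (C i) ^ 3)" by simp
  also have "\<dots> \<le> ennreal (12 * h) * (hausdorff3_outer A + ennreal d)"
    using sum by (intro mult_left_mono) auto
  also have "\<dots> = ennreal (12 * h) * hausdorff3_outer A + ennreal (12 * h * d)"
    using h d by (simp add: distrib_left ennreal_mult)
  also have "\<dots> \<le> ennreal (12 * h) * hausdorff3_outer A + ennreal e"
    using d by (intro add_left_mono ennreal_leI)
  finally show "outer_measure_of lborel (?S A) \<le> ennreal (12 * h) * hausdorff3_outer A + ennreal e" .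
qed

lemma sets_hausdorff3 [measurable_cong, simp]: "sets hausdorff3 = sets borel"
  unfolding hausdorff3_def using sets.sigma_sets_eq[of "borel :: heis measure"] by simp

lemma space_hausdorff3 [simp]: "space hausdorff3 = UNIV"
  using sets_eq_imp_space_eq[OF sets_hausdorff3] by simp

lemma ex_dyadic_level:
  assumes "0 < x" "x \<le> M" shows "\<exists>n. M * (1/2) ^ Suc n < x \<and> x \<le> M * (1/2::real) ^ n"
proof -
  have "\<exists>n. M * (1/2) ^ n < x"
  proof -
    have "0 < x / M" using assms by simp
    then obtain n where "(1/2::real) ^ n < x / M" using real_arch_pow_inv[of "x / M" "1/2"] by auto
    then show ?thesis using assms by (auto simp: field_simps)
  qed
  define n where "n = (LEAST n. M * (1/2) ^ n < x)"
  have n: "M * (1/2) ^ n < x" "\<And>k. k < n \<Longrightarrow> \<not> M * (1/2) ^ k < x"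
    unfolding n_def using \<open>\<exists>n. _\<close> by (auto intro: LeastI_ex dest: not_less_Least)
  have "n \<noteq> 0" using n(1) assms(2) by (cases "n = 0") simp_all
  then show ?thesis using n(1) n(2)[of "n - 1"] by (intro exI[of _ "n - 1"]) auto
qed

text \<open>The previous bound applied on each dyadic level set of \<open>\<bar>aff a b c\<bar>\<close> in \<open>G\<close>.\<close>

lemma outer_measure_shadow:
  assumes v: "transversal a b v" and G: "G \<in> sets borel" and fin: "emeasure hausdorff3 G < \<infinity>"
    and M: "\<And>x. x \<in> G \<Longrightarrow> \<bar>aff a b c x\<bar> \<le> M"
  shows "outer_measure_of lborel {p. \<exists>\<tau>. p \<odot> (\<tau> *\<^sub>R v) \<in> G \<and> \<bar>aff a b c p\<bar> \<le> \<bar>aff a b c (p \<odot> (\<tau> *\<^sub>R v))\<bar>}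
    \<le> 24 * (\<integral>\<^sup>+x\<in>G. ennreal \<bar>aff a b c x\<bar> \<partial>hausdorff3)"
    (is "outer_measure_of lborel ?S \<le> _")
proof -
  note [measurable] = G
  let ?f = "aff a b c"
  \<comment> \<open>The maximum with \<open>1\<close> keeps all dyadic levels positive.\<close>
  define M' where "M' = max M 1"
  have M': "0 < M'" "\<And>x. x \<in> G \<Longrightarrow> \<bar>?f x\<bar> \<le> M'" using M by (auto simp: M'_def le_max_iff_disj)
  let ?h = "\<lambda>n::nat. M' * (1/2) ^ n"
  define L where "L n = {x \<in> G. ?h (Suc n) < \<bar>?f x\<bar> \<and> \<bar>?f x\<bar> \<le> ?h n}" for n
  \<comment> \<open>The zero set is missed by the dyadic levels; its shadow lies in a strip of width
    \<open>0\<close> and is null.\<close>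
  define L0 where "L0 = {x \<in> G. ?f x = 0}"
  let ?N = "\<lambda>A h. {p. \<bar>?f p\<bar> \<le> h \<and> (\<exists>\<tau>. p \<odot> (\<tau> *\<^sub>R v) \<in> A)}"
  have L[measurable]: "L n \<in> sets borel" for n unfolding L_def by measurable
  have L0[measurable]: "L0 \<in> sets borel" unfolding L0_def by measurable
  have finL: "hausdorff3_outer A < \<infinity>" if "A \<subseteq> G" for A
    using fin hausdorff3_outer_mono[OF that] emeasure_hausdorff3[OF G] by simp
  \<comment> \<open>As a measure, the integral of \<open>\<bar>?f\<bar>\<close> adds up over the
    disjoint level sets.\<close>
  define \<nu> where "\<nu> = density hausdorff3 (\<lambda>x. ennreal \<bar>?f x\<bar>)"
  have \<nu>: "emeasure \<nu> A = (\<integral>\<^sup>+x\<in>A. ennreal \<bar>?f x\<bar> \<partial>hausdorff3)" if "A \<in> sets borel" for A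
    unfolding \<nu>_def using that by (subst emeasure_density) auto
  have "?S \<subseteq> ?N L0 0 \<union> (\<Union>n. ?N (L n) (?h n))"
  proof
    fix p assume "p \<in> ?S"
    then obtain \<tau> where x: "p \<odot> (\<tau> *\<^sub>R v) \<in> G" "\<bar>?f p\<bar> \<le> \<bar>?f (p \<odot> (\<tau> *\<^sub>R v))\<bar>" by blast
    show "p \<in> ?N L0 0 \<union> (\<Union>n. ?N (L n) (?h n))"
    proof (cases "?f (p \<odot> (\<tau> *\<^sub>R v)) = 0")
      case True
      then show ?thesis using x by (auto simp: L0_def)
    next
      case False
      then obtain n where n: "?h (Suc n) < \<bar>?f (p \<odot> (\<tau> *\<^sub>R v))\<bar>" "\<bar>?f (p \<odot> (\<tau> *\<^sub>R v))\<bar> \<le> ?h n"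
        using ex_dyadic_level[of "\<bar>?f (p \<odot> (\<tau> *\<^sub>R v))\<bar>" M'] M'(2)[OF x(1)] by auto
      then have "p \<odot> (\<tau> *\<^sub>R v) \<in> L n" using x by (simp add: L_def)
      moreover have "\<bar>?f p\<bar> \<le> ?h n" using x n by linarith
      ultimately show ?thesis by blast
    qed
  qed
  then have "outer_measure_of lborel ?S \<le> outer_measure_of lborel (?N L0 0 \<union> (\<Union>n. ?N (L n) (?h n)))"
    by (rule outer_measure_of_mono)
  also have "\<dots> \<le> outer_measure_of lborel (?N L0 0) + outer_measure_of lborel (\<Union>n. ?N (L n) (?h n))"
    by (rule outer_measure_of_Un_le) auto
  also have "\<dots> \<le> 0 + (\<Sum>n. outer_measure_of lborel (?N (L n) (?h n)))"
  proof (intro add_mono outer_measure_of_UN_le)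
    show "outer_measure_of lborel (?N L0 0) \<le> 0"
      using outer_measure_lines_hausdorff3[OF v order_refl finL[of L0]] by (simp add: L0_def)
  qed auto
  also have "\<dots> \<le> 0 + (\<Sum>n. 24 * emeasure \<nu> (L n))"
  proof (intro add_left_mono suminf_le)
    fix n
    have h0: "0 \<le> ?h n" using M' by simp
    have "outer_measure_of lborel (?N (L n) (?h n)) \<le> ennreal (12 * ?h n) * emeasure hausdorff3 (L n)"
      using outer_measure_lines_hausdorff3[OF v h0 finL[of "L n"]] emeasure_hausdorff3[OF L] by (auto simp: L_def)
    also have "\<dots> = (\<integral>\<^sup>+x\<in>L n. ennreal (12 * ?h n) \<partial>hausdorff3)"
      by (subst nn_integral_cmult_indicator) auto
    also have "\<dots> \<le> (\<integral>\<^sup>+x\<in>L n. 24 * ennreal \<bar>?f x\<bar> \<partial>hausdorff3)"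
    proof (intro nn_integral_mono)
      fix x
      show "ennreal (12 * ?h n) * indicator (L n) x \<le> 24 * ennreal \<bar>?f x\<bar> * indicator (L n) x"
      proof (cases "x \<in> L n")
        case True
        \<comment> \<open>On \<open>L n\<close> the level satisfies
          \<open>?h n = 2 * ?h (Suc n) < 2 * \<bar>?f x\<bar>\<close>, which doubles the constant
          \<open>12\<close>.\<close>
        then have "12 * ?h n \<le> 24 * \<bar>?f x\<bar>" by (simp add: L_def)
        then have "ennreal (12 * ?h n) \<le> ennreal 24 * ennreal \<bar>?f x\<bar>"
          by (subst ennreal_mult[symmetric]) (auto intro!: ennreal_leI)
        then show ?thesis using True by simp
      qed simp
    qed
    also have "\<dots> = 24 * emeasure \<nu> (L n)"
      by (simp add: \<nu> mult.assoc nn_integral_cmult)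
    finally show "outer_measure_of lborel (?N (L n) (?h n)) \<le> 24 * emeasure \<nu> (L n)" .
  qed auto
  also have "\<dots> = 24 * (\<Sum>n. emeasure \<nu> (L n))" by simp
  also have "(\<Sum>n. emeasure \<nu> (L n)) = emeasure \<nu> (\<Union>n. L n)"
  proof (rule suminf_emeasure)
    show "range L \<subseteq> sets \<nu>" by (auto simp: \<nu>_def)
    have "?h m \<le> ?h (Suc n)" if "n < m" for m n
      using M' that by (intro mult_left_mono power_decreasing) auto
    then have "L n \<inter> L m = {}" if "n < m" for n m using that by (fastforce simp: L_def)
    then show "disjoint_family L" unfolding disjoint_family_on_def by (metis Int_commute nat_neq_iff)
  qed
  also have "24 * emeasure \<nu> (\<Union>n. L n) \<le> 24 * emeasure \<nu> G"
    by (intro mult_left_mono emeasure_mono) (auto simp: L_def \<nu>_def)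
  finally show ?thesis by (simp add: \<nu> G)
qed

section \<open>Vertical differences and \<open>\<beta>\<close>-numbers\<close>

lemma abs_aff_diff_le:
  assumes "a\<^sup>2 + b\<^sup>2 = 1" shows "\<bar>aff a b c p - aff a b c q\<bar> \<le> hdist p q"
proof -
  obtain x y t where p: "p = (x, y, t)" by (cases p)
  obtain x' y' t' where q: "q = (x', y', t')" by (cases q)
  have "\<bar>aff a b c p - aff a b c q\<bar> = \<bar>inner (a, b) (x - x', y - y')\<bar>"
    by (simp add: p q algebra_simps)
  also have "\<dots> \<le> norm (a, b) * norm (x - x', y - y')" by (rule Cauchy_Schwarz_ineq2)
  also have "norm (a, b) = 1" using assms by (simp add: norm_Pair)
  also have "1 * norm (x - x', y - y') \<le> hdist p q" by (simp add: p q hdist_Pair)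
  finally show ?thesis .
qed

text \<open>A nonzero normal of \<open>W\<close> is orthogonal to the vertical axis, hence
  horizontal, and can be normalised to \<open>(a, b)\<close>. Horizontal coordinates add under the
  group law, so a suitable \<open>c\<close> makes the affine function vanish on the coset; being
  1-Lipschitz, it is bounded by the distance to it.\<close>

lemma vertical_subgroup_aff:
  assumes W: "vertical_subgroup W"
  obtains a b c where "a\<^sup>2 + b\<^sup>2 = 1" "\<And>x. ennreal \<bar>aff a b c x\<bar> \<le> hinfdist x ((\<odot>) z ` W)"
proof -
  have sub: "subspace W" "dim W = 2" "\<And>t. (0, 0, t) \<in> W"
    using W by (auto simp: vertical_subgroup_def)
  have "dim W < DIM(heis)" using sub by simp
  then obtain n :: heis where n0: "n \<noteq> 0" and n1: "\<And>w. w \<in> span W \<Longrightarrow> orthogonal n w"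
    by (rule orthogonal_to_subspace_exists) blast
  have n2: "orthogonal n w" if "w \<in> W" for w using n1 span_base[OF that] by simp
  obtain a' b' c' where abc: "n = (a', b', c')" by (cases n)
  have c0: "c' = 0" using n2[OF sub(3)[of 1]] by (simp add: abc orthogonal_def)
  define r where "r = sqrt (a'\<^sup>2 + b'\<^sup>2)"
  have pos: "0 < a'\<^sup>2 + b'\<^sup>2" using n0 c0 by (simp add: abc zero_prod_def sum_power2_gt_zero_iff)
  then have r: "0 < r" "r\<^sup>2 = a'\<^sup>2 + b'\<^sup>2" by (auto simp: r_def)
  define a b where "a = a' / r" and "b = b' / r"
  have ab: "a\<^sup>2 + b\<^sup>2 = 1"
    using r unfolding a_def b_def power_divide add_divide_distrib[symmetric] r(2)[symmetric] by simp
  obtain z1 z2 z3 where z: "z = (z1, z2, z3)" by (cases z)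
  define c where "c = - (a * z1 + b * z2)"
  have "ennreal \<bar>aff a b c x\<bar> \<le> hinfdist x ((\<odot>) z ` W)" for x
    unfolding hinfdist_def
  proof (rule INF_greatest)
    fix y assume "y \<in> (\<odot>) z ` W"
    then obtain w where w: "w \<in> W" "y = z \<odot> w" by blast
    obtain w1 w2 w3 where w': "w = (w1, w2, w3)" by (cases w)
    have "a' * w1 + b' * w2 = 0" using n2[OF w(1)] c0 by (simp add: abc w' orthogonal_def)
    then have "a * w1 + b * w2 = 0" using r by (simp add: a_def b_def field_simps)
    then have "aff a b c y = 0" by (simp add: w w' z c_def algebra_simps)
    then have "\<bar>aff a b c x\<bar> \<le> hdist x y" using abs_aff_diff_le[OF ab, of c x y] by simp
    then show "ennreal \<bar>aff a b c x\<bar> \<le> ennreal (hdist x y)" by (rule ennreal_leI)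
  qed
  with ab show thesis by (rule that)
qed

text \<open>The set whose indicator is the integrand of \<open>vertical_var\<close>.\<close>

definition vdiff :: "heis set \<Rightarrow> real \<Rightarrow> heis set" where
  "vdiff \<Omega> s = {p. (p \<in> \<Omega>) \<noteq> (p \<odot> (0, 0, s\<^sup>2) \<in> \<Omega>)}"

section \<open>Frontier points on paths between separated points\<close>

lemma connected_disjoint_frontier:
  assumes "connected S" "S \<inter> frontier T = {}" "x \<in> S" "y \<in> S" shows "x \<in> T \<longleftrightarrow> y \<in> T"
  using connected_Int_frontier[OF assms(1), of T] assms(2-4) by blast

lemma continuous_on_hmul_right [continuous_intros]:
  assumes "continuous_on S f" "continuous_on S g" shows "continuous_on S (\<lambda>x. f x \<odot> g x)"
proof -
  have "(\<lambda>x. f x \<odot> g x) = (\<lambda>x. (fst (f x) + fst (g x), fst (snd (f x)) + fst (snd (g x)),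
    snd (snd (f x)) + snd (snd (g x)) + (fst (f x) * fst (snd (g x)) - fst (g x) * fst (snd (f x))) / 2))"
    by (rule ext, case_tac "f x", case_tac "g x") simp
  then show ?thesis by (simp only:) (intro continuous_intros assms, simp)
qed

lemma frontier_between:
  assumes "connected T" "continuous_on T g" "s \<in> T" "t \<in> T" "p \<odot> g s \<in> \<Omega> \<longleftrightarrow> p \<odot> g t \<notin> \<Omega>"
  obtains \<tau> where "\<tau> \<in> T" "p \<odot> g \<tau> \<in> frontier \<Omega>"
proof -
  have "connected ((\<lambda>\<tau>. p \<odot> g \<tau>) ` T)"
    using assms by (intro connected_continuous_image continuous_intros)
  from connected_disjoint_frontier[OF this, of \<Omega> "p \<odot> g s" "p \<odot> g t"] assms(3-5) that
  show thesis by blast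
qed

lemma hmul_central: "p \<odot> (0, 0, t) \<odot> v = p \<odot> v \<odot> (0, 0, t)"
  by (cases p; cases v) (simp add: algebra_simps)

lemma regular3_ge:
  assumes "regular3 A E" "q \<in> E" "0 < r" "ennreal r \<le> hdiam E"
  shows "ennreal (inverse A * r ^ 3) \<le> emeasure hausdorff3 (E \<inter> heis.mball q r)"
  using assms by (simp add: regular3_def)

lemma regular3_le:
  assumes "regular3 A E" "q \<in> E" "0 < r" "ennreal r \<le> hdiam E"
  shows "emeasure hausdorff3 (E \<inter> heis.mball q r) \<le> ennreal (A * r ^ 3)"
  using assms by (simp add: regular3_def)

text \<open>The vertical segment from \<open>p\<close> to its translate joins separated points, and
  its point at height \<open>\<tau>\<close> has distance \<open>2 * sqrt \<tau>\<close> from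
  \<open>p\<close>.\<close>

lemma vertical_frontier_point:
  assumes "p \<in> vdiff \<Omega> s" "0 < s" shows "\<exists>\<tau>. p \<odot> (0, 0, \<tau>) \<in> frontier \<Omega> \<and> hdist (p \<odot> (0, 0, \<tau>)) p \<le> 2 * s"
proof -
  have z: "p \<odot> (0, 0, 0) = p" using hmul_zero(2)[of p] by (simp add: zero_prod_def)
  have "p \<odot> (0, 0, 0) \<in> \<Omega> \<longleftrightarrow> p \<odot> (0, 0, s\<^sup>2) \<notin> \<Omega>"
    using assms(1) by (auto simp: vdiff_def z)
  moreover have "continuous_on {0..s\<^sup>2} (\<lambda>\<tau>::real. (0::real, 0::real, \<tau>))" by (intro continuous_intros)
  ultimately obtain \<tau> where \<tau>: "\<tau> \<in> {0..s\<^sup>2}" "p \<odot> (0, 0, \<tau>) \<in> frontier \<Omega>"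
    using frontier_between[of "{0..s\<^sup>2}" "\<lambda>\<tau>. (0, 0, \<tau>)" 0 "s\<^sup>2" p \<Omega>] by auto
  have "sqrt \<tau> \<le> s" using \<tau> assms(2) by (intro real_le_lsqrt) auto
  then have "hdist (p \<odot> (0, 0, \<tau>)) p \<le> 2 * s" using \<tau> assms(2) by (simp add: hdist_hmul_right)
  with \<tau> show ?thesis by blast
qed

text \<open>If both horizontal sides of the path avoid the frontier, its far vertical side joins
  separated points and meets the frontier where \<open>\<bar>aff a b c\<bar>\<close> is at least
  \<open>s\<close>, against \<open>small\<close>. The radius \<open>7 * s\<close> is
  \<open>3 * s\<close> for \<open>p\<close> plus \<open>2 * s\<close> for each of two sides.\<close>

lemma vdiff_hball_subset:
  assumes s: "0 < s" and ab: "a\<^sup>2 + b\<^sup>2 = 1" and v: "transversal a b v"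
    and small: "\<And>x. x \<in> frontier \<Omega> \<Longrightarrow> hdist x q < 7 * s \<Longrightarrow> \<bar>aff a b c x\<bar> < s"
    and p: "p \<in> vdiff \<Omega> s" "hdist p q < 3 * s"
  shows "\<exists>p'\<in>{p, p \<odot> (0, 0, s\<^sup>2)}. \<exists>\<tau>. p' \<odot> (\<tau> *\<^sub>R v) \<in> frontier \<Omega> \<inter> heis.mball q (7 * s)
    \<and> \<bar>aff a b c p'\<bar> \<le> \<bar>aff a b c (p' \<odot> (\<tau> *\<^sub>R v))\<bar>"
proof (rule ccontr)
  let ?f = "aff a b c"
  assume neg: "\<not> ?thesis"
  define p' where "p' = p \<odot> (0, 0, s\<^sup>2)"
  \<comment> \<open>The slope of \<open>?f\<close> along \<open>v\<close>.\<close>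
  define k where "k = (if v = (1, 0, 0) then a else b)"
  have k: "1/2 \<le> \<bar>k\<bar>" using v unfolding transversal_def k_def by (elim disjE) simp_all
  have fv: "?f (u \<odot> (\<tau> *\<^sub>R v)) = ?f u + \<tau> * k" for u \<tau>
    using v unfolding transversal_def k_def by (cases u, elim disjE) (simp_all add: algebra_simps)
  have nv: "hnorm (\<tau> *\<^sub>R v) = \<bar>\<tau>\<bar>" for \<tau>
    using v unfolding transversal_def by (elim disjE) (simp_all add: norm_Pair)
  \<comment> \<open>The orientation of \<open>v\<close> in which \<open>\<bar>?f\<bar>\<close> grows
    linearly from \<open>p\<close>.\<close>
  define \<sigma> :: real where "\<sigma> = (if 0 \<le> ?f p * k then 1 else -1)"
  have fp': "?f p' = ?f p" unfolding p'_def by (cases p) simp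
  have same_sign: "\<bar>u + w\<bar> = \<bar>u\<bar> + \<bar>w\<bar>" if "0 \<le> u * w" for u w :: real
    using that by (auto simp: zero_le_mult_iff)
  have grow: "\<bar>?f p + \<tau> * k\<bar> = \<bar>?f p\<bar> + \<bar>\<tau>\<bar> * \<bar>k\<bar>" if "0 \<le> \<sigma> * \<tau>" for \<tau>
  proof (cases "0 \<le> ?f p * k")
    case True
    then have "0 \<le> \<tau>" using that by (simp add: \<sigma>_def)
    then have "0 \<le> ?f p * (\<tau> * k)" using mult_nonneg_nonneg[OF _ True] by (simp add: mult_ac)
    then show ?thesis by (simp add: same_sign abs_mult)
  next
    case False
    then have "\<tau> \<le> 0" using that by (simp add: \<sigma>_def)
    then have "0 \<le> ?f p * (\<tau> * k)" using mult_nonpos_nonpos[of \<tau> "?f p * k"] False by (simp add: mult_ac)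
    then show ?thesis by (simp add: same_sign abs_mult)
  qed
  have z: "u \<odot> (0 *\<^sub>R v) = u" for u using hmul_zero(2)[of u] by simp
  have horiz: "u \<in> \<Omega> \<longleftrightarrow> u \<odot> ((\<sigma> * (2 * s)) *\<^sub>R v) \<in> \<Omega>"
    if u: "u \<in> {p, p'}" for u
  proof (rule ccontr)
    assume "\<not> ?thesis"
    then have "u \<odot> ((\<sigma> * 0) *\<^sub>R v) \<in> \<Omega> \<longleftrightarrow> u \<odot> ((\<sigma> * (2 * s)) *\<^sub>R v) \<notin> \<Omega>" using z by auto
    moreover have "continuous_on {0..2 * s} (\<lambda>\<tau>. (\<sigma> * \<tau>) *\<^sub>R v)" by (intro continuous_intros)
    ultimately obtain \<tau> where \<tau>: "\<tau> \<in> {0..2 * s}" "u \<odot> ((\<sigma> * \<tau>) *\<^sub>R v) \<in> frontier \<Omega>"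
      using s frontier_between[of "{0..2 * s}" "\<lambda>\<tau>. (\<sigma> * \<tau>) *\<^sub>R v" 0 "2 * s" u \<Omega>]
      by (metis atLeastAtMost_iff connected_Icc order_refl less_imp_le mult_pos_pos zero_less_numeral)
    have "\<bar>\<sigma> * \<tau>\<bar> \<le> 2 * s" using \<tau> by (auto simp: \<sigma>_def)
    \<comment> \<open>The translate \<open>p'\<close> has distance \<open>2 * s\<close> from
      \<open>p\<close>; the horizontal side adds another \<open>2 * s\<close> below.\<close>
    have "hdist u q < 5 * s"
    proof (cases "u = p")
      case False
      then have "hdist u p \<le> 2 * s" using u s by (simp add: p'_def hdist_hmul_right)
      then show ?thesis using heis.triangle[of u p q] p by simp
    qed (use p s in simp)
    moreover have "hdist (u \<odot> ((\<sigma> * \<tau>) *\<^sub>R v)) u \<le> 2 * s"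
      using \<open>\<bar>\<sigma> * \<tau>\<bar> \<le> 2 * s\<close> by (simp only: hdist_hmul_right nv)
    ultimately have d: "hdist (u \<odot> ((\<sigma> * \<tau>) *\<^sub>R v)) q < 7 * s"
      using heis.triangle[of "u \<odot> ((\<sigma> * \<tau>) *\<^sub>R v)" u q] by simp
    have "0 \<le> \<sigma> * (\<sigma> * \<tau>)" using \<tau>(1) by (simp add: \<sigma>_def)
    from grow[OF this] have "\<bar>?f p\<bar> \<le> \<bar>?f p + \<sigma> * \<tau> * k\<bar>" by simp
    moreover have "?f u = ?f p" using u fp' by auto
    ultimately have "\<bar>?f u\<bar> \<le> \<bar>?f (u \<odot> ((\<sigma> * \<tau>) *\<^sub>R v))\<bar>" by (simp only: fv)
    moreover have "u \<odot> ((\<sigma> * \<tau>) *\<^sub>R v) \<in> frontier \<Omega> \<inter> heis.mball q (7 * s)"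
      using \<tau>(2) d by (simp add: heis.commute)
    ultimately show False using neg u unfolding p'_def by blast
  qed
  \<comment> \<open>Vertical elements are central, so the far ends of the two horizontal sides again
    differ by \<open>(0, 0, s\<^sup>2)\<close>.\<close>
  define p1 where "p1 = p \<odot> ((\<sigma> * (2 * s)) *\<^sub>R v)"
  have p1': "p' \<odot> ((\<sigma> * (2 * s)) *\<^sub>R v) = p1 \<odot> (0, 0, s\<^sup>2)"
    unfolding p'_def p1_def by (rule hmul_central)
  have "p \<in> \<Omega> \<longleftrightarrow> p1 \<in> \<Omega>" unfolding p1_def by (rule horiz) simp
  moreover have "p' \<in> \<Omega> \<longleftrightarrow> p1 \<odot> (0, 0, s\<^sup>2) \<in> \<Omega>" using horiz[of p'] p1' by simp
  moreover have "p \<in> \<Omega> \<longleftrightarrow> p' \<notin> \<Omega>" using p(1) by (auto simp: vdiff_def p'_def)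
  ultimately have "p1 \<in> vdiff \<Omega> s" unfolding vdiff_def by blast
  then obtain \<tau> where \<tau>: "p1 \<odot> (0, 0, \<tau>) \<in> frontier \<Omega>" "hdist (p1 \<odot> (0, 0, \<tau>)) p1 \<le> 2 * s"
    using vertical_frontier_point s by blast
  have "hdist p1 p \<le> 2 * s" unfolding p1_def hdist_hmul_right nv using s by (simp add: \<sigma>_def)
  then have "hdist (p1 \<odot> (0, 0, \<tau>)) q < 7 * s"
    using \<tau>(2) heis.triangle[of "p1 \<odot> (0, 0, \<tau>)" p1 q] heis.triangle[of p1 p q] p by simp
  \<comment> \<open>The function \<open>?f\<close> ignores the vertical coordinate, so its value at
    the frontier point is that at \<open>p1\<close>.\<close>
  from small[OF \<tau>(1) this] have "\<bar>?f p1\<bar> < s" by (cases p1) simp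
  moreover have "\<bar>?f p1\<bar> = \<bar>?f p\<bar> + \<bar>\<sigma> * (2 * s)\<bar> * \<bar>k\<bar>"
    unfolding p1_def fv using s by (intro grow) (simp add: \<sigma>_def)
  moreover have "s \<le> \<bar>\<sigma> * (2 * s)\<bar> * \<bar>k\<bar>" using k s by (simp add: \<sigma>_def)
  ultimately show False by linarith
qed

section \<open>Vertical translations and measurability\<close>

lemma hmul_central_eq_plus: "p \<odot> (0, 0, t) = (0, 0, t) + p"
  by (cases p) simp

text \<open>Multiplication by a central element is a Euclidean translation, and translation
  invariance of Lebesgue measure passes to outer measure through a measurable hull.\<close>

lemma outer_measure_central_translate:
  "outer_measure_of lborel {p. p \<odot> (0, 0, t) \<in> S} \<le> outer_measure_of lborel S"
proof -
  obtain T where T: "T \<in> sets lborel" "S \<subseteq> T" "outer_measure_of lborel S = emeasure lborel T"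
    using outer_measure_of_attain[of S lborel] by auto
  have m: "(+) (0, 0, t) \<in> borel_measurable (borel :: heis measure)"
    by (intro borel_measurable_continuous_onI continuous_intros)
  have "outer_measure_of lborel {p. p \<odot> (0, 0, t) \<in> S} \<le> outer_measure_of lborel ((+) (0, 0, t) -` T)"
    using T(2) by (intro outer_measure_of_mono) (auto simp: hmul_central_eq_plus)
  also have "\<dots> = emeasure lborel ((+) (0, 0, t) -` T)"
    using measurable_sets[OF m] T(1) by (intro outer_measure_of_eq) simp
  also have "\<dots> = emeasure (distr lborel borel ((+) (0, 0, t))) T"
    using m T(1) by (subst emeasure_distr) auto
  also have "\<dots> = emeasure lborel T" by (simp add: lborel_distr_plus)
  finally show ?thesis using T by simp
qed

lemma sets_hball [measurable, simp]: "heis.mball q r \<in> sets borel"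
  by (simp add: borel_open)

lemma sets_vdiff:
  assumes "open \<Omega>" shows "vdiff \<Omega> s \<in> sets borel"
proof -
  have 1: "open {p. p \<odot> (0, 0, s\<^sup>2) \<in> \<Omega>}"
    using open_vimage[OF assms, of "\<lambda>p. p \<odot> (0, 0, s\<^sup>2)"]
      continuous_on_hmul_right[OF continuous_on_id continuous_on_const]
    by (simp add: vimage_def)
  have "vdiff \<Omega> s = (\<Omega> - {p. p \<odot> (0, 0, s\<^sup>2) \<in> \<Omega>}) \<union> ({p. p \<odot> (0, 0, s\<^sup>2) \<in> \<Omega>} - \<Omega>)"
    by (auto simp: vdiff_def)
  then show ?thesis using assms 1 by (simp add: borel_open)
qed

text \<open>The constant is the quotient of \<open>2 * (3 * s) ^ 4\<close>, the volume bound for the ball, and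
  \<open>s ^ 4 / (16 * A)\<close>, the lower bound for the integral if the frontier is far from the plane.\<close>

lemma vdiff_hball_le_integral:
  assumes \<Omega>: "open \<Omega>" and reg: "regular3 A (frontier \<Omega>)" and q: "q \<in> frontier \<Omega>"
    and s: "0 < s" "ennreal (8 * s) \<le> hdiam (frontier \<Omega>)" and ab: "a\<^sup>2 + b\<^sup>2 = 1"
  shows "emeasure lborel (vdiff \<Omega> s \<inter> heis.mball q (3 * s))
    \<le> ennreal (2592 * A) * (\<integral>\<^sup>+x\<in>heis.mball q (8 * s) \<inter> frontier \<Omega>. ennreal \<bar>aff a b c x\<bar> \<partial>hausdorff3)"
    (is "emeasure lborel ?D \<le> ennreal (2592 * A) * ?I")
proof -
  let ?E = "frontier \<Omega>" and ?f = "aff a b c"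
  have [measurable]: "?E \<in> sets borel" by (simp add: borel_closed)
  have A: "1 \<le> A" using reg by (simp add: regular3_def)
  have scale: "ennreal r \<le> hdiam ?E" if "r \<le> 8 * s" for r
    using s(2) ennreal_leI[OF that] order_trans by blast
  show ?thesis
  \<comment> \<open>Either one frontier point far from the plane makes the integral large by
    regularity, or the path argument applies.\<close>
  proof (cases "\<exists>x\<in>?E. hdist x q < 7 * s \<and> s \<le> \<bar>?f x\<bar>")
    case True
    then obtain x where x: "x \<in> ?E" "hdist x q < 7 * s" "s \<le> \<bar>?f x\<bar>" by blast
    let ?B = "?E \<inter> heis.mball x (s / 2)"
    \<comment> \<open>The function \<open>?f\<close> is 1-Lipschitz, and
      \<open>7 * s + s / 2 < 8 * s\<close>.\<close>
    have sub: "s / 2 \<le> \<bar>?f y\<bar> \<and> hdist q y < 8 * s" if "y \<in> ?B" for y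
    proof -
      have "hdist x y < s / 2" using that by simp
      then show ?thesis
        using abs_aff_diff_le[OF ab, of c x y] x heis.triangle[of q x y] heis.commute[of q x] by auto
    qed
    have "ennreal (s / 2) * ennreal (inverse A * (s / 2) ^ 3) \<le> ennreal (s / 2) * emeasure hausdorff3 ?B"
      using s x scale[of "s / 2"] by (intro mult_left_mono regular3_ge[OF reg]) auto
    also have "\<dots> = (\<integral>\<^sup>+y\<in>?B. ennreal (s / 2) \<partial>hausdorff3)"
      by (rule nn_integral_cmult_indicator[symmetric]) simp
    also have "\<dots> \<le> ?I"
      using sub by (intro nn_integral_mono) (auto simp: indicator_def intro!: ennreal_leI)
    finally have I: "ennreal (s ^ 4 / (16 * A)) \<le> ?I"
      using A s by (simp add: ennreal_mult[symmetric] field_simps eval_nat_numeral)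
    have "emeasure lborel ?D \<le> emeasure lborel (heis.mball q (3 * s))"
      by (intro emeasure_mono) auto
    also have "\<dots> \<le> ennreal (2 * (3 * s) ^ 4)" using s by (intro emeasure_hball_le) auto
    also have "\<dots> = ennreal (2592 * A) * ennreal (s ^ 4 / (16 * A))"
      using A s by (subst ennreal_mult[symmetric]) (auto simp: field_simps eval_nat_numeral)
    also have "\<dots> \<le> ennreal (2592 * A) * ?I" using I by (rule mult_left_mono) simp
    finally show ?thesis .
  next
    case False
    obtain v where v: "transversal a b v"
    proof -
      have "1/2 \<le> \<bar>a\<bar> \<or> 1/2 \<le> \<bar>b\<bar>"
      proof (rule ccontr)
        assume "\<not> ?thesis"
        then have "a\<^sup>2 < (1/2)\<^sup>2" "b\<^sup>2 < (1/2)\<^sup>2" by (auto intro: power2_strict_mono)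
        then show False using ab by (simp add: power_divide)
      qed
      then show thesis using that unfolding transversal_def by blast
    qed
    let ?G = "?E \<inter> heis.mball q (7 * s)"
    let ?S = "{p. \<exists>\<tau>. p \<odot> (\<tau> *\<^sub>R v) \<in> ?G \<and> \<bar>?f p\<bar> \<le> \<bar>?f (p \<odot> (\<tau> *\<^sub>R v))\<bar>}"
    have small: "\<bar>?f x\<bar> < s" if "x \<in> ?E" "hdist x q < 7 * s" for x using False that by force
    \<comment> \<open>Each separated point, or its vertical translate, lies in the shadow of the
      frontier; the two halves cost the factor \<open>2 * 24 = 48\<close> below.\<close>
    have sub: "?D \<subseteq> ?S \<union> {p. p \<odot> (0, 0, s\<^sup>2) \<in> ?S}"
    proof
      fix p assume "p \<in> ?D"
      then have "p \<in> vdiff \<Omega> s" "hdist p q < 3 * s" by (auto simp: heis.commute)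
      from vdiff_hball_subset[OF s(1) ab v small this]
      show "p \<in> ?S \<union> {p. p \<odot> (0, 0, s\<^sup>2) \<in> ?S}" by simp
    qed
    have "emeasure hausdorff3 ?G \<le> ennreal (A * (7 * s) ^ 3)"
      using s q scale[of "7 * s"] by (intro regular3_le[OF reg]) auto
    then have fin: "emeasure hausdorff3 ?G < \<infinity>" by (rule order_le_less_trans) simp
    have S: "outer_measure_of lborel ?S \<le> 24 * (\<integral>\<^sup>+x\<in>?G. ennreal \<bar>?f x\<bar> \<partial>hausdorff3)"
    proof (rule outer_measure_shadow[OF v _ fin])
      fix x assume "x \<in> ?G"
      then show "\<bar>?f x\<bar> \<le> s" using small[of x] by (auto simp: heis.commute)
    qed simp
    also have "\<dots> \<le> 24 * ?I"
      using s by (intro mult_left_mono nn_integral_mono) (auto simp: indicator_def)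
    finally have S: "outer_measure_of lborel ?S \<le> 24 * ?I" .
    have "emeasure lborel ?D \<le> outer_measure_of lborel (?S \<union> {p. p \<odot> (0, 0, s\<^sup>2) \<in> ?S})"
      using sub sets_vdiff[OF \<Omega>] by (intro emeasure_le_outer_measure_of) auto
    also have "\<dots> \<le> outer_measure_of lborel ?S + outer_measure_of lborel {p. p \<odot> (0, 0, s\<^sup>2) \<in> ?S}"
      by (rule outer_measure_of_Un_le) auto
    also have "\<dots> \<le> 24 * ?I + 24 * ?I"
      using S outer_measure_central_translate[of "s\<^sup>2" ?S] by (intro add_mono) (auto intro: order_trans)
    also have "\<dots> = 48 * ?I" by (simp add: distrib_right[symmetric])
    also have "\<dots> = ennreal 48 * ?I" by simp
    also have "\<dots> \<le> ennreal (2592 * A) * ?I" using A by (intro mult_right_mono ennreal_leI) auto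
    finally show ?thesis .
  qed
qed

text \<open>The integral bound has the same constant for every plane and so survives the infimum.
  The power \<open>(8 * s) ^ 4\<close> is the product of the normalisations \<open>8 * s\<close> and
  \<open>(8 * s) ^ 3\<close> in \<open>beta1\<close>.\<close>

lemma vdiff_hball_le_beta1:
  assumes \<Omega>: "open \<Omega>" and reg: "regular3 A (frontier \<Omega>)" and q: "q \<in> frontier \<Omega>"
    and s: "0 < s" "ennreal (8 * s) \<le> hdiam (frontier \<Omega>)"
  shows "ennreal (measure lborel (vdiff \<Omega> s \<inter> heis.mball q (3 * s)) / (2592 * A * (8 * s) ^ 4))
    \<le> beta1 (frontier \<Omega>) q (8 * s)"
  unfolding beta1_def
proof (rule INF_greatest, clarify)
  let ?B = "heis.mball q (8 * s) \<inter> frontier \<Omega>"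
  define m where "m = measure lborel (vdiff \<Omega> s \<inter> heis.mball q (3 * s))"
  have [measurable]: "frontier \<Omega> \<in> sets borel" by (simp add: borel_closed)
  have A: "1 \<le> A" using reg by (simp add: regular3_def)
  fix W z assume "vertical_subgroup W"
  then obtain a b c where ab: "a\<^sup>2 + b\<^sup>2 = 1"
      and f: "\<And>x. ennreal \<bar>aff a b c x\<bar> \<le> hinfdist x ((\<odot>) z ` W)"
    using vertical_subgroup_aff[of W z] by blast
  let ?I = "\<integral>\<^sup>+x\<in>?B. ennreal \<bar>aff a b c x\<bar> \<partial>hausdorff3"
  have "emeasure lborel (vdiff \<Omega> s \<inter> heis.mball q (3 * s)) \<le> emeasure lborel (heis.mball q (3 * s))"
    by (intro emeasure_mono) auto
  also have "\<dots> \<le> ennreal (2 * (3 * s) ^ 4)" using s by (intro emeasure_hball_le) auto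
  finally have "emeasure lborel (vdiff \<Omega> s \<inter> heis.mball q (3 * s)) = ennreal m"
    unfolding m_def by (intro emeasure_eq_ennreal_measure) (auto simp: top_unique)
  then have m: "ennreal m \<le> ennreal (2592 * A) * ?I"
    using vdiff_hball_le_integral[OF \<Omega> reg q s ab, of c] by simp
  have "ennreal (m / (2592 * A * (8 * s) ^ 4)) \<le> ?I / ennreal (8 * s) / ennreal ((8 * s) ^ 3)"
  proof (cases "?I")
    case (real i)
    then have "m \<le> 2592 * A * i" using m A by (simp add: ennreal_mult[symmetric])
    then have "m / (2592 * A * (8 * s) ^ 4) \<le> (2592 * A * i) / (2592 * A * (8 * s) ^ 4)"
      using A s by (intro divide_right_mono) auto
    also have "\<dots> = i / (8 * s) / (8 * s) ^ 3" using A s by (simp add: field_simps eval_nat_numeral)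
    finally show ?thesis using real s by (simp add: divide_ennreal ennreal_leI)
  next
    case top
    then show ?thesis using s by (simp add: ennreal_top_divide)
  qed
  also have "?I / ennreal (8 * s) = (\<integral>\<^sup>+x\<in>?B. ennreal \<bar>aff a b c x\<bar> / ennreal (8 * s) \<partial>hausdorff3)"
    by (subst nn_integral_divide[symmetric]) (auto simp: divide_ennreal_def mult_ac)
  also have "\<dots> / ennreal ((8 * s) ^ 3) \<le> (\<integral>\<^sup>+x\<in>?B. hinfdist x ((\<odot>) z ` W) / ennreal (8 * s) \<partial>hausdorff3) / ennreal ((8 * s) ^ 3)"
    using f by (intro divide_right_mono_ennreal nn_integral_mono mult_right_mono) auto
  finally show "ennreal (m / (2592 * A * (8 * s) ^ 4))
    \<le> (\<integral>\<^sup>+x\<in>?B. hinfdist x ((\<odot>) z ` W) / ennreal (8 * s) \<partial>hausdorff3) / ennreal ((8 * s) ^ 3)" .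
qed

section \<open>Averaging over the frontier\<close>

text \<open>A ball is the intersection of a round vertical cylinder with a slab: for fixed centre,
  the vertical part of the metric is a function of an affine form in the point. Convexity makes the
  complement connected.\<close>

lemma convex_hcball: "convex (heis.mcball q r)"
proof -
  obtain a b c where q: "q = (a, b, c)" by (cases q)
  let ?n = "(b / 2, - a / 2, 1) :: heis"
  have "bounded_linear (\<lambda>p::heis. (fst p, fst (snd p)))"
    by (intro bounded_linear_Pair bounded_linear_fst bounded_linear_fst_comp bounded_linear_snd)
  then have 1: "convex ((\<lambda>p::heis. (fst p, fst (snd p))) -` cball (a, b) r)"
    by (intro convex_linear_vimage convex_cball) (rule bounded_linear.linear)
  have n: "2 * sqrt \<bar>u\<bar> \<le> r \<longleftrightarrow> 0 \<le> r \<and> \<bar>u\<bar> \<le> r\<^sup>2 / 4" for u :: real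
  proof -
    have eq: "2 * sqrt \<bar>u\<bar> = sqrt (4 * \<bar>u\<bar>)" by (simp add: real_sqrt_mult)
    show ?thesis
    proof (cases "0 \<le> r")
      case True
      then have "sqrt (4 * \<bar>u\<bar>) \<le> r \<longleftrightarrow> sqrt (4 * \<bar>u\<bar>) \<le> sqrt (r\<^sup>2)" by simp
      also have "\<dots> \<longleftrightarrow> 4 * \<bar>u\<bar> \<le> r\<^sup>2" by (rule real_sqrt_le_iff)
      finally show ?thesis using True by (auto simp: eq)
    next
      case False
      moreover have "0 \<le> 2 * sqrt \<bar>u\<bar>" by simp
      ultimately show ?thesis by linarith
    qed
  qed
  have "heis.mcball q r = (\<lambda>p::heis. (fst p, fst (snd p))) -` cball (a, b) r \<inter>
    {p. ?n \<bullet> p \<le> c + r\<^sup>2 / 4} \<inter> {p. ?n \<bullet> p \<ge> c - r\<^sup>2 / 4}" (is "_ = ?R")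
  proof (intro set_eqI)
    fix p :: heis
    obtain x y t where p: "p = (x, y, t)" by (cases p)
    have ineq: "\<bar>t - c + (b * x - a * y) / 2\<bar> \<le> r\<^sup>2 / 4 \<longleftrightarrow>
      b * x / 2 - a * y / 2 + t \<le> c + r\<^sup>2 / 4 \<and> c - r\<^sup>2 / 4 \<le> b * x / 2 - a * y / 2 + t"
      unfolding abs_le_iff diff_divide_distrib by linarith
    have mem: "p \<in> heis.mcball q r \<longleftrightarrow> hdist p q \<le> r" by (simp add: heis.commute[of q p])
    have "norm (x - a, y - b) \<le> r \<Longrightarrow> 0 \<le> r" using norm_ge_zero order_trans by blast
    then have "p \<in> heis.mcball q r \<longleftrightarrow> norm (x - a, y - b) \<le> r \<and> \<bar>t - c + (b * x - a * y) / 2\<bar> \<le> r\<^sup>2 / 4"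
      using n[of "t - c + (b * x - a * y) / 2"] mem hdist_Pair[of x y t a b c] by (auto simp: p q)
    also have "\<dots> \<longleftrightarrow> p \<in> ?R"
      using ineq by (auto simp: p dist_Pair_Pair norm_Pair dist_real_def power2_commute)
    finally show "p \<in> heis.mcball q r \<longleftrightarrow> p \<in> ?R" .
  qed
  then show ?thesis using 1 by (auto intro!: convex_Int convex_halfspace_le convex_halfspace_ge)
qed

lemma bounded_hcball: "bounded (heis.mcball q r)"
proof -
  obtain a b c where q: "q = (a, b, c)" by (cases q)
  let ?M = "(\<bar>a\<bar> + r) + ((\<bar>b\<bar> + r) + (\<bar>c\<bar> + r\<^sup>2 / 4 + (\<bar>b\<bar> * (\<bar>a\<bar> + r) + \<bar>a\<bar> * (\<bar>b\<bar> + r)) / 2))"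
  have "norm p \<le> ?M" if "p \<in> heis.mcball q r" for p
  proof -
    obtain x y t where p: "p = (x, y, t)" by (cases p)
    have "hdist (x, y, t) (a, b, c) \<le> r" using that by (simp add: p q heis.commute)
    note d = hdist_le_D[OF this]
    have x: "\<bar>x\<bar> \<le> \<bar>a\<bar> + r" and y: "\<bar>y\<bar> \<le> \<bar>b\<bar> + r" using d(1,2) by linarith+
    have tri: "\<bar>t\<bar> \<le> \<bar>c\<bar> + k + (m + n) / 2"
      if "\<bar>u\<bar> \<le> m" "\<bar>v\<bar> \<le> n" "\<bar>t - c + (u - v) / 2\<bar> \<le> k" for u v m n k
      using that abs_ge_self[of c] abs_ge_minus_self[of c] unfolding abs_le_iff by (simp add: field_simps)
    have "\<bar>b * x\<bar> \<le> \<bar>b\<bar> * (\<bar>a\<bar> + r)" "\<bar>a * y\<bar> \<le> \<bar>a\<bar> * (\<bar>b\<bar> + r)"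
      unfolding abs_mult using x y by (auto intro: mult_left_mono)
    then have "\<bar>t\<bar> \<le> \<bar>c\<bar> + r\<^sup>2 / 4 + (\<bar>b\<bar> * (\<bar>a\<bar> + r) + \<bar>a\<bar> * (\<bar>b\<bar> + r)) / 2"
      using d(3) tri by blast
    moreover have "norm p \<le> norm x + (norm y + norm t)"
      unfolding p using norm_Pair_le[of x "(y, t)"] norm_Pair_le[of y t] by linarith
    ultimately show ?thesis using x y by simp
  qed
  then show ?thesis by (rule boundedI)
qed

section \<open>Trivial bounds for the vertical variation\<close>

lemma vertical_var_eq:
  assumes "open \<Omega>" "U \<in> sets borel"
  shows "vertical_var \<Omega> U s = emeasure lborel (vdiff \<Omega> s \<inter> U)"
proof -
  have "vertical_var \<Omega> U s = (\<integral>\<^sup>+p. indicator (vdiff \<Omega> s \<inter> U) p \<partial>lborel)"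
    unfolding vertical_var_def by (intro nn_integral_cong) (auto simp: vdiff_def indicator_def)
  also have "\<dots> = emeasure lborel (vdiff \<Omega> s \<inter> U)"
    using sets_vdiff[OF assms(1)] assms(2) by (intro nn_integral_indicator) simp
  finally show ?thesis .
qed

lemma vertical_var_hball_le:
  assumes "open \<Omega>" "0 \<le> r" shows "vertical_var \<Omega> (heis.mball q r) s \<le> ennreal (2 * r ^ 4)"
proof -
  have "emeasure lborel (vdiff \<Omega> s \<inter> heis.mball q r) \<le> emeasure lborel (heis.mball q r)"
    by (intro emeasure_mono) auto
  also have "\<dots> \<le> ennreal (2 * r ^ 4)" by (rule emeasure_hball_le) fact
  finally show ?thesis using assms by (simp add: vertical_var_eq)
qed

text \<open>The complement of a closed ball is connected, so it lies in \<open>\<Omega>\<close> or is disjoint from it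
  when the ball contains the frontier.\<close>

lemma vertical_var_frontier_hcball:
  assumes \<Omega>: "open \<Omega>" and U: "U \<in> sets borel" and "0 \<le> r"
    and sub: "frontier \<Omega> \<subseteq> heis.mcball q r"
  shows "vertical_var \<Omega> U s \<le> ennreal (4 * r ^ 4)"
proof -
  let ?B = "heis.mcball q r"
  have conn: "connected (- ?B)"
    by (intro connected_complement_bounded_convex bounded_hcball convex_hcball) simp
  have "vdiff \<Omega> s \<subseteq> ?B \<union> {p. p \<odot> (0, 0, s\<^sup>2) \<in> ?B}"
  proof (rule subsetI, rule ccontr)
    fix p assume p: "p \<in> vdiff \<Omega> s" "p \<notin> ?B \<union> {p. p \<odot> (0, 0, s\<^sup>2) \<in> ?B}"
    have "p \<in> \<Omega> \<longleftrightarrow> p \<odot> (0, 0, s\<^sup>2) \<in> \<Omega>"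
      using connected_disjoint_frontier[OF conn, of \<Omega> p "p \<odot> (0, 0, s\<^sup>2)"] sub p(2) by blast
    then show False using p(1) by (simp add: vdiff_def)
  qed
  then have "emeasure lborel (vdiff \<Omega> s \<inter> U) \<le> outer_measure_of lborel (?B \<union> {p. p \<odot> (0, 0, s\<^sup>2) \<in> ?B})"
    using sets_vdiff[OF \<Omega>] U by (intro emeasure_le_outer_measure_of) auto
  also have "\<dots> \<le> outer_measure_of lborel ?B + outer_measure_of lborel {p. p \<odot> (0, 0, s\<^sup>2) \<in> ?B}"
    by (rule outer_measure_of_Un_le) auto
  also have "\<dots> \<le> outer_measure_of lborel ?B + outer_measure_of lborel ?B"
    by (intro add_left_mono outer_measure_central_translate)
  also have "outer_measure_of lborel ?B = emeasure lborel ?B"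
    by (intro outer_measure_of_eq) (simp add: borel_closed)
  also have "emeasure lborel ?B + emeasure lborel ?B \<le> ennreal (2 * r ^ 4) + ennreal (2 * r ^ 4)"
    by (intro add_mono emeasure_hcball_le) fact+
  also have "\<dots> = ennreal (4 * r ^ 4)" by (subst ennreal_plus[symmetric]) auto
  finally show ?thesis using \<Omega> U by (simp add: vertical_var_eq)
qed

text \<open>The constant is the quotient of the volume bounds \<open>2 * (3 * r) ^ 4\<close> and \<open>(r / 4) ^ 4 / 4\<close>.\<close>

lemma hball_packing:
  assumes r: "0 < r" and P: "finite P" "P \<subseteq> heis.mball q (2 * r)"
    and sep: "\<And>x y. x \<in> P \<Longrightarrow> y \<in> P \<Longrightarrow> x \<noteq> y \<Longrightarrow> r / 2 \<le> hdist x y"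
  shows "card P \<le> 165888"
proof -
  have disj: "disjoint_family_on (\<lambda>p. heis.mball p (r / 4)) P"
    unfolding disjoint_family_on_def
  proof (intro ballI impI)
    fix x y assume xy: "x \<in> P" "y \<in> P" "x \<noteq> y"
    show "heis.mball x (r / 4) \<inter> heis.mball y (r / 4) = {}"
    proof (rule ccontr)
      assume "\<not> ?thesis"
      then obtain z where "hdist x z < r / 4" "hdist y z < r / 4" by auto
      then show False using sep[OF xy] heis.triangle[of x z y] heis.commute[of y z] by simp
    qed
  qed
  have "ennreal (real (card P) * ((r / 4) ^ 4 / 4)) = (\<Sum>p\<in>P. ennreal ((r / 4) ^ 4 / 4))"
    using r by (subst sum_ennreal) simp_all
  also have "\<dots> \<le> (\<Sum>p\<in>P. emeasure lborel (heis.mball p (r / 4)))"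
    using r by (intro sum_mono emeasure_hball_ge) simp
  also have "\<dots> = emeasure lborel (\<Union>p\<in>P. heis.mball p (r / 4))"
    using P disj by (intro sum_emeasure) auto
  also have "\<dots> \<le> emeasure lborel (heis.mball q (3 * r))"
  proof (intro emeasure_mono)
    show "(\<Union>p\<in>P. heis.mball p (r / 4)) \<subseteq> heis.mball q (3 * r)"
    proof clarify
      fix p x1 x2 x3 assume "p \<in> P" and x: "(x1, x2, x3) \<in> heis.mball p (r / 4)"
      then have "hdist q p < 2 * r" using P by auto
      then show "(x1, x2, x3) \<in> heis.mball q (3 * r)"
        using x r heis.triangle[of q p "(x1, x2, x3)"] by simp
    qed
  qed simp
  also have "\<dots> \<le> ennreal (2 * (3 * r) ^ 4)" using r by (intro emeasure_hball_le) simp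
  finally have "real (card P) * ((r / 4) ^ 4 / 4) \<le> 2 * (3 * r) ^ 4" using r by simp
  then have "real (card P) * r ^ 4 \<le> 165888 * r ^ 4" by (simp add: power_divide power_mult_distrib)
  then have "real (card P) \<le> 165888" using r by simp
  then show ?thesis by simp
qed

text \<open>Packing bounds the size of \<open>r / 2\<close>-separated subsets, so one of largest
  cardinality exists. A point missed by its balls could be added to it.\<close>

lemma hball_finite_cover:
  assumes r: "0 < r" and F: "F \<subseteq> heis.mball q (2 * r)"
  obtains P where "finite P" "P \<subseteq> F" "card P \<le> 165888" "F \<subseteq> (\<Union>p\<in>P. heis.mball p (r / 2))"
proof -
  define Q where "Q P \<longleftrightarrow> finite P \<and> P \<subseteq> F \<and> (\<forall>x\<in>P. \<forall>y\<in>P. x \<noteq> y \<longrightarrow> r / 2 \<le> hdist x y)" for P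
  have bd: "card P < 165889" if "Q P" for P
    using hball_packing[OF r, of P q] that F by (fastforce simp: Q_def)
  have "Q {}" by (simp add: Q_def)
  from ex_has_greatest_nat[of Q "{}" card, OF this] bd
  obtain P where P: "Q P" "\<And>P'. Q P' \<Longrightarrow> card P' \<le> card P" by (metis less_imp_le)
  have "F \<subseteq> (\<Union>p\<in>P. heis.mball p (r / 2))"
  proof (rule subsetI, rule ccontr)
    fix x assume x: "x \<in> F" "x \<notin> (\<Union>p\<in>P. heis.mball p (r / 2))"
    then have far: "r / 2 \<le> hdist p x" if "p \<in> P" for p using that by force
    have far': "r / 2 \<le> hdist x p" if "p \<in> P" for p using far[OF that] by (simp only: heis.commute[of x p])
    have "x \<notin> P"
    proof
      assume "x \<in> P"
      from far[OF this] show False using r by simp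
    qed
    moreover have "Q (insert x P)"
      using P(1) x far far' unfolding Q_def by auto
    ultimately show False using P(2)[of "insert x P"] P(1) by (simp add: Q_def)
  qed
  then show thesis using that P(1) bd[OF P(1)] by (auto simp: Q_def)
qed

section \<open>Joint measurability in centre and scale\<close>

lemma continuous_on_hdist2: "continuous_on UNIV (\<lambda>z. hdist (fst z) (snd z))"
proof -
  have "(\<lambda>z. hdist (fst z) (snd z)) = (\<lambda>z. max (norm (fst (fst z) - fst (snd z), fst (snd (fst z)) - fst (snd (snd z))))
     (2 * sqrt \<bar>snd (snd (fst z)) - snd (snd (snd z)) + (fst (snd (snd z)) * fst (fst z) - fst (snd z) * fst (snd (fst z))) / 2\<bar>))"
    by (rule ext) (auto simp: hdist_Pair split_beta)
  then show ?thesis by (simp only:) (intro continuous_intros ballI, simp)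
qed

lemma continuous_on_hdist' [continuous_intros]:
  "continuous_on S f \<Longrightarrow> continuous_on S g \<Longrightarrow> continuous_on S (\<lambda>x. hdist (f x) (g x))"
  using continuous_on_compose2[OF continuous_on_hdist2 continuous_on_Pair, of S f g] by simp

lemma sets_vdiff_graph:
  assumes \<Omega>: "open \<Omega>"
  shows "{z::(heis \<times> real) \<times> heis. snd z \<in> vdiff \<Omega> (snd (fst z)) \<inter> heis.mball (fst (fst z)) (3 * snd (fst z))}
    \<in> sets borel" (is "?Z \<in> _")
proof -
  let ?O = "{z::(heis \<times> real) \<times> heis. snd z \<in> \<Omega>}"
  let ?O' = "{z::(heis \<times> real) \<times> heis. snd z \<odot> (0, 0, (snd (fst z))\<^sup>2) \<in> \<Omega>}"
  let ?B = "{z::(heis \<times> real) \<times> heis. hdist (fst (fst z)) (snd z) < 3 * snd (fst z)}"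
  have "open (snd -` \<Omega> :: ((heis \<times> real) \<times> heis) set)"
    by (intro open_vimage \<Omega> continuous_on_snd continuous_on_id)
  moreover have "open ((\<lambda>z::(heis \<times> real) \<times> heis. snd z \<odot> (0, 0, (snd (fst z))\<^sup>2)) -` \<Omega>)"
    by (intro open_vimage \<Omega> continuous_intros)
  moreover have "open ?B" by (intro open_Collect_less continuous_intros)
  ultimately have "?O \<in> sets borel" "?O' \<in> sets borel" "?B \<in> sets borel"
    by (auto simp: vimage_def intro: borel_open)
  then have "((?O - ?O') \<union> (?O' - ?O)) \<inter> ?B \<in> sets borel" by (intro sets.Int sets.Un sets.Diff)
  moreover have "?Z = ((?O - ?O') \<union> (?O' - ?O)) \<inter> ?B" by (auto simp: vdiff_def)
  ultimately show ?thesis by simp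
qed

lemma sets_pair_borel_lborel:
  "sets (borel \<Otimes>\<^sub>M lborel) = sets (borel :: ('a::second_countable_topology \<times> 'b::euclidean_space) measure)"
  by (simp only: sets_pair_measure_cong[OF refl sets_lborel] borel_prod)

text \<open>Volumes of sections of a Borel set are measurable in the parameter. The joint form is
  what the exchange of the integrals over the frontier and over the scales requires.\<close>

lemma measurable_vdiff_hball:
  assumes \<Omega>: "open \<Omega>"
  shows "(\<lambda>z. emeasure lborel (vdiff \<Omega> (snd z) \<inter> heis.mball (fst z) (3 * snd z))) \<in> borel_measurable borel"
proof -
  let ?Z = "{z::(heis \<times> real) \<times> heis. snd z \<in> vdiff \<Omega> (snd (fst z)) \<inter> heis.mball (fst (fst z)) (3 * snd (fst z))}"
  have "?Z \<in> sets (borel \<Otimes>\<^sub>M lborel)"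
    using sets_vdiff_graph[OF \<Omega>] by (simp only: sets_pair_borel_lborel)
  from sigma_finite_measure.measurable_emeasure_Pair[OF sigma_finite_lborel this]
  have "(\<lambda>z. emeasure lborel (Pair z -` ?Z)) \<in> borel_measurable borel" .
  moreover have "Pair z -` ?Z = vdiff \<Omega> (snd z) \<inter> heis.mball (fst z) (3 * snd z)" for z by auto
  ultimately show ?thesis by simp
qed

text \<open>Every point of \<open>vdiff \<Omega> s\<close> has a large part of the frontier nearby, so the measure of
  \<open>vdiff \<Omega> s\<close> is controlled by an average, over the frontier, of its measure in small balls.\<close>

lemma vertical_var_le_average:
  assumes \<Omega>: "open \<Omega>" and reg: "regular3 A (frontier \<Omega>)"
    and s: "0 < s" "ennreal s \<le> hdiam (frontier \<Omega>)"
    and U: "U \<in> sets borel" and F: "F \<in> sets borel" and fin: "emeasure hausdorff3 F < \<infinity>"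
    and UF: "\<And>p. p \<in> U \<Longrightarrow> frontier \<Omega> \<inter> heis.mball p (3 * s) \<subseteq> F"
  shows "vertical_var \<Omega> U s
    \<le> ennreal (A / s ^ 3) * (\<integral>\<^sup>+q\<in>F. emeasure lborel (vdiff \<Omega> s \<inter> heis.mball q (3 * s)) \<partial>hausdorff3)"
proof -
  let ?E = "frontier \<Omega>" and ?D = "vdiff \<Omega> s"
  have A: "1 \<le> A" using reg by (simp add: regular3_def)
  have [measurable]: "?D \<in> sets borel" "U \<in> sets borel" "F \<in> sets borel" "?E \<in> sets borel"
    using sets_vdiff[OF \<Omega>] U F by (auto simp: borel_closed)
  \<comment> \<open>Restricted to \<open>F\<close>, the Hausdorff measure is finite, so that
    Tonelli's theorem applies.\<close>
  define N where "N = density hausdorff3 (indicator F)"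
  have setsN [simp, measurable_cong]: "sets N = sets borel" by (simp add: N_def)
  have N: "emeasure N S = emeasure hausdorff3 (F \<inter> S)" if "S \<in> sets borel" for S
    unfolding N_def using that by (subst emeasure_density) (auto simp: indicator_inter_arith[symmetric])
  interpret N: finite_measure N
  proof
    have "space N = UNIV" using sets_eq_imp_space_eq[OF setsN] by simp
    then show "emeasure N (space N) \<noteq> \<infinity>" using N[of UNIV] fin by simp
  qed
  interpret pair_sigma_finite N lborel ..
  \<comment> \<open>Pairs of a frontier point and a separated point at distance below
    \<open>3 * s\<close>. Slicing at the second point gives the lower bound by regularity, slicing
    at the first gives the average.\<close>
  let ?Z = "{z::heis \<times> heis. snd z \<in> ?D \<inter> U \<and> hdist (fst z) (snd z) < 3 * s}"
  have "open {z::heis \<times> heis. hdist (fst z) (snd z) < 3 * s}" by (intro open_Collect_less continuous_intros)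
  moreover have "snd -` (?D \<inter> U) \<inter> space borel \<in> sets (borel :: (heis \<times> heis) measure)"
    by (rule measurable_sets[of _ _ borel]) (auto intro!: borel_measurable_continuous_onI continuous_intros)
  ultimately have "snd -` (?D \<inter> U) \<inter> {z::heis \<times> heis. hdist (fst z) (snd z) < 3 * s} \<in> sets borel"
    by (auto intro: borel_open)
  also have "snd -` (?D \<inter> U) \<inter> {z::heis \<times> heis. hdist (fst z) (snd z) < 3 * s} = ?Z" by auto
  finally have "?Z \<in> sets borel" .
  then have Z: "?Z \<in> sets (N \<Otimes>\<^sub>M lborel)"
    by (simp only: sets_pair_measure_cong[OF setsN sets_lborel] borel_prod)
  have "ennreal (s ^ 3 / A) * emeasure lborel (?D \<inter> U) = (\<integral>\<^sup>+p\<in>?D \<inter> U. ennreal (s ^ 3 / A) \<partial>lborel)"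
    by (rule nn_integral_cmult_indicator[symmetric]) simp
  also have "\<dots> \<le> (\<integral>\<^sup>+p. emeasure N ((\<lambda>q. (q, p)) -` ?Z) \<partial>lborel)"
  proof (intro nn_integral_mono)
    fix p
    show "ennreal (s ^ 3 / A) * indicator (?D \<inter> U) p \<le> emeasure N ((\<lambda>q. (q, p)) -` ?Z)"
    proof (cases "p \<in> ?D \<inter> U")
      case True
      then obtain \<tau> where "p \<odot> (0, 0, \<tau>) \<in> ?E" "hdist (p \<odot> (0, 0, \<tau>)) p \<le> 2 * s"
        using vertical_frontier_point[OF _ s(1)] by blast
      then obtain x where x: "x \<in> ?E" "hdist x p \<le> 2 * s" by blast
      \<comment> \<open>The frontier point \<open>x\<close> is within \<open>2 * s\<close> of
        \<open>p\<close>, so the ball of radius \<open>s\<close> to which regularity is applied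
        fits.\<close>
      have "?E \<inter> heis.mball x s \<subseteq> heis.mball p (3 * s)"
      proof
        fix y assume "y \<in> ?E \<inter> heis.mball x s"
        then show "y \<in> heis.mball p (3 * s)"
          using x heis.triangle[of p x y] heis.commute[of p x] by simp
      qed
      then have sub: "?E \<inter> heis.mball x s \<subseteq> F \<inter> heis.mball p (3 * s)" using UF[of p] True by blast
      have "ennreal (s ^ 3 / A) = ennreal (inverse A * s ^ 3)" by (simp add: field_simps)
      also have "\<dots> \<le> emeasure hausdorff3 (?E \<inter> heis.mball x s)"
        using s x by (intro regular3_ge[OF reg])
      also have "\<dots> \<le> emeasure hausdorff3 (F \<inter> heis.mball p (3 * s))"
        using sub by (intro emeasure_mono) auto
      also have "\<dots> = emeasure N (heis.mball p (3 * s))" by (rule N[symmetric]) simp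
      also have "heis.mball p (3 * s) = (\<lambda>q. (q, p)) -` ?Z" using True by (auto simp: heis.commute)
      finally show ?thesis using True by simp
    qed simp
  qed
  also have "\<dots> = emeasure (N \<Otimes>\<^sub>M lborel) ?Z" by (rule emeasure_pair_measure_alt2[OF Z, symmetric])
  also have "\<dots> = (\<integral>\<^sup>+q. emeasure lborel (Pair q -` ?Z) \<partial>N)"
    by (rule sigma_finite_measure.emeasure_pair_measure_alt[OF sigma_finite_lborel Z])
  also have "\<dots> = (\<integral>\<^sup>+q. indicator F q * emeasure lborel (Pair q -` ?Z) \<partial>hausdorff3)"
    unfolding N_def
  proof (rule nn_integral_density)
    show "(\<lambda>q. emeasure lborel (Pair q -` ?Z)) \<in> borel_measurable hausdorff3"
      using sigma_finite_measure.measurable_emeasure_Pair[OF sigma_finite_lborel Z]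
        measurable_cong_sets[of N hausdorff3 borel borel] by simp
  qed simp
  also have "\<dots> \<le> (\<integral>\<^sup>+q\<in>F. emeasure lborel (?D \<inter> heis.mball q (3 * s)) \<partial>hausdorff3)"
    unfolding mult.commute[of "indicator F _"]
    by (intro nn_integral_mono mult_right_mono emeasure_mono) auto
  finally have *: "ennreal (s ^ 3 / A) * emeasure lborel (?D \<inter> U) \<le> (\<integral>\<^sup>+q\<in>F. emeasure lborel (?D \<inter> heis.mball q (3 * s)) \<partial>hausdorff3)" .
  have "emeasure lborel (?D \<inter> U) = ennreal (A / s ^ 3) * (ennreal (s ^ 3 / A) * emeasure lborel (?D \<inter> U))"
    using A s by (simp add: mult.assoc[symmetric] ennreal_mult[symmetric])
  also have "\<dots> \<le> ennreal (A / s ^ 3) * (\<integral>\<^sup>+q\<in>F. emeasure lborel (?D \<inter> heis.mball q (3 * s)) \<partial>hausdorff3)"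
    using * by (rule mult_left_mono) simp
  finally show ?thesis using \<Omega> U by (simp add: vertical_var_eq)
qed

section \<open>Carleson integrals\<close>

lemma ennreal_powr_ennreal: "0 \<le> x \<Longrightarrow> ennreal_powr (ennreal x) a = ennreal (x powr a)"
  by (simp add: ennreal_powr_def)

section \<open>Powers and Jensen's inequality\<close>

lemma ennreal_powr_mono:
  assumes "x \<le> y" "0 \<le> a" shows "ennreal_powr x a \<le> ennreal_powr y a"
proof (cases "y = \<infinity>")
  case False
  then have "y < top" by (simp add: less_top)
  with assms have "x < top" by simp
  with \<open>y < top\<close> assms show ?thesis
    by (auto simp: ennreal_powr_def intro!: ennreal_leI powr_mono2 enn2real_mono)
qed (simp add: ennreal_powr_def)

lemma ennreal_powr_cmult:
  assumes "0 < c" shows "ennreal_powr (ennreal c * x) a = ennreal (c powr a) * ennreal_powr x a"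
proof (cases x)
  case (real r)
  then show ?thesis using assms
    by (simp add: ennreal_mult[symmetric] ennreal_powr_ennreal powr_mult)
next
  case top
  then show ?thesis using assms by (simp add: ennreal_powr_def ennreal_mult_top)
qed

text \<open>For \<open>x > l\<close> write \<open>x = x powr (1 - p) * x powr p\<close>; the
  exponent \<open>1 - p\<close> is nonpositive, so the first factor is at most
  \<open>l powr (1 - p)\<close>.\<close>

lemma le_add_powr:
  fixes l x p :: real
  assumes "0 < l" "0 \<le> x" "1 \<le> p" shows "x \<le> l + l powr (1 - p) * x powr p"
proof (cases "x \<le> l")
  case True
  moreover have "0 \<le> l powr (1 - p) * x powr p" by simp
  ultimately show ?thesis by linarith
next
  case False
  then have "x = x powr (1 - p) * x powr p" using assms by (simp add: powr_add[symmetric])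
  also have "\<dots> \<le> l powr (1 - p) * x powr p"
    using assms False by (intro mult_right_mono powr_mono2') auto
  finally show ?thesis using assms by simp
qed

text \<open>Jensen's inequality up to a constant: integrate \<open>x \<le> l + l powr (1 - p) * x powr p\<close>
  and choose \<open>l\<close> such that the first term contributes half of the integral.\<close>

lemma ennreal_powr_nn_integral_le:
  fixes f :: "'a \<Rightarrow> real"
  assumes [measurable]: "f \<in> borel_measurable N" and f: "\<And>x. 0 \<le> f x"
    and m: "emeasure N (space N) \<le> ennreal m" "0 < m" and p: "1 \<le> p"
  shows "ennreal_powr (\<integral>\<^sup>+x. ennreal (f x) \<partial>N) p
    \<le> ennreal (2 powr p * m powr (p - 1)) * (\<integral>\<^sup>+x. ennreal (f x powr p) \<partial>N)"
    (is "ennreal_powr ?X p \<le> _ * ?Y")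
proof -
  have base: "?X \<le> ennreal (l * m) + ennreal (l powr (1 - p)) * ?Y" if l: "0 < l" for l
  proof -
    have "?X \<le> (\<integral>\<^sup>+x. ennreal l + ennreal (l powr (1 - p)) * ennreal (f x powr p) \<partial>N)"
    proof (rule nn_integral_mono)
      fix x
      have "ennreal (f x) \<le> ennreal (l + l powr (1 - p) * f x powr p)"
        using le_add_powr[OF l f p] by (rule ennreal_leI)
      then show "ennreal (f x) \<le> ennreal l + ennreal (l powr (1 - p)) * ennreal (f x powr p)"
        using l by (simp add: ennreal_mult)
    qed
    also have "\<dots> = ennreal l * emeasure N (space N) + ennreal (l powr (1 - p)) * ?Y"
      by (subst nn_integral_add) (auto simp: nn_integral_cmult)
    also have "\<dots> \<le> ennreal l * ennreal m + ennreal (l powr (1 - p)) * ?Y"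
      using m by (intro add_right_mono mult_left_mono) auto
    finally show ?thesis using l m by (simp add: ennreal_mult)
  qed
  show ?thesis
  proof (cases ?Y)
    case top
    then show ?thesis using m by (simp add: ennreal_mult_top)
  next
    case (real y)
    \<comment> \<open>The choice \<open>l = 1\<close> serves to show that \<open>?X\<close> is
      finite.\<close>
    have "?X \<le> ennreal (1 * m) + ennreal (1 powr (1 - p)) * ?Y" by (rule base) simp
    also have "\<dots> < top" using real by (simp add: ennreal_mult_less_top)
    finally obtain x where x: "0 \<le> x" "?X = ennreal x" by (cases ?X) auto
    show ?thesis
    proof (cases "x = 0")
      case True
      then show ?thesis using x by (simp add: ennreal_powr_def)
    next
      case False
      define l where "l = x / (2 * m)"
      have l: "0 < l" using x False m by (simp add: l_def)
      have "ennreal x \<le> ennreal (l * m + l powr (1 - p) * y)"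
        using base[OF l] l m real x by (simp add: ennreal_mult[symmetric])
      then have "x \<le> l * m + l powr (1 - p) * y" using l m real by (subst (asm) ennreal_le_iff) auto
      moreover have "l * m = x / 2" using m by (simp add: l_def)
      ultimately have "x / 2 \<le> l powr (1 - p) * y" by simp
      then have "l powr (p - 1) * (x / 2) \<le> l powr (p - 1) * (l powr (1 - p) * y)"
        by (intro mult_left_mono) auto
      also have "\<dots> = y" using l by (simp add: mult.assoc[symmetric] powr_add[symmetric])
      \<comment> \<open>Since \<open>l = x / (2 * m)\<close>, this factor turns the left side into
        \<open>x powr p\<close>.\<close>
      finally have "2 * (2 * m) powr (p - 1) * (l powr (p - 1) * (x / 2)) \<le> 2 * (2 * m) powr (p - 1) * y"
        by (intro mult_left_mono) auto
      moreover have "2 * (2 * m) powr (p - 1) * (l powr (p - 1) * (x / 2)) = x powr p"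
      proof -
        have "(2 * m) powr (p - 1) * l powr (p - 1) = x powr (p - 1)"
          using x m l by (simp add: powr_mult[symmetric] l_def)
        then have "2 * (2 * m) powr (p - 1) * (l powr (p - 1) * (x / 2)) = x powr (p - 1) * x"
          by (simp add: mult_ac)
        also have "\<dots> = x powr (p - 1) * x powr 1" using x by simp
        also have "\<dots> = x powr p" unfolding powr_add[symmetric] by simp
        finally show ?thesis .
      qed
      moreover have "2 * (2 * m) powr (p - 1) = 2 powr p * m powr (p - 1)"
        using m by (simp add: powr_mult powr_diff)
      ultimately have "x powr p \<le> 2 powr p * m powr (p - 1) * y" by (simp only:)
      then show ?thesis using x real m by (simp add: ennreal_powr_ennreal ennreal_mult[symmetric] ennreal_leI)
    qed
  qed
qed

text \<open>The power \<open>s ^ 4\<close> is the order of the volume of a ball of radius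
  \<open>s\<close>, so this density is scale invariant, as \<open>beta1\<close> is.\<close>

definition vdens :: "heis set \<Rightarrow> heis \<Rightarrow> real \<Rightarrow> real" where
  "vdens \<Omega> q s = measure lborel (vdiff \<Omega> s \<inter> heis.mball q (3 * s)) / s ^ 4"

lemma vdens_nonneg: "0 \<le> vdens \<Omega> q s"
  by (simp add: vdens_def)

lemma measurable_vdens:
  assumes "open \<Omega>" shows "(\<lambda>z. vdens \<Omega> (fst z) (snd z)) \<in> borel_measurable borel"
proof -
  have [measurable]: "snd \<in> borel_measurable (borel :: (heis \<times> real) measure)"
    by (intro borel_measurable_continuous_onI continuous_intros)
  have [measurable]: "(\<lambda>z. enn2real (emeasure lborel (vdiff \<Omega> (snd z) \<inter> heis.mball (fst z) (3 * snd z)))) \<in> borel_measurable borel"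
    using measurable_vdiff_hball[OF assms] by measurable
  show ?thesis unfolding vdens_def measure_def by measurable
qed

lemma measurable_vdens_pair [measurable (raw)]:
  assumes "open \<Omega>" "f \<in> borel_measurable M" "g \<in> borel_measurable M"
  shows "(\<lambda>x. vdens \<Omega> (f x) (g x)) \<in> borel_measurable M"
  using measurable_compose[OF borel_measurable_Pair[OF assms(2,3)] measurable_vdens[OF assms(1)]] by simp

lemma emeasure_vdiff_hball_eq:
  assumes "open \<Omega>" "0 < s"
  shows "emeasure lborel (vdiff \<Omega> s \<inter> heis.mball q (3 * s)) = ennreal (s ^ 4) * ennreal (vdens \<Omega> q s)"
proof -
  have "emeasure lborel (vdiff \<Omega> s \<inter> heis.mball q (3 * s)) \<le> emeasure lborel (heis.mball q (3 * s))"
    by (intro emeasure_mono) auto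
  also have "\<dots> \<le> ennreal (2 * (3 * s) ^ 4)" using assms by (intro emeasure_hball_le) auto
  finally have "emeasure lborel (vdiff \<Omega> s \<inter> heis.mball q (3 * s)) = ennreal (measure lborel (vdiff \<Omega> s \<inter> heis.mball q (3 * s)))"
    by (intro emeasure_eq_ennreal_measure) (auto simp: top_unique)
  then show ?thesis using assms by (simp add: vdens_def ennreal_mult[symmetric])
qed

text \<open>A measurable substitute for the inner Carleson integral of \<open>beta1\<close>.\<close>

definition vdens_integral :: "heis set \<Rightarrow> real \<Rightarrow> real \<Rightarrow> heis \<Rightarrow> ennreal" where
  "vdens_integral \<Omega> p T q = (\<integral>\<^sup>+s\<in>{0<..<T}. ennreal (vdens \<Omega> q s powr p / s) \<partial>lborel)"

lemma measurable_vdens_integral [measurable]: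
  assumes "open \<Omega>" shows "vdens_integral \<Omega> p T \<in> borel_measurable borel"
proof -
  have "(\<lambda>(q, s). ennreal (vdens \<Omega> q s powr p / s) * indicator {0<..<T} s) \<in> borel_measurable (borel \<Otimes>\<^sub>M lborel)"
    using assms by measurable
  from sigma_finite_measure.borel_measurable_nn_integral_fst[OF sigma_finite_lborel this]
  show ?thesis unfolding vdens_integral_def[abs_def] by simp
qed

text \<open>Substitute \<open>r = 8 * s\<close>, which preserves the measure \<open>ds / s\<close>.
  The substitution acts on the measurable density, and \<open>beta1\<close> enters by pointwise
  comparison.\<close>

lemma vdens_integral_le_beta1:
  assumes \<Omega>: "open \<Omega>" and reg: "regular3 A (frontier \<Omega>)" and q: "q \<in> frontier \<Omega>"
    and R: "ennreal R \<le> hdiam (frontier \<Omega>)" and p: "1 \<le> p"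
  shows "ennreal ((2592 * A * 8 ^ 4) powr - p) * vdens_integral \<Omega> p (R / 8) q
    \<le> (\<integral>\<^sup>+r\<in>{0<..<R}. ennreal_powr (beta1 (frontier \<Omega>) q r) p / ennreal r \<partial>lborel)"
proof -
  define L where "L = 2592 * A * 8 ^ 4"
  have L: "0 < L" using reg by (simp add: regular3_def L_def)
  have m[measurable]: "(\<lambda>s. vdens \<Omega> q s) \<in> borel_measurable borel"
    using \<Omega> by measurable
  have "ennreal (L powr - p) * vdens_integral \<Omega> p (R / 8) q
    = ennreal (L powr - p) * (ennreal (1 / 8) * (\<integral>\<^sup>+r. ennreal (vdens \<Omega> q (0 + 1 / 8 * r) powr p / (0 + 1 / 8 * r)) * indicator {0<..<R / 8} (0 + 1 / 8 * r) \<partial>lborel))"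
    unfolding vdens_integral_def by (subst nn_integral_real_affine[where c="1/8" and t=0]) auto
  also have "\<dots> = (\<integral>\<^sup>+r. ennreal (L powr - p) * (ennreal (1 / 8) * (ennreal (vdens \<Omega> q (0 + 1 / 8 * r) powr p / (0 + 1 / 8 * r)) * indicator {0<..<R / 8} (0 + 1 / 8 * r))) \<partial>lborel)"
    by (simp add: nn_integral_cmult)
  also have "\<dots> \<le> (\<integral>\<^sup>+r\<in>{0<..<R}. ennreal_powr (beta1 (frontier \<Omega>) q r) p / ennreal r \<partial>lborel)"
  proof (rule nn_integral_mono)
    fix r :: real
    show "ennreal (L powr - p) * (ennreal (1 / 8) * (ennreal (vdens \<Omega> q (0 + 1 / 8 * r) powr p / (0 + 1 / 8 * r)) * indicator {0<..<R / 8} (0 + 1 / 8 * r)))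
      \<le> ennreal_powr (beta1 (frontier \<Omega>) q r) p / ennreal r * indicator {0<..<R} r"
    proof (cases "0 < r \<and> r < R")
      case True
      then have r: "0 < r / 8" "ennreal (8 * (r / 8)) \<le> hdiam (frontier \<Omega>)"
        using order_trans[OF ennreal_leI R, of r] by auto
      let ?w = "vdens \<Omega> q (r / 8)"
      have "ennreal (?w / L) \<le> beta1 (frontier \<Omega>) q (8 * (r / 8))"
        using vdiff_hball_le_beta1[OF \<Omega> reg q r] L True by (simp add: vdens_def L_def power_divide mult_ac)
      then have "ennreal_powr (ennreal (?w / L)) p \<le> ennreal_powr (beta1 (frontier \<Omega>) q r) p"
        using p by (intro ennreal_powr_mono) auto
      moreover have "ennreal_powr (ennreal (?w / L)) p = ennreal (L powr - p * ?w powr p)"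
        using L vdens_nonneg[of \<Omega> q "r / 8"] by (simp add: ennreal_powr_ennreal powr_divide powr_minus_divide)
      ultimately have "ennreal (L powr - p * ?w powr p) / ennreal r \<le> ennreal_powr (beta1 (frontier \<Omega>) q r) p / ennreal r"
        by (simp add: divide_right_mono_ennreal)
      moreover have "ennreal (L powr - p * ?w powr p) / ennreal r
        = ennreal (L powr - p) * (ennreal (1 / 8) * ennreal (?w powr p / (1 / 8 * r)))"
        using True by (simp add: divide_ennreal ennreal_mult[symmetric])
      ultimately show ?thesis using True by simp
    qed (auto simp: indicator_def)
  qed
  finally show ?thesis by (simp add: L_def)
qed

text \<open>The centre \<open>q\<close> may lie off \<open>E\<close> and the radius may exceed the
  diameter, so regularity is applied to the balls of radius \<open>\<rho> / 2\<close> centred on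
  \<open>E\<close> of a finite cover.\<close>

lemma emeasure_frontier_hball_le:
  assumes reg: "regular3 A E" and \<rho>: "0 < \<rho>" "ennreal \<rho> \<le> hdiam E"
  shows "emeasure hausdorff3 (E \<inter> heis.mball q (2 * \<rho>)) \<le> ennreal (165888 * A * \<rho> ^ 3)"
proof -
  let ?F = "E \<inter> heis.mball q (2 * \<rho>)"
  have E[measurable]: "E \<in> sets borel" and A: "1 \<le> A" using reg by (auto simp: regular3_def borel_closed)
  obtain P where P: "finite P" "P \<subseteq> ?F" "card P \<le> 165888" "?F \<subseteq> (\<Union>x\<in>P. heis.mball x (\<rho> / 2))"
    using hball_finite_cover[OF \<rho>(1), of ?F q] by auto
  have "emeasure hausdorff3 ?F \<le> emeasure hausdorff3 (\<Union>x\<in>P. E \<inter> heis.mball x (\<rho> / 2))"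
    using P by (intro emeasure_mono) auto
  also have "\<dots> \<le> (\<Sum>x\<in>P. emeasure hausdorff3 (E \<inter> heis.mball x (\<rho> / 2)))"
    using P by (intro emeasure_subadditive_finite) auto
  also have "\<dots> \<le> (\<Sum>x\<in>P. ennreal (A * \<rho> ^ 3))"
  proof (rule sum_mono)
    fix x assume "x \<in> P"
    then have "emeasure hausdorff3 (E \<inter> heis.mball x (\<rho> / 2)) \<le> ennreal (A * (\<rho> / 2) ^ 3)"
      using P \<rho> order_trans[OF ennreal_leI \<rho>(2), of "\<rho> / 2"] by (intro regular3_le[OF reg]) auto
    also have "\<dots> \<le> ennreal (A * \<rho> ^ 3)"
      using A \<rho> by (intro ennreal_leI mult_left_mono power_mono) auto
    finally show "emeasure hausdorff3 (E \<inter> heis.mball x (\<rho> / 2)) \<le> ennreal (A * \<rho> ^ 3)" .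
  qed
  also have "\<dots> = ennreal (real (card P) * (A * \<rho> ^ 3))" using A \<rho> by (subst sum_ennreal) simp_all
  also have "\<dots> \<le> ennreal (165888 * A * \<rho> ^ 3)"
    using P(3) A \<rho> unfolding mult.assoc by (intro ennreal_leI mult_right_mono) auto
  finally show ?thesis .
qed

text \<open>The same cover transfers the Carleson bound from balls of radius
  \<open>\<rho> / 2\<close> centred on \<open>E\<close> to the larger ball.\<close>

lemma nn_integral_frontier_hball_le:
  assumes reg: "regular3 A E" and \<rho>: "0 < \<rho>" and c: "0 \<le> c"
    and g [measurable]: "g \<in> borel_measurable borel"
    and bound: "\<And>x. x \<in> E \<Longrightarrow> (\<integral>\<^sup>+q\<in>heis.mball x (\<rho> / 2) \<inter> E. g q \<partial>hausdorff3) \<le> ennreal c"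
  shows "(\<integral>\<^sup>+q\<in>E \<inter> heis.mball q0 (2 * \<rho>). g q \<partial>hausdorff3) \<le> ennreal (165888 * c)"
proof -
  let ?F = "E \<inter> heis.mball q0 (2 * \<rho>)"
  have E[measurable]: "E \<in> sets borel" using reg by (auto simp: regular3_def borel_closed)
  obtain P where P: "finite P" "P \<subseteq> ?F" "card P \<le> 165888" "?F \<subseteq> (\<Union>x\<in>P. heis.mball x (\<rho> / 2))"
    using hball_finite_cover[OF \<rho>(1), of ?F q0] by auto
  have "(\<integral>\<^sup>+q\<in>?F. g q \<partial>hausdorff3) \<le> (\<integral>\<^sup>+q. (\<Sum>x\<in>P. g q * indicator (heis.mball x (\<rho> / 2) \<inter> E) q) \<partial>hausdorff3)"
  proof (rule nn_integral_mono)
    fix q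
    show "g q * indicator ?F q \<le> (\<Sum>x\<in>P. g q * indicator (heis.mball x (\<rho> / 2) \<inter> E) q)"
    proof (cases "q \<in> ?F")
      case True
      then obtain x where x: "x \<in> P" "q \<in> heis.mball x (\<rho> / 2)" using P(4) by blast
      have "g q * indicator ?F q = (\<Sum>x\<in>{x}. g q * indicator (heis.mball x (\<rho> / 2) \<inter> E) q)"
        using True x by simp
      also have "\<dots> \<le> (\<Sum>x\<in>P. g q * indicator (heis.mball x (\<rho> / 2) \<inter> E) q)"
        using P x by (intro sum_mono2) auto
      finally show ?thesis .
    qed simp
  qed
  also have "\<dots> = (\<Sum>x\<in>P. \<integral>\<^sup>+q\<in>heis.mball x (\<rho> / 2) \<inter> E. g q \<partial>hausdorff3)"
    by (rule nn_integral_sum) measurable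
  also have "\<dots> \<le> (\<Sum>x\<in>P. ennreal c)" using bound P by (intro sum_mono) auto
  also have "\<dots> = ennreal (real (card P) * c)" using c by (subst sum_ennreal) simp_all
  also have "\<dots> \<le> ennreal (165888 * c)" using P(3) c by (intro ennreal_leI mult_right_mono) auto
  finally show ?thesis .
qed

section \<open>Integration over all scales\<close>

text \<open>All powers of \<open>s\<close> cancel: \<open>s ^ 4\<close> from the normalisation of
  \<open>vdens\<close>, \<open>s ^ 3\<close> from the averaging and \<open>s\<close> from the
  division.\<close>

lemma vertical_var_le_vdens:
  assumes \<Omega>: "open \<Omega>" and reg: "regular3 A (frontier \<Omega>)"
    and s: "0 < s" "ennreal s \<le> hdiam (frontier \<Omega>)"
    and U: "U \<in> sets borel" and F: "F \<in> sets borel" and fin: "emeasure hausdorff3 F < \<infinity>"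
    and UF: "\<And>p. p \<in> U \<Longrightarrow> frontier \<Omega> \<inter> heis.mball p (3 * s) \<subseteq> F"
  shows "vertical_var \<Omega> U s / ennreal s \<le> ennreal A * (\<integral>\<^sup>+q\<in>F. ennreal (vdens \<Omega> q s) \<partial>hausdorff3)"
    (is "_ \<le> _ * ?X")
proof -
  have A: "1 \<le> A" using reg by (simp add: regular3_def)
  have [measurable]: "(\<lambda>q. vdens \<Omega> q s) \<in> borel_measurable borel" "F \<in> sets borel"
    using \<Omega> F by measurable
  have "vertical_var \<Omega> U s
    \<le> ennreal (A / s ^ 3) * (\<integral>\<^sup>+q\<in>F. emeasure lborel (vdiff \<Omega> s \<inter> heis.mball q (3 * s)) \<partial>hausdorff3)"
    by (rule vertical_var_le_average) fact+
  also have "(\<integral>\<^sup>+q\<in>F. emeasure lborel (vdiff \<Omega> s \<inter> heis.mball q (3 * s)) \<partial>hausdorff3)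
    = ennreal (s ^ 4) * ?X"
    unfolding emeasure_vdiff_hball_eq[OF \<Omega> s(1)] mult.assoc by (rule nn_integral_cmult) measurable
  also have "ennreal (A / s ^ 3) * (ennreal (s ^ 4) * ?X) = ennreal (A / s ^ 3 * s ^ 4) * ?X"
    using A s by (subst ennreal_mult[of "A / s ^ 3" "s ^ 4"]) (auto simp: mult.assoc)
  also have "A / s ^ 3 * s ^ 4 = s * A" using s by (simp add: eval_nat_numeral)
  finally have "vertical_var \<Omega> U s / ennreal s \<le> ennreal (s * A) * ?X / ennreal s"
    by (rule divide_right_mono_ennreal)
  also have "\<dots> = ennreal (inverse s) * (ennreal (s * A) * ?X)"
    using s by (simp add: divide_ennreal_def inverse_ennreal mult.commute)
  also have "\<dots> = ennreal (inverse s * (s * A)) * ?X"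
    using s A by (simp add: ennreal_mult mult.assoc)
  also have "inverse s * (s * A) = A" using s by simp
  finally show ?thesis .
qed

text \<open>Averaging, Jensen's inequality and Tonelli's theorem reduce the small scales to the
  Carleson bound. Radii below \<open>\<rho> / 2\<close> correspond to scales below
  \<open>\<rho> / 16\<close>, since scale \<open>s\<close> is compared with \<open>beta1\<close> at
  radius \<open>8 * s\<close>. The measurable majorant \<open>G\<close> allows the integral over the
  scales to be split later.\<close>

lemma vertical_perimeter_small_scales:
  assumes \<Omega>: "open \<Omega>" and reg: "regular3 A (frontier \<Omega>)" and p: "1 \<le> p"
    and \<rho>: "0 < \<rho>" "ennreal \<rho> \<le> hdiam (frontier \<Omega>)"
    and U: "U \<in> sets borel"
    and UF: "\<And>u s. u \<in> U \<Longrightarrow> s < \<rho> / 16 \<Longrightarrow> frontier \<Omega> \<inter> heis.mball u (3 * s) \<subseteq> heis.mball q0 (2 * \<rho>)"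
    and c: "0 \<le> c"
    and carleson: "\<And>x. x \<in> frontier \<Omega> \<Longrightarrow> (\<integral>\<^sup>+q\<in>heis.mball x (\<rho> / 2) \<inter> frontier \<Omega>.
      (\<integral>\<^sup>+r\<in>{0<..<\<rho> / 2}. ennreal_powr (beta1 (frontier \<Omega>) q r) p / ennreal r \<partial>lborel) \<partial>hausdorff3) \<le> ennreal c"
  shows "\<exists>G\<in>borel_measurable borel.
    (\<forall>s. 0 < s \<longrightarrow> s < \<rho> / 16 \<longrightarrow> ennreal_powr (vertical_var \<Omega> U s / ennreal s) p / ennreal s \<le> G s) \<and>
    (\<integral>\<^sup>+s\<in>{0<..<\<rho> / 16}. G s \<partial>lborel)
      \<le> ennreal (A powr p * (2 powr p * (165888 * A * \<rho> ^ 3) powr (p - 1)) * (165888 * ((2592 * A * 8 ^ 4) powr p * c)))"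
proof -
  let ?E = "frontier \<Omega>"
  define F where "F = ?E \<inter> heis.mball q0 (2 * \<rho>)"
  define L where "L = 2592 * A * 8 ^ 4"
  define m where "m = 165888 * A * \<rho> ^ 3"
  have A: "1 \<le> A" using reg by (simp add: regular3_def)
  have L: "0 < L" and m0: "0 < m" using A \<rho> by (auto simp: L_def m_def)
  have [measurable]: "?E \<in> sets borel" by (simp add: borel_closed)
  have F[measurable]: "F \<in> sets borel" unfolding F_def by measurable
  have g[measurable]: "vdens_integral \<Omega> p (\<rho> / 16) \<in> borel_measurable borel" by (rule measurable_vdens_integral) fact
  have Fm: "emeasure hausdorff3 F \<le> ennreal m"
    unfolding F_def m_def by (rule emeasure_frontier_hball_le) fact+
  then have fin: "emeasure hausdorff3 F < \<infinity>" by (rule order_le_less_trans) simp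
  have gF: "(\<integral>\<^sup>+q\<in>F. vdens_integral \<Omega> p (\<rho> / 16) q \<partial>hausdorff3) \<le> ennreal (165888 * (L powr p * c))"
    unfolding F_def
  proof (rule nn_integral_frontier_hball_le[OF reg \<rho>(1)])
    fix x assume x: "x \<in> ?E"
    let ?B = "heis.mball x (\<rho> / 2) \<inter> ?E"
    let ?I = "\<integral>\<^sup>+q\<in>?B. vdens_integral \<Omega> p (\<rho> / 16) q \<partial>hausdorff3"
    have R: "ennreal (\<rho> / 2) \<le> hdiam ?E" using order_trans[OF ennreal_leI \<rho>(2), of "\<rho> / 2"] \<rho> by simp
    have "ennreal (L powr - p) * ?I = (\<integral>\<^sup>+q\<in>?B. ennreal (L powr - p) * vdens_integral \<Omega> p (\<rho> / 16) q \<partial>hausdorff3)"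
      unfolding mult.assoc by (rule nn_integral_cmult[symmetric]) measurable
    also have "\<dots> \<le> (\<integral>\<^sup>+q\<in>?B. (\<integral>\<^sup>+r\<in>{0<..<\<rho> / 2}. ennreal_powr (beta1 ?E q r) p / ennreal r \<partial>lborel) \<partial>hausdorff3)"
    proof (rule nn_integral_mono)
      fix q
      show "ennreal (L powr - p) * vdens_integral \<Omega> p (\<rho> / 16) q * indicator ?B q
        \<le> (\<integral>\<^sup>+r\<in>{0<..<\<rho> / 2}. ennreal_powr (beta1 ?E q r) p / ennreal r \<partial>lborel) * indicator ?B q"
        using vdens_integral_le_beta1[OF \<Omega> reg _ R p, of q] by (cases "q \<in> ?B") (auto simp: L_def)
    qed
    also have "\<dots> \<le> ennreal c" by (rule carleson) fact
    \<comment> \<open>Multiplying by \<open>L powr p\<close> undoes the comparison factor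
      \<open>L powr - p\<close>.\<close>
    finally have "ennreal (L powr p) * (ennreal (L powr - p) * ?I) \<le> ennreal (L powr p) * ennreal c"
      by (rule mult_left_mono) simp
    moreover have "ennreal (L powr p) * (ennreal (L powr - p) * ?I) = ?I"
      using L by (simp add: mult.assoc[symmetric] ennreal_mult[symmetric] powr_add[symmetric])
    ultimately show "?I \<le> ennreal (L powr p * c)" using c by (simp add: ennreal_mult)
  qed (use c in auto)
  define N where "N = density hausdorff3 (indicator F)"
  have setsN [simp, measurable_cong]: "sets N = sets borel" by (simp add: N_def)
  have spaceN: "space N = UNIV" using sets_eq_imp_space_eq[OF setsN] by simp
  have int_N: "(\<integral>\<^sup>+q. f q \<partial>N) = (\<integral>\<^sup>+q\<in>F. f q \<partial>hausdorff3)" if "f \<in> borel_measurable borel" for f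
    unfolding N_def using that by (subst nn_integral_density) (auto simp: mult.commute)
  have N: "emeasure N (space N) \<le> ennreal m"
    unfolding N_def using Fm by (subst emeasure_density) auto
  interpret N: finite_measure N
    by standard (use N in \<open>auto simp: top_unique\<close>)
  interpret pair_sigma_finite N lborel ..
  \<comment> \<open>The factor \<open>A powr p\<close> comes from the averaging, the rest from
    Jensen's inequality for total mass at most \<open>m\<close>.\<close>
  define k where "k = A powr p * (2 powr p * m powr (p - 1))"
  have k: "0 < k" using A m0 by (simp add: k_def)
  define G where "G s = ennreal k * (\<integral>\<^sup>+q. ennreal (vdens \<Omega> q s powr p / s) \<partial>N)" for s
  have meas: "(\<lambda>(q, s). ennreal (vdens \<Omega> q s powr p / s) * indicator {0<..<\<rho> / 16} s) \<in> borel_measurable (N \<Otimes>\<^sub>M lborel)"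
    using \<Omega> by measurable
  have "(\<lambda>(s, q). ennreal (vdens \<Omega> q s powr p / s)) \<in> borel_measurable (lborel \<Otimes>\<^sub>M N)"
    using \<Omega> by measurable
  from N.borel_measurable_nn_integral_fst[OF this]
  have "(\<lambda>s. \<integral>\<^sup>+q. ennreal (vdens \<Omega> q s powr p / s) \<partial>N) \<in> borel_measurable lborel" by simp
  then have G[measurable]: "G \<in> borel_measurable borel" unfolding G_def by simp
  have small: "ennreal_powr (vertical_var \<Omega> U s / ennreal s) p / ennreal s \<le> G s" if s: "0 < s" "s < \<rho> / 16" for s
  proof -
    have [measurable]: "(\<lambda>q. vdens \<Omega> q s) \<in> borel_measurable borel" using \<Omega> by measurable
    have "vertical_var \<Omega> U s / ennreal s \<le> ennreal A * (\<integral>\<^sup>+q\<in>F. ennreal (vdens \<Omega> q s) \<partial>hausdorff3)"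
    proof (rule vertical_var_le_vdens[OF \<Omega> reg s(1) _ U F fin])
      show "ennreal s \<le> hdiam ?E" using order_trans[OF ennreal_leI \<rho>(2), of s] s by simp
      show "?E \<inter> heis.mball u (3 * s) \<subseteq> F" if "u \<in> U" for u using UF[OF that s(2)] by (auto simp: F_def)
    qed
    also have "(\<integral>\<^sup>+q\<in>F. ennreal (vdens \<Omega> q s) \<partial>hausdorff3) = (\<integral>\<^sup>+q. ennreal (vdens \<Omega> q s) \<partial>N)"
      by (rule int_N[symmetric]) measurable
    finally have "ennreal_powr (vertical_var \<Omega> U s / ennreal s) p
      \<le> ennreal_powr (ennreal A * (\<integral>\<^sup>+q. ennreal (vdens \<Omega> q s) \<partial>N)) p"
      using p by (intro ennreal_powr_mono) auto
    also have "\<dots> = ennreal (A powr p) * ennreal_powr (\<integral>\<^sup>+q. ennreal (vdens \<Omega> q s) \<partial>N) p"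
      using A by (intro ennreal_powr_cmult) simp
    also have "\<dots> \<le> ennreal (A powr p) * (ennreal (2 powr p * m powr (p - 1)) * (\<integral>\<^sup>+q. ennreal (vdens \<Omega> q s powr p) \<partial>N))"
      by (intro mult_left_mono ennreal_powr_nn_integral_le vdens_nonneg N m0 p) auto
    also have "\<dots> = ennreal k * (\<integral>\<^sup>+q. ennreal (vdens \<Omega> q s powr p) \<partial>N)"
      by (simp add: k_def ennreal_mult mult.assoc)
    finally have "ennreal_powr (vertical_var \<Omega> U s / ennreal s) p / ennreal s
      \<le> ennreal k * (\<integral>\<^sup>+q. ennreal (vdens \<Omega> q s powr p) \<partial>N) / ennreal s"
      by (rule divide_right_mono_ennreal)
    also have "\<dots> = ennreal k * ((\<integral>\<^sup>+q. ennreal (vdens \<Omega> q s powr p) \<partial>N) / ennreal s)"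
      by (simp add: divide_ennreal_def mult.assoc)
    also have "(\<integral>\<^sup>+q. ennreal (vdens \<Omega> q s powr p) \<partial>N) / ennreal s
      = (\<integral>\<^sup>+q. ennreal (vdens \<Omega> q s powr p) / ennreal s \<partial>N)"
      by (rule nn_integral_divide[symmetric]) measurable
    also have "\<dots> = (\<integral>\<^sup>+q. ennreal (vdens \<Omega> q s powr p / s) \<partial>N)"
      using s by (simp add: divide_ennreal)
    finally show ?thesis by (simp add: G_def)
  qed
  have "(\<integral>\<^sup>+s\<in>{0<..<\<rho> / 16}. G s \<partial>lborel) \<le> ennreal (k * (165888 * (L powr p * c)))"
  proof -
    have meas': "(\<lambda>(s, q). ennreal (vdens \<Omega> q s powr p / s) * indicator {0<..<\<rho> / 16} s) \<in> borel_measurable (lborel \<Otimes>\<^sub>M N)"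
      using \<Omega> by measurable
    have "(\<integral>\<^sup>+s\<in>{0<..<\<rho> / 16}. G s \<partial>lborel)
      = (\<integral>\<^sup>+s. ennreal k * (\<integral>\<^sup>+q. ennreal (vdens \<Omega> q s powr p / s) * indicator {0<..<\<rho> / 16} s \<partial>N) \<partial>lborel)"
      unfolding G_def using \<Omega>
      by (intro nn_integral_cong) (simp add: nn_integral_multc mult.assoc)
    also have "\<dots> = ennreal k * (\<integral>\<^sup>+s. \<integral>\<^sup>+q. ennreal (vdens \<Omega> q s powr p / s) * indicator {0<..<\<rho> / 16} s \<partial>N \<partial>lborel)"
      using N.borel_measurable_nn_integral_fst[OF meas'] by (intro nn_integral_cmult) simp
    \<comment> \<open>Exchanging the integrals puts the integral over scales inside, where it is
      \<open>vdens_integral\<close>.\<close>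
    also have "(\<integral>\<^sup>+s. \<integral>\<^sup>+q. ennreal (vdens \<Omega> q s powr p / s) * indicator {0<..<\<rho> / 16} s \<partial>N \<partial>lborel)
      = (\<integral>\<^sup>+q. vdens_integral \<Omega> p (\<rho> / 16) q \<partial>N)"
      using Fubini'[OF meas] by (simp add: vdens_integral_def)
    also have "\<dots> = (\<integral>\<^sup>+q\<in>F. vdens_integral \<Omega> p (\<rho> / 16) q \<partial>hausdorff3)" by (rule int_N) fact
    also have "ennreal k * \<dots> \<le> ennreal k * ennreal (165888 * (L powr p * c))"
      using gF by (rule mult_left_mono) simp
    finally show ?thesis using k c by (simp add: ennreal_mult)
  qed
  note large = this[unfolded k_def m_def L_def]
  show ?thesis by (intro bexI[of _ G] conjI allI impI small large G)
qed

lemma nn_integral_inverse_square_tail: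
  assumes "0 < a" shows "(\<integral>\<^sup>+s\<in>{a..}. ennreal (a / s\<^sup>2) \<partial>lborel) = 1"
proof -
  have "(\<integral>\<^sup>+s. ennreal (a / s\<^sup>2) * indicator {a..} s \<partial>lborel) = ennreal (0 - (- a / a))"
  proof (rule nn_integral_FTC_atLeast[where F="\<lambda>s. - a / s"])
    show "(\<lambda>s. a / s\<^sup>2) \<in> borel_measurable borel" by measurable
    show "((\<lambda>s. - a / s) has_real_derivative a / s\<^sup>2) (at s)" if "a \<le> s" for s
      using that assms by (auto intro!: derivative_eq_intros simp: power2_eq_square)
    show "((\<lambda>s. - a / s) \<longlongrightarrow> 0) at_top" by (intro tendsto_divide_0[OF tendsto_const]) (simp add: filterlim_at_top_imp_at_infinity filterlim_ident)
  qed (use assms in auto)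
  then show ?thesis using assms by simp
qed

text \<open>For \<open>s\<close> at least \<open>?a = \<rho> / 16\<close> the volume bound gives
  \<open>4 * \<rho> ^ 4 / s = 64 * \<rho> ^ 3 * (?a / s)\<close>. As \<open>?a / s \<le> 1\<close>
  and \<open>p \<ge> 1\<close>, its power is at most \<open>k * (?a / s)\<close>, and the tail
  integral of \<open>?a / s\<^sup>2\<close> is \<open>1\<close>.\<close>

lemma vertical_perimeter_le:
  assumes U: "\<And>s. vertical_var \<Omega> U s \<le> ennreal (4 * \<rho> ^ 4)" and p: "1 \<le> p" and \<rho>: "0 < \<rho>"
    and G [measurable]: "G \<in> borel_measurable borel"
    and small: "\<And>s. 0 < s \<Longrightarrow> s < \<rho> / 16 \<Longrightarrow> ennreal_powr (vertical_var \<Omega> U s / ennreal s) p / ennreal s \<le> G s"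
    and G_le: "(\<integral>\<^sup>+s\<in>{0<..<\<rho> / 16}. G s \<partial>lborel) \<le> ennreal (K * (\<rho> ^ 3) powr p)" and K: "0 \<le> K"
  shows "vertical_perimeter \<Omega> p U \<le> ennreal ((K + 64 powr p) powr (1 / p) * \<rho> ^ 3)"
proof -
  let ?a = "\<rho> / 16"
  define k where "k = (64 * \<rho> ^ 3) powr p"
  let ?T = "\<lambda>s. ennreal k * ennreal (?a / s\<^sup>2)"
  let ?v = "\<lambda>s. ennreal_powr (vertical_var \<Omega> U s / ennreal s) p / ennreal s"
  have large: "?v s \<le> ?T s" if s: "?a \<le> s" for s
  proof -
    have s0: "0 < s" using s \<rho> by linarith
    have "vertical_var \<Omega> U s / ennreal s \<le> ennreal (4 * \<rho> ^ 4) / ennreal s"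
      by (rule divide_right_mono_ennreal) (rule U)
    also have "\<dots> = ennreal (4 * \<rho> ^ 4 / s)" using s0 \<rho> by (simp add: divide_ennreal)
    finally have "ennreal_powr (vertical_var \<Omega> U s / ennreal s) p \<le> ennreal_powr (ennreal (4 * \<rho> ^ 4 / s)) p"
      using p by (intro ennreal_powr_mono) auto
    also have "\<dots> = ennreal ((4 * \<rho> ^ 4 / s) powr p)" using s0 \<rho> by (simp add: ennreal_powr_ennreal)
    also have "4 * \<rho> ^ 4 / s = 64 * \<rho> ^ 3 * (?a / s)" by (simp add: eval_nat_numeral)
    also have "ennreal ((64 * \<rho> ^ 3 * (?a / s)) powr p) \<le> ennreal (k * (?a / s))"
    proof (rule ennreal_leI)
      have "(?a / s) powr p \<le> (?a / s) powr 1"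
        using s s0 \<rho> p by (intro powr_mono') auto
      then have "k * (?a / s) powr p \<le> k * (?a / s)"
        using s0 \<rho> by (intro mult_left_mono) (auto simp: k_def)
      moreover have "(64 * \<rho> ^ 3 * (?a / s)) powr p = k * (?a / s) powr p"
        unfolding k_def by (rule powr_mult)
      ultimately show "(64 * \<rho> ^ 3 * (?a / s)) powr p \<le> k * (?a / s)" by simp
    qed
    finally have "?v s \<le> ennreal (k * (?a / s)) / ennreal s" by (rule divide_right_mono_ennreal)
    also have "\<dots> = ?T s"
      using s0 \<rho> by (simp add: divide_ennreal ennreal_mult[symmetric] k_def power2_eq_square)
    finally show ?thesis .
  qed
  have "(\<integral>\<^sup>+s\<in>{0<..}. ?v s \<partial>lborel) \<le> (\<integral>\<^sup>+s. G s * indicator {0<..<?a} s + ?T s * indicator {?a..} s \<partial>lborel)"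
  proof (rule nn_integral_mono)
    fix s :: real
    consider "s \<le> 0" | "0 < s" "s < ?a" | "?a \<le> s" by linarith
    then show "?v s * indicator {0<..} s \<le> G s * indicator {0<..<?a} s + ?T s * indicator {?a..} s"
    proof cases
      case 2
      then show ?thesis using small[of s] by simp
    next
      case 3
      then show ?thesis using large[of s] \<rho> by simp
    qed simp
  qed
  also have "\<dots> = (\<integral>\<^sup>+s\<in>{0<..<?a}. G s \<partial>lborel) + (\<integral>\<^sup>+s. ?T s * indicator {?a..} s \<partial>lborel)"
    by (rule nn_integral_add) measurable
  also have "(\<integral>\<^sup>+s. ?T s * indicator {?a..} s \<partial>lborel) = ennreal k * (\<integral>\<^sup>+s\<in>{?a..}. ennreal (?a / s\<^sup>2) \<partial>lborel)"
    unfolding mult.assoc by (rule nn_integral_cmult) measurable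
  also have "\<dots> = ennreal k" using nn_integral_inverse_square_tail[of ?a] \<rho> by simp
  also have "(\<integral>\<^sup>+s\<in>{0<..<?a}. G s \<partial>lborel) + ennreal k \<le> ennreal (K * (\<rho> ^ 3) powr p) + ennreal k"
    by (rule add_right_mono) (rule G_le)
  also have "\<dots> = ennreal ((K + 64 powr p) * (\<rho> ^ 3) powr p)"
    using K \<rho> by (simp add: k_def powr_mult distrib_right)
  finally have "vertical_perimeter \<Omega> p U \<le> ennreal_powr (ennreal ((K + 64 powr p) * (\<rho> ^ 3) powr p)) (1 / p)"
    unfolding vertical_perimeter_def using p by (intro ennreal_powr_mono) auto
  also have "\<dots> = ennreal (((K + 64 powr p) * (\<rho> ^ 3) powr p) powr (1 / p))"
    using K by (intro ennreal_powr_ennreal) simp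
  also have "((K + 64 powr p) * (\<rho> ^ 3) powr p) powr (1 / p) = (K + 64 powr p) powr (1 / p) * \<rho> ^ 3"
    using K p \<rho> by (simp add: powr_mult powr_powr)
  finally show ?thesis .
qed

lemma vertical_perimeter_eq_0:
  assumes "\<And>s. vertical_var \<Omega> U s = 0" shows "vertical_perimeter \<Omega> p U = 0"
  by (simp add: vertical_perimeter_def assms ennreal_powr_def)

text \<open>The admissible scale \<open>\<rho>\<close> is \<open>min r (diam (frontier \<Omega>))\<close>, which is \<open>0\<close> if the frontier is a
  single point.\<close>

lemma frontier_scale:
  assumes \<Omega>: "open \<Omega>" and q: "q \<in> frontier \<Omega>" and r: "0 < r"
  obtains \<rho> where "0 \<le> \<rho>" "\<rho> \<le> r" "ennreal \<rho> \<le> hdiam (frontier \<Omega>)"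
    "\<And>s. vertical_var \<Omega> (heis.mball q r) s \<le> ennreal (4 * \<rho> ^ 4)"
    "\<And>u s. u \<in> heis.mball q r \<Longrightarrow> 0 < \<rho> \<Longrightarrow> s < \<rho> / 16 \<Longrightarrow> frontier \<Omega> \<inter> heis.mball u (3 * s) \<subseteq> heis.mball q (2 * \<rho>)"
proof (cases "ennreal r \<le> hdiam (frontier \<Omega>)")
  case True
  show thesis
  proof (rule that[of r])
    fix s
    have "vertical_var \<Omega> (heis.mball q r) s \<le> ennreal (2 * r ^ 4)"
      using \<Omega> r by (intro vertical_var_hball_le) auto
    also have "\<dots> \<le> ennreal (4 * r ^ 4)" by (intro ennreal_leI) simp
    finally show "vertical_var \<Omega> (heis.mball q r) s \<le> ennreal (4 * r ^ 4)" .
  next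
    fix u s assume u: "u \<in> heis.mball q r" "s < r / 16"
    show "frontier \<Omega> \<inter> heis.mball u (3 * s) \<subseteq> heis.mball q (2 * r)"
    proof
      fix y assume "y \<in> frontier \<Omega> \<inter> heis.mball u (3 * s)"
      then show "y \<in> heis.mball q (2 * r)" using u r heis.triangle[of q u y] by simp
    qed
  qed (use True r in auto)
next
  case False
  then obtain \<rho> where \<rho>: "0 \<le> \<rho>" "hdiam (frontier \<Omega>) = ennreal \<rho>"
    by (cases "hdiam (frontier \<Omega>)") auto
  have dist: "hdist q y \<le> \<rho>" if "y \<in> frontier \<Omega>" for y
    using hdist_le_hdiam[OF q that] \<rho> by simp
  show thesis
  proof (rule that[of \<rho>])
    show "\<rho> \<le> r" using False \<rho> r by (simp add: ennreal_le_iff2)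
    show "vertical_var \<Omega> (heis.mball q r) s \<le> ennreal (4 * \<rho> ^ 4)" for s
      using \<Omega> \<rho> dist by (intro vertical_var_frontier_hcball) auto
    \<comment> \<open>The whole frontier lies within \<open>\<rho> < 2 * \<rho>\<close> of
      \<open>q\<close>.\<close>
    fix u s assume "0 < \<rho>"
    then show "frontier \<Omega> \<inter> heis.mball u (3 * s) \<subseteq> heis.mball q (2 * \<rho>)"
      using dist by force
  qed (use \<rho> in auto)
qed

theorem corollary6p5:
  fixes p A :: real and C0 :: ennreal
  assumes "1 \<le> p" and "C0 < \<infinity>"
  shows "\<exists>C::real. \<forall>\<Omega> :: heis set.
    open \<Omega> \<and> \<Omega> \<noteq> {} \<and> regular3 A (frontier \<Omega>) \<and>
    (\<forall>p0\<in>frontier \<Omega>. \<forall>R>0. ennreal R \<le> hdiam \<Omega> \<longrightarrow>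
       (\<integral>\<^sup>+q\<in>heis.mball p0 R \<inter> frontier \<Omega>.
          (\<integral>\<^sup>+r\<in>{0<..<R}. ennreal_powr (beta1 (frontier \<Omega>) q r) p / ennreal r \<partial>lborel)
        \<partial>hausdorff3) \<le> C0 * ennreal (R ^ 3)) \<longrightarrow>
    (\<forall>q\<in>frontier \<Omega>. \<forall>r>0. ennreal r \<le> hdiam \<Omega> \<longrightarrow>
       vertical_perimeter \<Omega> p (heis.mball q r) \<le> ennreal (C * r ^ 3))"
proof -
  obtain c0 where c0: "0 \<le> c0" "C0 = ennreal c0" using assms(2) by (cases C0) auto
  \<comment> \<open>The constant for small scales with the powers of \<open>\<rho>\<close> removed;
    large scales contribute \<open>64 powr p\<close>.\<close>
  define K where "K = A powr p * (2 powr p * (165888 * A) powr (p - 1)) * (165888 * ((2592 * A * 8 ^ 4) powr p * c0))"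
  have K: "0 \<le> K" using c0 by (simp add: K_def)
  show ?thesis
  proof (rule exI[of _ "(K + 64 powr p) powr (1 / p)"], intro allI impI ballI)
    fix \<Omega> :: "heis set" and q r
    assume H: "open \<Omega> \<and> \<Omega> \<noteq> {} \<and> regular3 A (frontier \<Omega>) \<and>
      (\<forall>p0\<in>frontier \<Omega>. \<forall>R>0. ennreal R \<le> hdiam \<Omega> \<longrightarrow>
       (\<integral>\<^sup>+q\<in>heis.mball p0 R \<inter> frontier \<Omega>.
          (\<integral>\<^sup>+r\<in>{0<..<R}. ennreal_powr (beta1 (frontier \<Omega>) q r) p / ennreal r \<partial>lborel)
        \<partial>hausdorff3) \<le> C0 * ennreal (R ^ 3))"
      and q: "q \<in> frontier \<Omega>" and r: "0 < r" "ennreal r \<le> hdiam \<Omega>"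
    then have \<Omega>: "open \<Omega>" and reg: "regular3 A (frontier \<Omega>)" by blast+
    have A: "1 \<le> A" using reg by (simp add: regular3_def)
    obtain \<rho> where \<rho>: "0 \<le> \<rho>" "\<rho> \<le> r" "ennreal \<rho> \<le> hdiam (frontier \<Omega>)"
      and v: "\<And>s. vertical_var \<Omega> (heis.mball q r) s \<le> ennreal (4 * \<rho> ^ 4)"
      and UF: "\<And>u s. u \<in> heis.mball q r \<Longrightarrow> 0 < \<rho> \<Longrightarrow> s < \<rho> / 16 \<Longrightarrow> frontier \<Omega> \<inter> heis.mball u (3 * s) \<subseteq> heis.mball q (2 * \<rho>)"
      using frontier_scale[OF \<Omega> q r(1)] by blast
    show "vertical_perimeter \<Omega> p (heis.mball q r) \<le> ennreal ((K + 64 powr p) powr (1 / p) * r ^ 3)"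
    \<comment> \<open>For \<open>\<rho> = 0\<close> the volume bound makes the vertical variation
      vanish at every scale.\<close>
    proof (cases "\<rho> = 0")
      case True
      then show ?thesis using v by (simp add: vertical_perimeter_eq_0)
    next
      case False
      then have \<rho>0: "0 < \<rho>" using \<rho> by simp
      \<comment> \<open>The Carleson hypothesis limits radii by the diameter of
        \<open>\<Omega>\<close>, regularity by that of the frontier; \<open>\<rho> \<le> r\<close>
        supplies the former.\<close>
      have R: "ennreal (\<rho> / 2) \<le> hdiam \<Omega>" using order_trans[OF ennreal_leI r(2), of "\<rho> / 2"] \<rho> by simp
      have carl: "(\<integral>\<^sup>+q\<in>heis.mball x (\<rho> / 2) \<inter> frontier \<Omega>.
        (\<integral>\<^sup>+r\<in>{0<..<\<rho> / 2}. ennreal_powr (beta1 (frontier \<Omega>) q r) p / ennreal r \<partial>lborel) \<partial>hausdorff3)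
        \<le> ennreal (c0 * \<rho> ^ 3)" if x: "x \<in> frontier \<Omega>" for x
      proof -
        have "(\<integral>\<^sup>+q\<in>heis.mball x (\<rho> / 2) \<inter> frontier \<Omega>.
          (\<integral>\<^sup>+r\<in>{0<..<\<rho> / 2}. ennreal_powr (beta1 (frontier \<Omega>) q r) p / ennreal r \<partial>lborel) \<partial>hausdorff3)
          \<le> C0 * ennreal ((\<rho> / 2) ^ 3)"
          using H x R \<rho>0 by simp
        also have "\<dots> = ennreal (c0 * (\<rho> / 2) ^ 3)" using c0 \<rho> by (simp add: ennreal_mult)
        also have "\<dots> \<le> ennreal (c0 * \<rho> ^ 3)"
          using c0 \<rho> by (intro ennreal_leI mult_left_mono power_mono) auto
        finally show ?thesis .
      qed
      have UF': "frontier \<Omega> \<inter> heis.mball u (3 * s) \<subseteq> heis.mball q (2 * \<rho>)"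
        if "u \<in> heis.mball q r" "s < \<rho> / 16" for u s
        using UF[OF that(1) \<rho>0 that(2)] .
      have c: "0 \<le> c0 * \<rho> ^ 3" using c0 \<rho> by simp
      have "\<exists>G\<in>borel_measurable borel.
        (\<forall>s. 0 < s \<longrightarrow> s < \<rho> / 16 \<longrightarrow> ennreal_powr (vertical_var \<Omega> (heis.mball q r) s / ennreal s) p / ennreal s \<le> G s) \<and>
        (\<integral>\<^sup>+s\<in>{0<..<\<rho> / 16}. G s \<partial>lborel)
          \<le> ennreal (A powr p * (2 powr p * (165888 * A * \<rho> ^ 3) powr (p - 1)) * (165888 * ((2592 * A * 8 ^ 4) powr p * (c0 * \<rho> ^ 3))))"
        by (rule vertical_perimeter_small_scales[OF \<Omega> reg assms(1) \<rho>0 \<rho>(3) sets_hball[of q r]]; fact UF' c carl)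
      then obtain G where G: "G \<in> borel_measurable borel"
        "\<And>s. 0 < s \<Longrightarrow> s < \<rho> / 16 \<Longrightarrow> ennreal_powr (vertical_var \<Omega> (heis.mball q r) s / ennreal s) p / ennreal s \<le> G s"
        "(\<integral>\<^sup>+s\<in>{0<..<\<rho> / 16}. G s \<partial>lborel)
          \<le> ennreal (A powr p * (2 powr p * (165888 * A * \<rho> ^ 3) powr (p - 1)) * (165888 * ((2592 * A * 8 ^ 4) powr p * (c0 * \<rho> ^ 3))))"
        by blast
      \<comment> \<open>One factor \<open>\<rho> ^ 3\<close> from the Carleson bound completes the
        exponent \<open>p - 1\<close> from Jensen's inequality to \<open>p\<close>.\<close>
      have "(165888 * A * \<rho> ^ 3) powr (p - 1) * \<rho> ^ 3 = (165888 * A) powr (p - 1) * (\<rho> ^ 3) powr p"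
        using \<rho>0 A powr_add[of "\<rho> ^ 3" "p - 1" 1] by (simp add: powr_mult)
      then have "A powr p * (2 powr p * (165888 * A * \<rho> ^ 3) powr (p - 1)) * (165888 * ((2592 * A * 8 ^ 4) powr p * (c0 * \<rho> ^ 3)))
        = K * (\<rho> ^ 3) powr p"
        unfolding K_def by (simp add: mult_ac)
      then have "vertical_perimeter \<Omega> p (heis.mball q r) \<le> ennreal ((K + 64 powr p) powr (1 / p) * \<rho> ^ 3)"
        using G by (intro vertical_perimeter_le[OF v assms(1) \<rho>0 G(1,2) _ K]) auto
      also have "\<dots> \<le> ennreal ((K + 64 powr p) powr (1 / p) * r ^ 3)"
        using \<rho> by (intro ennreal_leI mult_left_mono power_mono) auto
      finally show ?thesis .
    qed
  qed
qed

end
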